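(* Let $G=(V,E)$ be a finite simple undirected graph that is cubic (every vertex has degree $3$) and $3$-edge connected, and let $n=|V|$. Then $G$ has a $2$-edge connected spanning subgraph with at most $\frac{7}{6}n$ edges.
   Context: For $A\subset V$ with $A\neq\emptyset$ and $A\neq V$, the cut $\delta(A)$ is the set of edges of $G$ with exactly one endpoint in $A$. A graph is $k$-edge connected if every such cut has at least $k$ edges. A subgraph $H=(V_H,E_H)$ of $G$ has $V_H\subseteq V$ and $E_H\subseteq E$ (so no edge is used more than once), where $uv\in E_H$ implies $u,v\in V_H$; it is spanning if $V_H=V$. A subgraph is $2$-edge connected if it is $2$-edge connected as a graph in its own right. *)

theory Defs
  imports Complex_Main
begin

(* A graph is given by its vertex set V and its edge set E, an undirected edge uv being the
   two-element set {u, v}; loops and parallel edges are thus excluded. *)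

definition finite_simple_graph :: "'a set \<Rightarrow> 'a set set \<Rightarrow> bool" where
  "finite_simple_graph V E \<longleftrightarrow>
     finite V \<and> (\<forall>e\<in>E. \<exists>u\<in>V. \<exists>v\<in>V. u \<noteq> v \<and> e = {u, v})"

definition vertex_degree :: "'a set set \<Rightarrow> 'a \<Rightarrow> nat" where
  "vertex_degree E v = card {e \<in> E. v \<in> e}"

definition cubic :: "'a set \<Rightarrow> 'a set set \<Rightarrow> bool" where
  "cubic V E \<longleftrightarrow> (\<forall>v\<in>V. vertex_degree E v = 3)"

definition edge_cut :: "'a set set \<Rightarrow> 'a set \<Rightarrow> 'a set set" where
  "edge_cut E A = {e \<in> E. card (e \<inter> A) = 1}"

(* Graphs with at most one vertex have no such A and are k-edge connected for every k. *)
definition edge_connected :: "nat \<Rightarrow> 'a set \<Rightarrow> 'a set set \<Rightarrow> bool" where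
  "edge_connected k V E \<longleftrightarrow>
     (\<forall>A. A \<subseteq> V \<and> A \<noteq> {} \<and> A \<noteq> V \<longrightarrow> k \<le> card (edge_cut E A))"

definition subgraph :: "'a set \<Rightarrow> 'a set set \<Rightarrow> 'a set \<Rightarrow> 'a set set \<Rightarrow> bool" where
  "subgraph V\<^sub>H E\<^sub>H V E \<longleftrightarrow> V\<^sub>H \<subseteq> V \<and> E\<^sub>H \<subseteq> E \<and> (\<forall>e\<in>E\<^sub>H. e \<subseteq> V\<^sub>H)"

definition spanning_subgraph :: "'a set \<Rightarrow> 'a set set \<Rightarrow> 'a set \<Rightarrow> 'a set set \<Rightarrow> bool" where
  "spanning_subgraph V\<^sub>H E\<^sub>H V E \<longleftrightarrow> subgraph V\<^sub>H E\<^sub>H V E \<and> V\<^sub>H = V"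

end

theory Submission
  imports Defs
begin

text \<open>By induction on the number of vertices we show a weighted statement: for every real edge
  weighting \<open>w\<close> some edge set \<open>M\<close> with \<open>w M \<ge> 2/9 w E\<close> can be deleted so that a \<open>2\<close>-edge
  connected graph remains. For unit weights this gives \<open>|E - M| \<le> 7/9 |E| = 7/6 n\<close>.

  Arbitrary weights make the claim compatible with 3-edge cuts: contract either side, and give the
  three star edges of one graph weights that encode what the other side can gain. Hence all 3-edge
  cuts may be assumed trivial; then only \<open>K\<^sub>4\<close> has triangles. A square is treated by deleting one of
  its edges and suppressing the two endpoints. If there is no square, take a path \<open>u, v, x, y\<close>,
  delete \<open>uv\<close> and \<open>xy\<close> and suppress all four vertices. If the reduced graph is 3-edge connected,
  this proves the claim unless \<open>4 (w(uv) + w(xy)) < 2 w(vx) + s(u) + s(y)\<close>, where \<open>s\<close> sums the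
  weights at a vertex. By uncrossing 4-edge cuts, of the two ways to pair the end edges around
  a given middle edge, one gives two admissible paths. Adding their inequalities over all middle
  edges yields \<open>12 w(E) < 12 w(E)\<close>.\<close>

subsection \<open>Cuts and \<open>2\<close>-edge connected graphs\<close>

text \<open>The graphs are simple, so suppressing vertices must not create parallel edges. This
  shapes the case split: a coincidence among the outer neighbours, or a new edge that is already
  present, betrays a triangle or a square, and these are settled before the path reduction. The
  weights of new edges record exchanges: when a new edge is deleted, some old edge is deleted in
  place of one that would be deleted otherwise, so the weight is a difference. It may be negative,
  hence the induction runs over real weights; deleted edges of negative weight can be restored, so
  the local arguments may assume nonnegative weights. The constant 2/9 is tight for the path: its
  four vertices meet nine edges, two of them are deleted, and for unit weights all three new edges
  get weight 0. Deleting two edges lowers a cut by at most two, and nontrivial cuts have at least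
  four edges, so only a 4-edge cut through both deleted edges can spoil 3-edge connectivity. This is
  why 4-edge cuts are the ones to uncross.\<close>

lemma card_doubleton_Int_eq_1: "a \<noteq> b \<Longrightarrow> card ({a, b} \<inter> A) = 1 \<longleftrightarrow> (a \<in> A) \<noteq> (b \<in> A)"
  by (cases "a \<in> A"; cases "b \<in> A") (auto simp: Int_insert_left)

lemma finite_simple_graph_finite_edges:
  assumes "finite_simple_graph V E" shows "finite E"
proof (rule finite_subset)
  show "E \<subseteq> Pow V" using assms unfolding finite_simple_graph_def by auto
  show "finite (Pow V)" using assms unfolding finite_simple_graph_def by auto
qed

lemma finite_simple_graph_edge_subset:
  "finite_simple_graph V E \<Longrightarrow> e \<in> E \<Longrightarrow> e \<subseteq> V"
  unfolding finite_simple_graph_def by fastforce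

lemma finite_simple_graph_edgeE:
  assumes "finite_simple_graph V E" "e \<in> E"
  obtains u v where "u \<in> V" "v \<in> V" "u \<noteq> v" "e = {u, v}"
proof -
  from assms have "\<exists>u\<in>V. \<exists>v\<in>V. u \<noteq> v \<and> e = {u, v}" unfolding finite_simple_graph_def by simp
  then show thesis by (elim bexE conjE) (rule that)
qed

lemma finite_simple_graph_mono:
  "finite_simple_graph V E \<Longrightarrow> V \<subseteq> W \<Longrightarrow> finite W \<Longrightarrow> F \<subseteq> E \<Longrightarrow> finite_simple_graph W F"
  unfolding finite_simple_graph_def by (meson subsetD)

lemma finite_simple_graph_insert:
  "finite_simple_graph V (insert {a, b} E) \<longleftrightarrow>
     a \<in> V \<and> b \<in> V \<and> a \<noteq> b \<and> finite_simple_graph V E"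
  unfolding finite_simple_graph_def by (auto simp: doubleton_eq_iff)

lemma finite_simple_graph_Un:
  "finite_simple_graph V (E \<union> F) \<longleftrightarrow> finite_simple_graph V E \<and> finite_simple_graph V F"
  unfolding finite_simple_graph_def by (auto simp: ball_Un)

abbreviation cut_size :: "'a set set \<Rightarrow> 'a set \<Rightarrow> nat" where
  "cut_size F A \<equiv> card (edge_cut F A)"

lemma finite_edge_cut: "finite F \<Longrightarrow> finite (edge_cut F A)"
  unfolding edge_cut_def by simp

lemma edge_cut_mono: "F \<subseteq> F' \<Longrightarrow> edge_cut F A \<subseteq> edge_cut F' A"
  unfolding edge_cut_def by auto

lemma cut_size_mono: "F \<subseteq> F' \<Longrightarrow> finite F' \<Longrightarrow> cut_size F A \<le> cut_size F' A"
  by (simp add: card_mono edge_cut_mono finite_edge_cut)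

lemma cut_size_insert:
  assumes "finite F" "a \<noteq> b" "{a, b} \<notin> F"
  shows "cut_size (insert {a, b} F) A = cut_size F A + of_bool ((a \<in> A) \<noteq> (b \<in> A))"
proof -
  have "edge_cut (insert {a, b} F) A =
      (if (a \<in> A) \<noteq> (b \<in> A) then insert {a, b} (edge_cut F A) else edge_cut F A)"
    unfolding edge_cut_def using card_doubleton_Int_eq_1[OF assms(2)] by auto
  moreover have "{a, b} \<notin> edge_cut F A" using assms(3) by (simp add: edge_cut_def)
  ultimately show ?thesis using assms(1) by (simp add: finite_edge_cut)
qed

text \<open>Subdivision replaces an edge \<open>{a, b}\<close> that may also belong to
  \<open>F\<close>; inserting it then adds nothing, so only an upper bound is available.\<close>

lemma cut_size_insert_le:
  assumes "finite F" "a \<noteq> b"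
  shows "cut_size (insert {a, b} F) A \<le> cut_size F A + of_bool ((a \<in> A) \<noteq> (b \<in> A))"
  using assms cut_size_insert[of F a b A] by (cases "{a, b} \<in> F") (auto simp: insert_absorb)

lemma cut_size_Un_disjoint:
  assumes "finite E" "finite F" "E \<inter> F = {}"
  shows "cut_size (E \<union> F) A = cut_size E A + cut_size F A"
proof -
  have "edge_cut (E \<union> F) A = edge_cut E A \<union> edge_cut F A" "edge_cut E A \<inter> edge_cut F A = {}"
    using assms(3) unfolding edge_cut_def by auto
  then show ?thesis using assms by (simp add: card_Un_disjoint finite_edge_cut)
qed

lemma edge_cut_cong:
  assumes "finite_simple_graph V E" "A \<inter> V = B \<inter> V"
  shows "edge_cut E A = edge_cut E B"
proof -
  have "e \<inter> A = e \<inter> B" if "e \<in> E" for e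
    using finite_simple_graph_edge_subset[OF assms(1) that] assms(2) by blast
  then show ?thesis unfolding edge_cut_def by auto
qed

lemma edge_cut_compl:
  assumes "finite_simple_graph V E"
  shows "edge_cut E (V - A) = edge_cut E A"
proof -
  have "card (e \<inter> (V - A)) = 1 \<longleftrightarrow> card (e \<inter> A) = 1" if e: "e \<in> E" for e
  proof -
    obtain u v where "u \<in> V" "v \<in> V" "u \<noteq> v" "e = {u, v}"
      by (rule finite_simple_graph_edgeE[OF assms e])
    then show ?thesis using card_doubleton_Int_eq_1[of u v] by auto
  qed
  then show ?thesis unfolding edge_cut_def by auto
qed

text \<open>Submodularity holds edge by edge: in each of the 16 positions of its endpoints an edge
  contributes at least as much to the right as to the left. All uncrossing arguments rest on
  this.\<close>

lemma cut_size_submodular: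
  assumes "finite_simple_graph V E"
  shows "cut_size E (A \<inter> B) + cut_size E (A \<union> B) \<le> cut_size E A + cut_size E B"
proof -
  have "finite E" using assms by (rule finite_simple_graph_finite_edges)
  then show ?thesis using assms
  proof (induction E)
    case empty then show ?case by (simp add: edge_cut_def)
  next
    case (insert e E)
    obtain a b where ab: "a \<noteq> b" "e = {a, b}"
      by (rule finite_simple_graph_edgeE[OF insert.prems, of e]) simp
    have "finite_simple_graph V E"
      using insert.prems unfolding finite_simple_graph_def by simp
    then have "cut_size E (A \<inter> B) + cut_size E (A \<union> B) \<le> cut_size E A + cut_size E B"
      by (rule insert.IH)
    then show ?case
      using cut_size_insert[OF insert.hyps(1) ab(1)] insert.hyps(2) ab(2)
      by (cases "a \<in> A"; cases "b \<in> A"; cases "a \<in> B"; cases "b \<in> B") simp_all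
  qed
qed

text \<open>Turns degrees into cuts, so that cubicity of a reduced graph can be read off its
  explicit cut formula.\<close>

lemma cut_size_singleton:
  assumes "finite_simple_graph V E"
  shows "cut_size E {v} = vertex_degree E v"
proof -
  have "card (e \<inter> {v}) = 1 \<longleftrightarrow> v \<in> e" for e :: "'a set"
    by (cases "v \<in> e") auto
  then show ?thesis unfolding edge_cut_def vertex_degree_def by simp
qed

section \<open>Subdivisions and ears\<close>

definition two_edge_connected :: "'a set \<Rightarrow> 'a set set \<Rightarrow> bool" where
  "two_edge_connected V F \<longleftrightarrow> finite_simple_graph V F \<and> edge_connected 2 V F"

lemma two_edge_connectedD:
  "two_edge_connected V F \<Longrightarrow> A \<subseteq> V \<Longrightarrow> A \<noteq> {} \<Longrightarrow> A \<noteq> V \<Longrightarrow> 2 \<le> cut_size F A"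
  unfolding two_edge_connected_def edge_connected_def by blast

lemma edge_connected_mono:
  "edge_connected k V F \<Longrightarrow> F \<subseteq> F' \<Longrightarrow> finite F' \<Longrightarrow> edge_connected k V F'"
  unfolding edge_connected_def by (meson cut_size_mono le_trans)

lemma two_edge_connected_mono:
  "two_edge_connected V F \<Longrightarrow> F \<subseteq> F' \<Longrightarrow> finite_simple_graph V F' \<Longrightarrow> two_edge_connected V F'"
  unfolding two_edge_connected_def
  using edge_connected_mono finite_simple_graph_finite_edges by blast

text \<open>A cut that separates \<open>a\<close> from \<open>b\<close> also separates
  \<open>u\<close> from one of them, so no old cut shrinks. The only new cuts are \<open>{u}\<close>
  and its complement, and both new edges cross them.\<close>

lemma two_edge_connected_subdivide:
  assumes "two_edge_connected V (insert {a, b} F)" "u \<notin> V"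
  shows "two_edge_connected (insert u V) (insert {u, a} (insert {u, b} F))"
proof -
  have ab: "a \<in> V" "b \<in> V" "a \<noteq> b" and F: "finite_simple_graph V F" and V: "finite V"
    using assms(1) unfolding two_edge_connected_def finite_simple_graph_insert
    by (auto simp: finite_simple_graph_def)
  have fin: "finite F" by (rule finite_simple_graph_finite_edges[OF F])
  have fsg: "finite_simple_graph (insert u V) (insert {u, a} (insert {u, b} F))"
    using ab assms(2) V finite_simple_graph_mono[OF F, of "insert u V" F]
    by (auto simp: finite_simple_graph_insert)
  have new: "{u, z} \<notin> F" for z
    using finite_simple_graph_edge_subset[OF F, of "{u, z}"] assms(2) by auto
  have cut: "cut_size (insert {u, a} (insert {u, b} F)) A
      = cut_size F (A \<inter> V) + of_bool ((u \<in> A) \<noteq> (a \<in> A)) + of_bool ((u \<in> A) \<noteq> (b \<in> A))" for A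
  proof -
    have "u \<noteq> a" "u \<noteq> b" using ab assms(2) by auto
    then show ?thesis
      using new fin ab(3) edge_cut_cong[OF F, of A "A \<inter> V"]
      by (simp add: cut_size_insert doubleton_eq_iff)
  qed
  have "2 \<le> cut_size (insert {u, a} (insert {u, b} F)) A"
    if A: "A \<subseteq> insert u V" "A \<noteq> {}" "A \<noteq> insert u V" for A
  proof -
    consider "A \<inter> V = {}" | "A \<inter> V = V" | "A \<inter> V \<noteq> {}" "A \<inter> V \<noteq> V" by blast
    then show ?thesis
    proof cases
      case 1
      then have "u \<in> A" "a \<notin> A" "b \<notin> A" using A ab by auto
      then show ?thesis unfolding cut by simp
    next
      case 2
      then have "u \<notin> A" "a \<in> A" "b \<in> A" using A ab by auto
      then show ?thesis unfolding cut by simp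
    next
      case 3
      then have "2 \<le> cut_size (insert {a, b} F) (A \<inter> V)"
        using two_edge_connectedD[OF assms(1), of "A \<inter> V"] by blast
      also have "\<dots> \<le> cut_size F (A \<inter> V) + of_bool ((a \<in> A) \<noteq> (b \<in> A))"
        using cut_size_insert_le[OF fin ab(3), of "A \<inter> V"] ab by simp
      finally show ?thesis unfolding cut by (auto simp: of_bool_def split: if_splits)
    qed
  qed
  then show ?thesis using fsg unfolding two_edge_connected_def edge_connected_def by blast
qed

text \<open>An ear with one inner vertex is a chord that has been added and then subdivided.\<close>

lemma two_edge_connected_add_ear1:
  assumes "two_edge_connected V F" "a \<in> V" "b \<in> V" "a \<noteq> b" "u \<notin> V"
  shows "two_edge_connected (insert u V) (insert {u, a} (insert {u, b} F))"
proof (rule two_edge_connected_subdivide[OF two_edge_connected_mono[OF assms(1)] assms(5)])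
  show "finite_simple_graph V (insert {a, b} F)"
    using assms by (simp add: finite_simple_graph_insert two_edge_connected_def)
qed auto

text \<open>The ends \<open>a\<close> and \<open>b\<close> may coincide, in which case the ear is a
  triangle through \<open>a\<close>. A chord \<open>{a, b}\<close> to subdivide is then not at hand,
  so the cuts are counted directly.\<close>

lemma two_edge_connected_add_ear2:
  assumes "two_edge_connected V F" "a \<in> V" "b \<in> V" "u \<notin> V" "v \<notin> V" "u \<noteq> v"
  shows "two_edge_connected (insert v (insert u V))
           (insert {u, a} (insert {u, v} (insert {v, b} F)))"
proof -
  have F: "finite_simple_graph V F" and V: "finite V"
    using assms(1) unfolding two_edge_connected_def by (auto simp: finite_simple_graph_def)
  have fin: "finite F" by (rule finite_simple_graph_finite_edges[OF F])
  have fsg: "finite_simple_graph (insert v (insert u V))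
           (insert {u, a} (insert {u, v} (insert {v, b} F)))"
    using assms V finite_simple_graph_mono[OF F, of "insert v (insert u V)" F]
    by (auto simp: finite_simple_graph_insert)
  have new: "{u, z} \<notin> F" "{v, z} \<notin> F" for z
    using finite_simple_graph_edge_subset[OF F, of "{u, z}"]
      finite_simple_graph_edge_subset[OF F, of "{v, z}"] assms by auto
  have cut: "cut_size (insert {u, a} (insert {u, v} (insert {v, b} F))) A
      = cut_size F (A \<inter> V) + of_bool ((u \<in> A) \<noteq> (a \<in> A)) + of_bool ((u \<in> A) \<noteq> (v \<in> A))
        + of_bool ((v \<in> A) \<noteq> (b \<in> A))" for A
  proof -
    have "u \<noteq> a" "v \<noteq> b" "v \<noteq> a" "u \<noteq> b" using assms by auto
    then show ?thesis
      using new fin assms(6) edge_cut_cong[OF F, of A "A \<inter> V"]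
      by (simp add: cut_size_insert doubleton_eq_iff)
  qed
  have "2 \<le> cut_size (insert {u, a} (insert {u, v} (insert {v, b} F))) A"
    if A: "A \<subseteq> insert v (insert u V)" "A \<noteq> {}" "A \<noteq> insert v (insert u V)" for A
  proof -
    consider "A \<inter> V = {}" | "A \<inter> V = V" | "A \<inter> V \<noteq> {}" "A \<inter> V \<noteq> V" by blast
    then show ?thesis
    proof cases
      case 1
      then have "u \<in> A \<or> v \<in> A" "a \<notin> A" "b \<notin> A" using A assms by auto
      then show ?thesis unfolding cut by (cases "u \<in> A"; cases "v \<in> A") auto
    next
      case 2
      then have "u \<notin> A \<or> v \<notin> A" "a \<in> A" "b \<in> A" using A assms by auto
      then show ?thesis unfolding cut by (cases "u \<in> A"; cases "v \<in> A") auto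
    next
      case 3
      then have "2 \<le> cut_size F (A \<inter> V)"
        using two_edge_connectedD[OF assms(1), of "A \<inter> V"] by blast
      then show ?thesis unfolding cut by simp
    qed
  qed
  then show ?thesis using fsg unfolding two_edge_connected_def edge_connected_def by blast
qed

subsection \<open>Weighted removal of edges\<close>

definition cubic_3_edge_connected :: "'a set \<Rightarrow> 'a set set \<Rightarrow> bool" where
  "cubic_3_edge_connected V E \<longleftrightarrow> finite_simple_graph V E \<and> cubic V E \<and> edge_connected 3 V E"

definition removable :: "'a set \<Rightarrow> 'a set set \<Rightarrow> ('a set \<Rightarrow> real) \<Rightarrow> bool" where
  "removable V E w \<longleftrightarrow> (\<exists>M\<subseteq>E. two_edge_connected V (E - M) \<and> 2 / 9 * sum w E \<le> sum w M)"

text \<open>The weights of the new edges are prescribed on an index set: in the gluing the index is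
  an old cut edge and \<open>n\<close> sends it to a star edge. Injectivity of \<open>n\<close> lets
  \<nu> be transported to the new edges, and disjointness keeps it apart from
  \<open>w\<close>.\<close>

lemma removable_indexed:
  fixes w :: "'a set \<Rightarrow> real"
  assumes fin: "finite E" "finite I" and inj: "inj_on n I" and disj: "E \<inter> n ` I = {}"
    and rem: "\<And>w'. removable V (E \<union> n ` I) w'"
  obtains M J where "M \<subseteq> E" "J \<subseteq> I" "two_edge_connected V ((E - M) \<union> n ` (I - J))"
    "2 / 9 * (sum w E + sum \<nu> I) \<le> sum w M + sum \<nu> J"
proof -
  define w' where "w' = (\<lambda>e. if e \<in> n ` I then \<nu> (inv_into I n e) else w e)"
  have w'n: "sum w' (n ` J) = sum \<nu> J" if "J \<subseteq> I" for J
  proof -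
    have "inj_on n J" using inj that by (rule inj_on_subset)
    then have "sum w' (n ` J) = sum (w' \<circ> n) J" by (rule sum.reindex)
    also have "\<dots> = sum \<nu> J"
    proof (rule sum.cong)
      fix i assume "i \<in> J"
      with that have "i \<in> I" by blast
      then show "(w' \<circ> n) i = \<nu> i" by (simp add: w'_def inv_into_f_f[OF inj])
    qed simp
    finally show ?thesis .
  qed
  have w'E: "sum w' X = sum w X" if "X \<subseteq> E" for X
    using that disj by (intro sum.cong) (auto simp: w'_def)
  obtain M where M: "M \<subseteq> E \<union> n ` I" "two_edge_connected V (E \<union> n ` I - M)"
    "2 / 9 * sum w' (E \<union> n ` I) \<le> sum w' M"
    using rem[of w'] unfolding removable_def by blast
  define J where "J = {i \<in> I. n i \<in> M}"
  have J: "J \<subseteq> I" and M_eq: "M = (M \<inter> E) \<union> n ` J"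
    using M(1) unfolding J_def by auto
  have "E \<union> n ` I - M = (E - M \<inter> E) \<union> n ` (I - J)"
    using disj unfolding J_def by auto
  with M(2) have tec: "two_edge_connected V ((E - M \<inter> E) \<union> n ` (I - J))" by simp
  have "sum w' M = sum w' (M \<inter> E) + sum w' (n ` J)"
    using fin J disj by (subst M_eq, subst sum.union_disjoint)
      (auto intro: finite_subset)
  then have "sum w' M = sum w (M \<inter> E) + sum \<nu> J"
    using w'n[OF J] w'E[of "M \<inter> E"] by simp
  moreover have "sum w' (E \<union> n ` I) = sum w E + sum \<nu> I"
    using fin disj w'n[of I] w'E[of E] by (subst sum.union_disjoint) auto
  ultimately show thesis using that[OF _ J tec] M(3) by simp
qed

text \<open>A local reduction replaces the edges \<open>L\<close> by the edges \<open>n ` I\<close>. The numbers \<open>\<nu> i\<close> are the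
  weights given to the new edges, and \<open>C\<close> is the gain when none of them is removed.\<close>

lemma removable_lift:
  fixes w :: "'a set \<Rightarrow> real"
  assumes fin: "finite E0" "finite L" "finite I"
    and inj: "inj_on n I" and disj: "E0 \<inter> n ` I = {}" "E0 \<inter> L = {}"
    and IH: "\<And>w'. removable V' (E0 \<union> n ` I) w'"
    and lift: "\<And>J X. J \<subseteq> I \<Longrightarrow> X \<subseteq> E0 \<Longrightarrow> two_edge_connected V' (X \<union> n ` (I - J)) \<Longrightarrow>
       \<exists>R\<subseteq>L. two_edge_connected V (X \<union> (L - R)) \<and> C + sum \<nu> J \<le> sum w R"
    and gain: "2 / 9 * sum w L \<le> C + 2 / 9 * sum \<nu> I"
  shows "removable V (E0 \<union> L) w"
proof -
  obtain M J where M: "M \<subseteq> E0" "J \<subseteq> I" "two_edge_connected V' ((E0 - M) \<union> n ` (I - J))"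
    "2 / 9 * (sum w E0 + sum \<nu> I) \<le> sum w M + sum \<nu> J"
    by (rule removable_indexed[OF fin(1,3) inj disj(1) IH])
  from lift[OF M(2) _ M(3)] obtain R where R: "R \<subseteq> L"
    "two_edge_connected V ((E0 - M) \<union> (L - R))" "C + sum \<nu> J \<le> sum w R" by blast
  have "sum w (E0 \<union> L) = sum w E0 + sum w L"
    using fin disj by (subst sum.union_disjoint) auto
  moreover have "sum w (M \<union> R) = sum w M + sum w R"
    using fin disj R M(1) by (subst sum.union_disjoint) (auto intro: finite_subset)
  moreover have "E0 \<union> L - (M \<union> R) = (E0 - M) \<union> (L - R)" using disj R(1) M(1) by blast
  \<comment> \<open>The account is w(M) + w(R) \<ge> w(M) + C + \<nu>(J) \<ge> C + 2/9 (w(E0) +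
    \<nu>(I)) \<ge> 2/9 (w(E0) + w(L)), using in turn the bound on \<open>R\<close>, the bound on
    \<open>M\<close> and \<open>gain\<close>.\<close>
  ultimately show ?thesis
    unfolding removable_def
    using R M(1,4) gain by (intro exI[of _ "M \<union> R"]) auto
qed

text \<open>Restoring the deleted edges of negative weight keeps the graph 2-edge connected, and
  what stays deleted weighs as much as \<open>M\<close> under the truncated weights.\<close>

lemma removable_if_nonneg:
  assumes "finite_simple_graph V E" "removable V E (\<lambda>e. max 0 (w e))"
  shows "removable V E w"
proof -
  obtain M where M: "M \<subseteq> E" "two_edge_connected V (E - M)"
    "2 / 9 * (\<Sum>e\<in>E. max 0 (w e)) \<le> (\<Sum>e\<in>M. max 0 (w e))"
    using assms(2) unfolding removable_def by blast
  define M' where "M' = {e \<in> M. 0 \<le> w e}"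
  have fin: "finite E" by (rule finite_simple_graph_finite_edges[OF assms(1)])
  have "(\<Sum>e\<in>M. max 0 (w e)) = sum w M'"
    unfolding M'_def using finite_subset[OF M(1) fin]
    by (subst sum.inter_filter) (auto intro!: sum.cong)
  moreover have "sum w E \<le> (\<Sum>e\<in>E. max 0 (w e))" by (intro sum_mono) auto
  moreover have "two_edge_connected V (E - M')"
    using assms(1) by (intro two_edge_connected_mono[OF M(2)])
      (auto simp: M'_def finite_simple_graph_def)
  ultimately show ?thesis
    unfolding removable_def using M by (intro exI[of _ M']) (auto simp: M'_def)
qed

subsection \<open>Deleting the end edges of a path\<close>

text \<open>The propositional core of the cut argument. \<open>A\<close>, \<open>B\<close> say
  whether the outer neighbours of \<open>u\<close> lie in the cut, \<open>C\<close> and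
  \<open>D\<close> do so for those of \<open>v\<close> and \<open>x\<close>, and \<open>P\<close>,
  \<open>Q\<close> for those of \<open>y\<close>; \<open>f\<close> is the size of the extended cut
  as a function of the positions of \<open>u\<close>, \<open>v\<close>, \<open>x\<close>,
  \<open>y\<close>.\<close>

lemma path_placement:
  fixes f :: "bool \<Rightarrow> bool \<Rightarrow> bool \<Rightarrow> bool \<Rightarrow> nat"
  assumes f: "\<And>bu bv bx yb. f bu bv bx yb = n + of_bool (bu \<noteq> A) + of_bool (bu \<noteq> B)
      + of_bool (bu \<noteq> bv) + of_bool (bv \<noteq> C) + of_bool (bv \<noteq> bx) + of_bool (bx \<noteq> D)
      + of_bool (bx \<noteq> yb) + of_bool (yb \<noteq> P) + of_bool (yb \<noteq> Q)"
    and ge3: "\<And>bu bv bx yb. 3 \<le> f bu bv bx yb"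
    and ge4: "\<And>bu bv bx yb. bv = bx \<Longrightarrow> (bu \<noteq> bv \<and> (A \<longleftrightarrow> bu)) \<or> (yb \<noteq> bv \<and> (P \<longleftrightarrow> yb)) \<Longrightarrow>
      4 \<le> f bu bv bx yb"
    and ge5: "\<And>bu bv bx yb. bv = bx \<Longrightarrow> bu \<noteq> bv \<Longrightarrow> yb \<noteq> bv \<Longrightarrow> C \<longleftrightarrow> bv \<Longrightarrow> D \<longleftrightarrow> bv \<Longrightarrow>
      A \<longleftrightarrow> bu \<Longrightarrow> B \<longleftrightarrow> bu \<Longrightarrow> P \<longleftrightarrow> yb \<Longrightarrow> Q \<longleftrightarrow> yb \<Longrightarrow> 5 \<le> f bu bv bx yb"
  shows "3 \<le> n + of_bool (A \<noteq> B) + of_bool (C \<noteq> D) + of_bool (P \<noteq> Q)"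
proof -
  \<comment> \<open>\<open>u\<close> and \<open>y\<close> follow their outer neighbours whenever
    these agree, and \<open>v\<close>, \<open>x\<close> change sides at most once between
    \<open>C\<close> and \<open>D\<close>. Hence \<open>f\<close> exceeds the claimed sum exactly by
    the number of deleted edges that cross, that is, of true statements among
    \<open>bu \<noteq> bv\<close> and \<open>bx \<noteq> yb\<close>. If one crosses,
    \<open>ge4\<close> pays for it; if both do, \<open>ge5\<close> does.\<close>
  define bu where "bu = (if A = B then A else if C \<noteq> D \<and> P = Q then P else C)"
  define yb where "yb = (if P = Q then P else if C = D then C else bu)"
  define bv where "bv = (if C = D then C else bu)"
  define bx where "bx = (if C = D then C else if bu = C then yb else bu)"
  have ge4': "bv = bx \<and> ((bu \<noteq> bv \<and> (A \<longleftrightarrow> bu)) \<or> (yb \<noteq> bv \<and> (P \<longleftrightarrow> yb))) \<longrightarrow> 4 \<le> f bu bv bx yb"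
    by (intro impI, elim conjE, rule ge4)
  have ge5': "bv = bx \<and> bu \<noteq> bv \<and> yb \<noteq> bv \<and> C = bv \<and> D = bv \<and> A = bu \<and> B = bu \<and> P = yb \<and> Q = yb \<longrightarrow>
      5 \<le> f bu bv bx yb"
    by (intro impI, elim conjE, rule ge5)
  show ?thesis
    using ge3[of bu bv bx yb] ge4' ge5' unfolding f bu_def bv_def bx_def yb_def
    by (cases A; cases B; cases C; cases D; cases P; cases Q;
        simp only: simp_thms if_True if_False of_bool_eq; simp)
qed

text \<open>Built upwards from the part \<open>V0\<close>, \<open>E0\<close> that both graphs share,
  so that either graph is an explicit union: the old one adds \<open>L\<close>, the reduced one
  \<open>N\<close>. The assumptions \<open>new\<close> and \<open>new_distinct\<close> say that
  suppression creates no parallel edges.\<close>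

locale path_reduction =
  fixes V0 :: "'a set" and E0 :: "'a set set" and u v x y a b c d p q :: 'a
  assumes E0: "finite_simple_graph V0 E0"
    and path: "u \<noteq> v" "u \<noteq> x" "u \<noteq> y" "v \<noteq> x" "v \<noteq> y" "x \<noteq> y"
    and outside: "u \<notin> V0" "v \<notin> V0" "x \<notin> V0" "y \<notin> V0"
    and inside: "a \<in> V0" "b \<in> V0" "c \<in> V0" "d \<in> V0" "p \<in> V0" "q \<in> V0"
    and ends: "a \<noteq> b" "c \<noteq> d" "p \<noteq> q"
    and new: "{a, b} \<notin> E0" "{c, d} \<notin> E0" "{p, q} \<notin> E0"
    and new_distinct: "{a, b} \<noteq> {c, d}" "{a, b} \<noteq> {p, q}" "{c, d} \<noteq> {p, q}"
begin

abbreviation "V \<equiv> {u, v, x, y} \<union> V0"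
abbreviation "L \<equiv> {{u, a}, {u, b}, {u, v}, {v, c}, {v, x}, {x, d}, {x, y}, {y, p}, {y, q}}"
abbreviation "N \<equiv> {{a, b}, {c, d}, {p, q}}"

lemma neq: "a \<noteq> u" "a \<noteq> v" "a \<noteq> x" "a \<noteq> y" "b \<noteq> u" "b \<noteq> v" "b \<noteq> x" "b \<noteq> y" "c \<noteq> u" "c \<noteq> v" "c \<noteq> x"
    "c \<noteq> y" "d \<noteq> u" "d \<noteq> v" "d \<noteq> x" "d \<noteq> y" "p \<noteq> u" "p \<noteq> v" "p \<noteq> x" "p \<noteq> y" "q \<noteq> u" "q \<noteq> v"
    "q \<noteq> x" "q \<noteq> y"
  using outside inside by auto

lemmas distinctness = path path[symmetric] neq neq[symmetric] ends ends[symmetric]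

lemma finite_V0: "finite V0"
  using E0 unfolding finite_simple_graph_def by blast

lemma finite_E0: "finite E0"
  by (rule finite_simple_graph_finite_edges[OF E0])

lemma not_in_E0: "{u, z} \<notin> E0" "{v, z} \<notin> E0" "{x, z} \<notin> E0" "{y, z} \<notin> E0"
  using finite_simple_graph_edge_subset[OF E0] outside by blast+

lemma old_graph: "finite_simple_graph V (E0 \<union> L)"
proof -
  have "finite_simple_graph V E0"
    using finite_V0 by (intro finite_simple_graph_mono[OF E0]) auto
  then show ?thesis using inside distinctness by (simp add: finite_simple_graph_insert)
qed

lemma new_graph: "finite_simple_graph V0 (E0 \<union> N)"
  using E0 inside distinctness by (simp add: finite_simple_graph_insert)

lemma cut_size_old: "cut_size (E0 \<union> L) A = cut_size E0 A + of_bool ((u \<in> A) \<noteq> (a \<in> A))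
    + of_bool ((u \<in> A) \<noteq> (b \<in> A)) + of_bool ((u \<in> A) \<noteq> (v \<in> A)) + of_bool ((v \<in> A) \<noteq> (c \<in> A))
    + of_bool ((v \<in> A) \<noteq> (x \<in> A)) + of_bool ((x \<in> A) \<noteq> (d \<in> A)) + of_bool ((x \<in> A) \<noteq> (y \<in> A))
    + of_bool ((y \<in> A) \<noteq> (p \<in> A)) + of_bool ((y \<in> A) \<noteq> (q \<in> A))"
  using finite_E0 not_in_E0 distinctness
  by (simp add: cut_size_insert doubleton_eq_iff)

lemma cut_size_new: "cut_size (E0 \<union> N) A = cut_size E0 A + of_bool ((a \<in> A) \<noteq> (b \<in> A))
    + of_bool ((c \<in> A) \<noteq> (d \<in> A)) + of_bool ((p \<in> A) \<noteq> (q \<in> A))"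
  using finite_E0 new new_distinct ends by (simp add: cut_size_insert)

lemma cubic_reduced:
  assumes "cubic V (E0 \<union> L)"
  shows "cubic V0 (E0 \<union> N)"
  unfolding cubic_def
proof
  fix z assume z: "z \<in> V0"
  then have "cut_size (E0 \<union> L) {z} = 3"
    using assms unfolding cubic_def cut_size_singleton[OF old_graph] by blast
  moreover have "u \<noteq> z" "v \<noteq> z" "x \<noteq> z" "y \<noteq> z" using z outside by auto
  ultimately have "cut_size (E0 \<union> N) {z} = 3"
    unfolding cut_size_old cut_size_new using ends
    by (simp add: of_bool_def split: if_splits)
  then show "vertex_degree (E0 \<union> N) z = 3"
    unfolding cut_size_singleton[OF new_graph] .
qed

text \<open>A cut \<open>Z\<close> of the reduced graph extends to the old graph by placing \<open>u\<close>, \<open>v\<close>, \<open>x\<close>, \<open>y\<close>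
  optimally; at most the two deleted edges then cross it additionally.\<close>

lemma three_edge_connected_reduced:
  assumes conn: "edge_connected 3 V (E0 \<union> L)"
    and triv: "\<And>A s t s' t'. A \<subseteq> V \<Longrightarrow> s \<in> A \<Longrightarrow> t \<in> A \<Longrightarrow> s \<noteq> t \<Longrightarrow>
      s' \<in> V - A \<Longrightarrow> t' \<in> V - A \<Longrightarrow> s' \<noteq> t' \<Longrightarrow> 4 \<le> cut_size (E0 \<union> L) A"
    and good: "\<And>A. A \<subseteq> V \<Longrightarrow> {u, y, a, b, p, q} \<subseteq> A \<Longrightarrow> {v, x, c, d} \<inter> A = {} \<Longrightarrow>
      5 \<le> cut_size (E0 \<union> L) A"
  shows "edge_connected 3 V0 (E0 \<union> N)"
  unfolding edge_connected_def
proof (intro allI impI)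
  fix Z assume Z: "Z \<subseteq> V0 \<and> Z \<noteq> {} \<and> Z \<noteq> V0"
  define ext where "ext bu bv bx by = Z \<union> (if bu then {u} else {}) \<union> (if bv then {v} else {})
     \<union> (if bx then {x} else {}) \<union> (if by then {y} else {})" for bu bv bx "by"
  have notZ: "u \<notin> Z" "v \<notin> Z" "x \<notin> Z" "y \<notin> Z" using Z outside by auto
  have mem: "u \<in> ext bu bv bx by \<longleftrightarrow> bu" "v \<in> ext bu bv bx by \<longleftrightarrow> bv"
    "x \<in> ext bu bv bx by \<longleftrightarrow> bx" "y \<in> ext bu bv bx by \<longleftrightarrow> by"
    "z \<in> V0 \<Longrightarrow> z \<in> ext bu bv bx by \<longleftrightarrow> z \<in> Z" for bu bv bx "by" z
    using notZ path outside unfolding ext_def by auto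
  have sub: "ext bu bv bx by \<subseteq> V" for bu bv bx "by" using Z unfolding ext_def by auto
  have inter: "ext bu bv bx by \<inter> V0 = Z \<inter> V0" for bu bv bx "by"
    using outside unfolding ext_def by auto
  have proper: "ext bu bv bx by \<noteq> {}" "ext bu bv bx by \<noteq> V" for bu bv bx "by"
    using Z inter[of bu bv bx "by"] by auto
  have E0cut: "edge_cut E0 (ext bu bv bx by) = edge_cut E0 Z" for bu bv bx "by"
    by (rule edge_cut_cong[OF E0 inter])
  define f where "f bu bv bx by = cut_size (E0 \<union> L) (ext bu bv bx by)" for bu bv bx "by"
  have f: "f bu bv bx by = cut_size E0 Z + of_bool (bu \<noteq> (a \<in> Z)) + of_bool (bu \<noteq> (b \<in> Z))
      + of_bool (bu \<noteq> bv) + of_bool (bv \<noteq> (c \<in> Z)) + of_bool (bv \<noteq> bx) + of_bool (bx \<noteq> (d \<in> Z))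
      + of_bool (bx \<noteq> by) + of_bool (by \<noteq> (p \<in> Z)) + of_bool (by \<noteq> (q \<in> Z))"
    for bu bv bx "by"
    unfolding f_def cut_size_old E0cut using inside by (simp add: mem)
  have ge3: "3 \<le> f bu bv bx by" for bu bv bx "by"
    using conn[unfolded edge_connected_def, rule_format, of "ext bu bv bx by"] sub proper
    unfolding f_def by simp
  \<comment> \<open>Two vertices, \<open>u\<close> and \<open>a\<close> or else \<open>y\<close> and
    \<open>p\<close>, lie opposite to both \<open>v\<close> and \<open>x\<close>, so the cut is
    nontrivial and \<open>triv\<close> applies.\<close>
  have ge4: "4 \<le> f bu bv bx by" if vx_eq: "bv = bx" and
    cross: "(bu \<noteq> bv \<and> (a \<in> Z \<longleftrightarrow> bu)) \<or> (by \<noteq> bv \<and> (p \<in> Z \<longleftrightarrow> by))" for bu bv bx "by"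
  proof -
    obtain s t where st: "s \<in> V" "t \<in> V" "s \<noteq> t"
      "s \<in> ext bu bv bx by \<longleftrightarrow> \<not> bv" "t \<in> ext bu bv bx by \<longleftrightarrow> \<not> bv"
    proof (cases "bu \<noteq> bv \<and> (a \<in> Z \<longleftrightarrow> bu)")
      case True
      then show thesis using that[of u a] inside distinctness by (auto simp: mem)
    next
      case False
      with cross show thesis using that[of y p] inside distinctness by (auto simp: mem)
    qed
    have vx: "v \<in> ext bu bv bx by \<longleftrightarrow> bv" "x \<in> ext bu bv bx by \<longleftrightarrow> bv"
      using vx_eq by (simp_all add: mem)
    show ?thesis
    proof (cases bv)
      case True
      then show ?thesis
        using triv[OF sub, of v bu bv bx "by" x s t] st vx path unfolding f_def by auto
    next
      case False
      then show ?thesis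
        using triv[OF sub, of s bu bv bx "by" t v x] st vx path unfolding f_def by auto
    qed
  qed
  have ge5: "5 \<le> f bu bv bx by" if "bv = bx" "bu \<noteq> bv" "by \<noteq> bv" "c \<in> Z \<longleftrightarrow> bv" "d \<in> Z \<longleftrightarrow> bv"
    "a \<in> Z \<longleftrightarrow> bu" "b \<in> Z \<longleftrightarrow> bu" "p \<in> Z \<longleftrightarrow> by" "q \<in> Z \<longleftrightarrow> by" for bu bv bx "by"
  proof (cases bu)
    case True
    then show ?thesis using good[OF sub, of bu bv bx "by"] that inside
      unfolding f_def by (auto simp: mem)
  next
    \<comment> \<open>\<open>good\<close> is stated for the side that contains \<open>u\<close>; the
      complement has the same cut.\<close>
    case False
    then have "5 \<le> cut_size (E0 \<union> L) (V - ext bu bv bx by)"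
      using good[of "V - ext bu bv bx by"] that inside by (auto simp: mem)
    then show ?thesis unfolding f_def edge_cut_compl[OF old_graph] .
  qed
  have "3 \<le> cut_size E0 Z + of_bool ((a \<in> Z) \<noteq> (b \<in> Z)) + of_bool ((c \<in> Z) \<noteq> (d \<in> Z))
      + of_bool ((p \<in> Z) \<noteq> (q \<in> Z))"
    by (rule path_placement[OF f ge3 ge4 ge5])
  then show "3 \<le> cut_size (E0 \<union> N) Z" unfolding cut_size_new .
qed

lemma extend_two_edge_connected:
  assumes "two_edge_connected V K" "X \<subseteq> E0" "K \<subseteq> X \<union> (L - R)"
  shows "two_edge_connected V (X \<union> (L - R))"
proof (rule two_edge_connected_mono[OF assms(1,3)])
  show "finite_simple_graph V (X \<union> (L - R))"
    using finite_V0
    by (intro finite_simple_graph_mono[OF old_graph order_refl] Un_mono assms(2) Diff_subset) simp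
qed

text \<open>In each case the removed edges \<open>R\<close> are those for which \<open>L - R\<close> arises from the surviving new
  edges by subdividing them and adding ears.\<close>

lemma lift:
  assumes nonneg: "\<And>e. 0 \<le> w e"
    and order: "w {u, b} \<le> w {u, a}" "w {y, q} \<le> w {y, p}"
    and X: "X \<subseteq> E0" and J: "J \<subseteq> N" and tec: "two_edge_connected V0 (X \<union> (N - J))"
  defines "\<nu> \<equiv> (\<lambda>e. if e = {a, b} then w {u, a} - w {u, v}
      else if e = {p, q} then w {y, p} - w {x, y}
      else w {v, c} + w {x, d} - w {u, v} - w {x, y})"
  shows "\<exists>R\<subseteq>L. two_edge_connected V (X \<union> (L - R)) \<and>
      w {u, v} + w {x, y} + sum \<nu> J \<le> (sum w R :: real)"
proof -
  define f g k where fgk: "f = {a, b}" "g = {c, d}" "k = {p, q}"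
  have fgk_distinct: "f \<noteq> g" "f \<noteq> k" "g \<noteq> k" using new_distinct unfolding fgk .
  have \<nu>: "\<nu> f = w {u, a} - w {u, v}" "\<nu> k = w {y, p} - w {x, y}"
    "\<nu> g = w {v, c} + w {x, d} - w {u, v} - w {x, y}"
    using new_distinct[symmetric] unfolding \<nu>_def fgk by auto
  have J': "J \<subseteq> {f, g, k}" and tec': "two_edge_connected V0 (X \<union> ({f, g, k} - J))"
    using J tec unfolding fgk .
  note ops = insert_commute distinctness outside inside
  note finish = doubleton_eq_iff distinctness
  \<comment> \<open>By default \<open>{u, v}\<close> and \<open>{x, y}\<close> are removed. Losing
    \<open>f\<close> exchanges \<open>{u, v}\<close> for \<open>{u, a}\<close>, losing
    \<open>k\<close> exchanges \<open>{x, y}\<close> for \<open>{y, p}\<close>, and losing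
    \<open>g\<close> exchanges both for \<open>{v, c}\<close> and \<open>{x, d}\<close>; \<nu> is
    the change in weight.\<close>
  consider (remove_none) "f \<notin> J" "g \<notin> J" "k \<notin> J"
    | (remove_k) "f \<notin> J" "g \<notin> J" "k \<in> J"
    | (remove_g) "f \<notin> J" "g \<in> J" "k \<notin> J"
    | (remove_gk) "f \<notin> J" "g \<in> J" "k \<in> J"
    | (remove_f) "f \<in> J" "g \<notin> J" "k \<notin> J"
    | (remove_fk) "f \<in> J" "g \<notin> J" "k \<in> J"
    | (remove_fg) "f \<in> J" "g \<in> J" "k \<notin> J"
    | (remove_fgk) "f \<in> J" "g \<in> J" "k \<in> J"
    by blast
  then show ?thesis
  proof cases
    case remove_none
    then have J_eq: "J = {}" using J' by blast
    have "two_edge_connected V0 (insert {a, b} (insert {c, d} (insert {p, q} X)))"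
      using tec' J_eq fgk_distinct fgk by (simp add: insert_Diff_if)
    then have "two_edge_connected (insert u V0)
        (insert {u, a} (insert {u, b} (insert {c, d} (insert {p, q} X))))"
      using two_edge_connected_subdivide[of V0 a b "insert {c, d} (insert {p, q} X)" u]
      by (simp add: ops)
    then have "two_edge_connected (insert y (insert u V0))
        (insert {y, p} (insert {y, q} (insert {u, a} (insert {u, b} (insert {c, d} X)))))"
      using two_edge_connected_subdivide[of "insert u V0" p q "insert {u, a} (insert {u, b}
          (insert {c, d} X))" y]
      by (simp add: ops)
    then have "two_edge_connected (insert v (insert y (insert u V0)))
        (insert {v, c} (insert {v, d} (insert {y, p} (insert {y, q} (insert {u, a}
            (insert {u, b} X))))))"
      using two_edge_connected_subdivide[of "insert y (insert u V0)" c d "insert {y, p}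
          (insert {y, q} (insert {u, a} (insert {u, b} X)))" v]
      by (simp add: ops)
    then have "two_edge_connected (insert x (insert v (insert y (insert u V0))))
        (insert {x, v} (insert {x, d} (insert {v, c} (insert {y, p} (insert {y, q} (insert {u, a}
            (insert {u, b} X)))))))"
      using two_edge_connected_subdivide[of "insert v (insert y (insert u V0))" v d "insert {v, c}
          (insert {y, p} (insert {y, q} (insert {u, a} (insert {u, b} X))))" x]
      by (simp add: ops)
    then have "two_edge_connected V (X \<union> (L - {{u, v}, {x, y}}))"
      by (intro extend_two_edge_connected[OF _ X]) (simp_all add: insert_commute, auto simp: finish)
    then show ?thesis
      using J_eq \<nu> fgk_distinct nonneg[of "{u, v}"] nonneg[of "{x, y}"] nonneg[of "{v, x}"]
      by (intro exI[of _ "{{u, v}, {x, y}}"]) (simp add: finish)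
  next
    case remove_k
    then have J_eq: "J = {k}" using J' by blast
    have "two_edge_connected V0 (insert {a, b} (insert {c, d} X))"
      using tec' J_eq fgk_distinct fgk by (simp add: insert_Diff_if)
    then have "two_edge_connected (insert u V0)
        (insert {u, a} (insert {u, b} (insert {c, d} X)))"
      using two_edge_connected_subdivide[of V0 a b "insert {c, d} X" u]
      by (simp add: ops)
    then have "two_edge_connected (insert v (insert u V0))
        (insert {v, c} (insert {v, d} (insert {u, a} (insert {u, b} X))))"
      using two_edge_connected_subdivide[of "insert u V0" c d "insert {u, a} (insert {u, b} X)" v]
      by (simp add: ops)
    then have "two_edge_connected (insert x (insert v (insert u V0)))
        (insert {x, v} (insert {x, d} (insert {v, c} (insert {u, a} (insert {u, b} X)))))"
      using two_edge_connected_subdivide[of "insert v (insert u V0)" v d "insert {v, c}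
          (insert {u, a} (insert {u, b} X))" x]
      by (simp add: ops)
    then have "two_edge_connected (insert y (insert x (insert v (insert u V0))))
        (insert {y, q} (insert {y, x} (insert {x, v} (insert {x, d} (insert {v, c} (insert {u, a}
            (insert {u, b} X)))))))"
      using two_edge_connected_add_ear1[of "insert x (insert v (insert u V0))"
          "insert {x, v} (insert {x, d} (insert {v, c} (insert {u, a} (insert {u, b} X))))" q x y]
      by (simp add: ops)
    then have "two_edge_connected V (X \<union> (L - {{u, v}, {y, p}}))"
      by (intro extend_two_edge_connected[OF _ X]) (simp_all add: insert_commute, auto simp: finish)
    then show ?thesis
      using J_eq \<nu> fgk_distinct nonneg[of "{u, v}"] nonneg[of "{x, y}"] nonneg[of "{v, x}"]
      by (intro exI[of _ "{{u, v}, {y, p}}"]) (simp add: finish)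
  next
    \<comment> \<open>\<open>v\<close> and \<open>x\<close> have lost their outer edges and return
      as an ear from \<open>u\<close> to \<open>y\<close>.\<close>
    case remove_g
    then have J_eq: "J = {g}" using J' by blast
    have "two_edge_connected V0 (insert {a, b} (insert {p, q} X))"
      using tec' J_eq fgk_distinct fgk by (simp add: insert_Diff_if)
    then have "two_edge_connected (insert u V0)
        (insert {u, a} (insert {u, b} (insert {p, q} X)))"
      using two_edge_connected_subdivide[of V0 a b "insert {p, q} X" u]
      by (simp add: ops)
    then have "two_edge_connected (insert y (insert u V0))
        (insert {y, p} (insert {y, q} (insert {u, a} (insert {u, b} X))))"
      using two_edge_connected_subdivide[of "insert u V0" p q "insert {u, a} (insert {u, b} X)" y]
      by (simp add: ops)
    then have "two_edge_connected (insert x (insert v (insert y (insert u V0))))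
        (insert {v, u} (insert {v, x} (insert {x, y} (insert {y, p} (insert {y, q} (insert {u, a}
            (insert {u, b} X)))))))"
      using two_edge_connected_add_ear2[of "insert y (insert u V0)"
          "insert {y, p} (insert {y, q} (insert {u, a} (insert {u, b} X)))" u y v x]
      by (simp add: ops)
    then have "two_edge_connected V (X \<union> (L - {{v, c}, {x, d}}))"
      by (intro extend_two_edge_connected[OF _ X]) (simp_all add: insert_commute, auto simp: finish)
    then show ?thesis
      using J_eq \<nu> fgk_distinct nonneg[of "{u, v}"] nonneg[of "{x, y}"] nonneg[of "{v, x}"]
      by (intro exI[of _ "{{v, c}, {x, d}}"]) (simp add: finish)
  next
    case remove_gk
    then have J_eq: "J = {g, k}" using J' by blast
    have "two_edge_connected V0 (insert {a, b} X)"
      using tec' J_eq fgk_distinct fgk by (simp add: insert_Diff_if)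
    then have "two_edge_connected (insert u V0)
        (insert {u, a} (insert {u, b} X))"
      using two_edge_connected_subdivide[of V0 a b "X" u]
      by (simp add: ops)
    then have "two_edge_connected (insert x (insert y (insert u V0)))
        (insert {y, q} (insert {y, x} (insert {x, u} (insert {u, a} (insert {u, b} X)))))"
      using two_edge_connected_add_ear2[of "insert u V0" "insert {u, a} (insert {u, b} X)" q u y x]
      by (simp add: ops)
    then have "two_edge_connected (insert v (insert x (insert y (insert u V0))))
        (insert {v, x} (insert {v, u} (insert {y, q} (insert {y, x} (insert {u, a}
            (insert {u, b} X))))))"
      using two_edge_connected_subdivide[of "insert x (insert y (insert u V0))" x u "insert {y, q}
          (insert {y, x} (insert {u, a} (insert {u, b} X)))" v]
      by (simp add: ops)
    then have "two_edge_connected V (X \<union> (L - {{v, c}, {x, d}, {y, p}}))"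
      by (intro extend_two_edge_connected[OF _ X]) (simp_all add: insert_commute, auto simp: finish)
    then show ?thesis
      using J_eq \<nu> fgk_distinct nonneg[of "{u, v}"] nonneg[of "{x, y}"] nonneg[of "{v, x}"]
      by (intro exI[of _ "{{v, c}, {x, d}, {y, p}}"]) (simp add: finish)
  next
    case remove_f
    then have J_eq: "J = {f}" using J' by blast
    have "two_edge_connected V0 (insert {c, d} (insert {p, q} X))"
      using tec' J_eq fgk_distinct fgk by (simp add: insert_Diff_if)
    then have "two_edge_connected (insert y V0)
        (insert {y, p} (insert {y, q} (insert {c, d} X)))"
      using two_edge_connected_subdivide[of V0 p q "insert {c, d} X" y]
      by (simp add: ops)
    then have "two_edge_connected (insert v (insert y V0))
        (insert {v, c} (insert {v, d} (insert {y, p} (insert {y, q} X))))"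
      using two_edge_connected_subdivide[of "insert y V0" c d "insert {y, p} (insert {y, q} X)" v]
      by (simp add: ops)
    then have "two_edge_connected (insert x (insert v (insert y V0)))
        (insert {x, v} (insert {x, d} (insert {v, c} (insert {y, p} (insert {y, q} X)))))"
      using two_edge_connected_subdivide[of "insert v (insert y V0)" v d "insert {v, c}
          (insert {y, p} (insert {y, q} X))" x]
      by (simp add: ops)
    then have "two_edge_connected (insert u (insert x (insert v (insert y V0))))
        (insert {u, b} (insert {u, v} (insert {x, v} (insert {x, d} (insert {v, c} (insert {y, p}
            (insert {y, q} X)))))))"
      using two_edge_connected_add_ear1[of "insert x (insert v (insert y V0))"
          "insert {x, v} (insert {x, d} (insert {v, c} (insert {y, p} (insert {y, q} X))))" b v u]
      by (simp add: ops)
    then have "two_edge_connected V (X \<union> (L - {{u, a}, {x, y}}))"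
      by (intro extend_two_edge_connected[OF _ X]) (simp_all add: insert_commute, auto simp: finish)
    then show ?thesis
      using J_eq \<nu> fgk_distinct nonneg[of "{u, v}"] nonneg[of "{x, y}"] nonneg[of "{v, x}"]
      by (intro exI[of _ "{{u, a}, {x, y}}"]) (simp add: finish)
  next
    case remove_fk
    then have J_eq: "J = {f, k}" using J' by blast
    have "two_edge_connected V0 (insert {c, d} X)"
      using tec' J_eq fgk_distinct fgk by (simp add: insert_Diff_if)
    then have "two_edge_connected (insert v V0)
        (insert {v, c} (insert {v, d} X))"
      using two_edge_connected_subdivide[of V0 c d "X" v]
      by (simp add: ops)
    then have "two_edge_connected (insert x (insert v V0))
        (insert {x, v} (insert {x, d} (insert {v, c} X)))"
      using two_edge_connected_subdivide[of "insert v V0" v d "insert {v, c} X" x]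
      by (simp add: ops)
    then have "two_edge_connected (insert u (insert x (insert v V0)))
        (insert {u, b} (insert {u, v} (insert {x, v} (insert {x, d} (insert {v, c} X)))))"
      using two_edge_connected_add_ear1[of "insert x (insert v V0)"
          "insert {x, v} (insert {x, d} (insert {v, c} X))" b v u]
      by (simp add: ops)
    then have "two_edge_connected (insert y (insert u (insert x (insert v V0))))
        (insert {y, q} (insert {y, x} (insert {u, b} (insert {u, v} (insert {x, v} (insert {x, d}
            (insert {v, c} X)))))))"
      using two_edge_connected_add_ear1[of "insert u (insert x (insert v V0))"
          "insert {u, b} (insert {u, v} (insert {x, v} (insert {x, d} (insert {v, c} X))))" q x y]
      by (simp add: ops)
    then have "two_edge_connected V (X \<union> (L - {{u, a}, {y, p}}))"
      by (intro extend_two_edge_connected[OF _ X]) (simp_all add: insert_commute, auto simp: finish)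
    then show ?thesis
      using J_eq \<nu> fgk_distinct nonneg[of "{u, v}"] nonneg[of "{x, y}"] nonneg[of "{v, x}"]
      by (intro exI[of _ "{{u, a}, {y, p}}"]) (simp add: finish)
  next
    case remove_fg
    then have J_eq: "J = {f, g}" using J' by blast
    have "two_edge_connected V0 (insert {p, q} X)"
      using tec' J_eq fgk_distinct fgk by (simp add: insert_Diff_if)
    then have "two_edge_connected (insert y V0)
        (insert {y, p} (insert {y, q} X))"
      using two_edge_connected_subdivide[of V0 p q "X" y]
      by (simp add: ops)
    then have "two_edge_connected (insert v (insert u (insert y V0)))
        (insert {u, b} (insert {u, v} (insert {v, y} (insert {y, p} (insert {y, q} X)))))"
      using two_edge_connected_add_ear2[of "insert y V0" "insert {y, p} (insert {y, q} X)" b y u v]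
      by (simp add: ops)
    then have "two_edge_connected (insert x (insert v (insert u (insert y V0))))
        (insert {x, v} (insert {x, y} (insert {u, b} (insert {u, v} (insert {y, p}
            (insert {y, q} X))))))"
      using two_edge_connected_subdivide[of "insert v (insert u (insert y V0))" v y "insert {u, b}
          (insert {u, v} (insert {y, p} (insert {y, q} X)))" x]
      by (simp add: ops)
    then have "two_edge_connected V (X \<union> (L - {{u, a}, {v, c}, {x, d}}))"
      by (intro extend_two_edge_connected[OF _ X]) (simp_all add: insert_commute, auto simp: finish)
    then show ?thesis
      using J_eq \<nu> fgk_distinct nonneg[of "{u, v}"] nonneg[of "{x, y}"] nonneg[of "{v, x}"]
      by (intro exI[of _ "{{u, a}, {v, c}, {x, d}}"]) (simp add: finish)
  next
    \<comment> \<open>The whole path returns as one ear from \<open>b\<close> to \<open>q\<close>.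
      Since \<open>g\<close> alone already accounts for keeping both \<open>{u, v}\<close> and
      \<open>{x, y}\<close>, the exchanges for \<open>f\<close> and \<open>k\<close> subtract these
      weights once more; nonnegativity absorbs the difference.\<close>
    case remove_fgk
    then have J_eq: "J = {f, g, k}" using J' by blast
    have "two_edge_connected V0 (X)"
      using tec' J_eq fgk_distinct fgk by (simp add: insert_Diff_if)
    then have "two_edge_connected (insert y (insert u V0))
        (insert {u, b} (insert {u, y} (insert {y, q} X)))"
      using two_edge_connected_add_ear2[of V0 "X" b q u y]
      by (simp add: ops)
    then have "two_edge_connected (insert v (insert y (insert u V0)))
        (insert {v, u} (insert {v, y} (insert {u, b} (insert {y, q} X))))"
      using two_edge_connected_subdivide[of "insert y (insert u V0)" u y "insert {u, b}
          (insert {y, q} X)" v]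
      by (simp add: ops)
    then have "two_edge_connected (insert x (insert v (insert y (insert u V0))))
        (insert {x, v} (insert {x, y} (insert {v, u} (insert {u, b} (insert {y, q} X)))))"
      using two_edge_connected_subdivide[of "insert v (insert y (insert u V0))" v y "insert {v, u}
          (insert {u, b} (insert {y, q} X))" x]
      by (simp add: ops)
    then have "two_edge_connected V (X \<union> (L - {{u, a}, {v, c}, {x, d}, {y, p}}))"
      by (intro extend_two_edge_connected[OF _ X]) (simp_all add: insert_commute, auto simp: finish)
    then show ?thesis
      using J_eq \<nu> fgk_distinct nonneg[of "{u, v}"] nonneg[of "{x, y}"] nonneg[of "{v, x}"]
      by (intro exI[of _ "{{u, a}, {v, c}, {x, d}, {y, p}}"]) (simp add: finish)
  qed
qed

text \<open>The difference between w(L) and \<nu>(N) is w(ub) + w(yq) + w(vx) + 3 (w(uv) + w(xy)),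
  so the lifting condition reads 2 (w(ub) + w(yq) + w(vx)) \<le> 3 (w(uv) + w(xy)). As
  \<open>b\<close> and \<open>q\<close> are the lighter ends, 2 w(ub) \<le> w(ua) + w(ub), and
  likewise at \<open>y\<close>; this yields a condition symmetric in the outer edges.\<close>

lemma removable_old:
  assumes nonneg: "\<And>e. 0 \<le> w e"
    and order: "w {u, b} \<le> w {u, a}" "w {y, q} \<le> w {y, p}"
    and IH: "\<And>w'. removable V0 (E0 \<union> N) w'"
    and gain: "w {u, a} + w {u, b} + w {y, p} + w {y, q} + 2 * w {v, x} \<le> 3 * (w {u, v} + w {x, y})"
  shows "removable V (E0 \<union> L) w"
proof -
  define \<nu> where "\<nu> = (\<lambda>e. if e = {a, b} then w {u, a} - w {u, v}
      else if e = {p, q} then w {y, p} - w {x, y} else w {v, c} + w {x, d} - w {u, v} - w {x, y})"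
  show ?thesis
  proof (rule removable_lift[where n = "\<lambda>e. e" and I = N and \<nu> = \<nu> and V' = V0
        and C = "w {u, v} + w {x, y}"])
    show "E0 \<inter> (\<lambda>e. e) ` N = {}" using new by simp
    show "E0 \<inter> L = {}" using not_in_E0 by (simp add: insert_commute)
    show "removable V0 (E0 \<union> (\<lambda>e. e) ` N) w'" for w' using IH by simp
  next
    fix J X
    assume "J \<subseteq> N" "X \<subseteq> E0" "two_edge_connected V0 (X \<union> (\<lambda>e. e) ` (N - J))"
    then show "\<exists>R\<subseteq>L. two_edge_connected V (X \<union> (L - R)) \<and>
        w {u, v} + w {x, y} + sum \<nu> J \<le> sum w R"
      unfolding \<nu>_def using lift[OF nonneg order] by simp
  next
    have "sum \<nu> N = \<nu> {a, b} + \<nu> {c, d} + \<nu> {p, q}" using new_distinct by simp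
    also have "\<dots> = w {u, a} + w {y, p} + w {v, c} + w {x, d} - 2 * (w {u, v} + w {x, y})"
      using new_distinct new_distinct[symmetric] unfolding \<nu>_def by simp
    finally have N_eq: "sum \<nu> N = w {u, a} + w {y, p} + w {v, c} + w {x, d} - 2 * (w {u, v}
        + w {x, y})" .
    have L_eq: "sum w L = w {u, a} + w {u, b} + w {u, v} + w {v, c} + w {v, x} + w {x, d}
        + w {x, y} + w {y, p} + w {y, q}"
      using distinctness by (simp add: doubleton_eq_iff)
    show "2 / 9 * sum w L \<le> w {u, v} + w {x, y} + 2 / 9 * sum \<nu> N"
      unfolding N_eq L_eq using gain order by (simp add: field_simps)
  qed (use finite_E0 in simp_all)
qed

end

subsection \<open>Averaging over paths\<close>

lemma sum_incident_edges:
  fixes g :: "'a \<Rightarrow> 'a set \<Rightarrow> 'b::comm_monoid_add"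
  assumes "finite_simple_graph V E"
  shows "(\<Sum>z\<in>V. \<Sum>e | e \<in> E \<and> z \<in> e. g z e) = (\<Sum>e\<in>E. \<Sum>z\<in>e. g z e)"
proof -
  have "finite V" using assms unfolding finite_simple_graph_def by simp
  moreover have "finite E" by (rule finite_simple_graph_finite_edges[OF assms])
  ultimately have "(\<Sum>z\<in>V. \<Sum>e | e \<in> E \<and> z \<in> e. g z e) = (\<Sum>e\<in>E. \<Sum>z | z \<in> V \<and> z \<in> e. g z e)"
    by (rule sum.swap_restrict)
  also have "\<dots> = (\<Sum>e\<in>E. \<Sum>z\<in>e. g z e)"
  proof (intro sum.cong refl)
    fix e assume "e \<in> E"
    then have "e \<subseteq> V" by (rule finite_simple_graph_edge_subset[OF assms])
    then show "{z. z \<in> V \<and> z \<in> e} = e" by auto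
  qed
  finally show ?thesis .
qed

lemma incident_edges:
  assumes "finite_simple_graph V E" "\<And>z. {v, z} \<in> E \<longleftrightarrow> z = a \<or> z = b \<or> z = c"
  shows "{e \<in> E. v \<in> e} = {{v, a}, {v, b}, {v, c}}"
proof (rule set_eqI)
  fix e
  show "e \<in> {e \<in> E. v \<in> e} \<longleftrightarrow> e \<in> {{v, a}, {v, b}, {v, c}}"
  proof
    assume "e \<in> {e \<in> E. v \<in> e}"
    then have e: "e \<in> E" "v \<in> e" by auto
    obtain s t where st: "e = {s, t}" by (rule finite_simple_graph_edgeE[OF assms(1) e(1)])
    then obtain z where "e = {v, z}" using e(2) by (auto simp: insert_commute)
    then show "e \<in> {{v, a}, {v, b}, {v, c}}" using e(1) assms(2) by auto
  next
    assume "e \<in> {{v, a}, {v, b}, {v, c}}"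
    then obtain z where "e = {v, z}" "z = a \<or> z = b \<or> z = c" by auto
    then show "e \<in> {e \<in> E. v \<in> e}" using assms(2) by simp
  qed
qed

section \<open>Neighbourhoods in cubic graphs\<close>

lemma edge_neq: "finite_simple_graph V E \<Longrightarrow> {a, b} \<in> E \<Longrightarrow> a \<noteq> b"
  by (erule finite_simple_graph_edgeE) (auto simp: doubleton_eq_iff)

lemma edge_in: "finite_simple_graph V E \<Longrightarrow> {a, b} \<in> E \<Longrightarrow> a \<in> V \<and> b \<in> V"
  using finite_simple_graph_edge_subset by fastforce

lemma cubic_neighbours:
  assumes G: "finite_simple_graph V E" and "cubic V E" "v \<in> V"
  obtains a b c where "a \<noteq> b" "a \<noteq> c" "b \<noteq> c" "\<And>z. {v, z} \<in> E \<longleftrightarrow> z = a \<or> z = b \<or> z = c"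
proof -
  have "{e \<in> E. v \<in> e} = (\<lambda>z. {v, z}) ` {z. {v, z} \<in> E}"
  proof (rule set_eqI, rule iffI)
    fix e assume "e \<in> {e \<in> E. v \<in> e}"
    then have e: "e \<in> E" "v \<in> e" by auto
    obtain s t where st: "e = {s, t}" by (rule finite_simple_graph_edgeE[OF G e(1)])
    then obtain z where "e = {v, z}" using e(2) by (auto simp: insert_commute)
    then show "e \<in> (\<lambda>z. {v, z}) ` {z. {v, z} \<in> E}" using e(1) by simp
  qed auto
  moreover have "inj_on (\<lambda>z. {v, z}) {z. {v, z} \<in> E}"
    by (auto simp: inj_on_def doubleton_eq_iff)
  moreover have "card {e \<in> E. v \<in> e} = 3"
    using assms unfolding cubic_def vertex_degree_def by simp
  ultimately have "card {z. {v, z} \<in> E} = 3" by (simp add: card_image)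
  then obtain a b c where "{z. {v, z} \<in> E} = {a, b, c}" "a \<noteq> b" "b \<noteq> c" "a \<noteq> c"
    by (auto simp: card_3_iff)
  then show thesis using that[of a b c] by blast
qed

lemma cubic_neighbours_of_edge:
  assumes G: "finite_simple_graph V E" and "cubic V E" "{v, u} \<in> E"
  obtains a b where "a \<noteq> b" "a \<noteq> u" "b \<noteq> u" "\<And>z. {v, z} \<in> E \<longleftrightarrow> z = u \<or> z = a \<or> z = b"
proof -
  have "v \<in> V" using edge_in[OF G assms(3)] by simp
  then obtain a b c where abc: "a \<noteq> b" "a \<noteq> c" "b \<noteq> c"
    "\<And>z. {v, z} \<in> E \<longleftrightarrow> z = a \<or> z = b \<or> z = c"
    using cubic_neighbours[OF assms(1,2)] by blast
  then consider "u = a" | "u = b" | "u = c" using assms(3) by auto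
  then show thesis
    by cases (use abc that[of b c] that[of a c] that[of a b] in auto)
qed

text \<open>When \<open>v\<close> changes sides, its edges into \<open>A\<close> leave the cut and
  its other edges enter it. Both counts are added rather than subtracted, which avoids truncated
  subtraction.\<close>

lemma cut_size_insert_vertex:
  assumes G: "finite_simple_graph V E" and "v \<notin> A"
    and nb: "\<And>z. {v, z} \<in> E \<longleftrightarrow> z = a \<or> z = b \<or> z = c" and abc: "a \<noteq> b" "a \<noteq> c" "b \<noteq> c"
  shows "cut_size E (insert v A) + of_bool (a \<in> A) + of_bool (b \<in> A) + of_bool (c \<in> A) =
    cut_size E A + of_bool (a \<notin> A) + of_bool (b \<notin> A) + of_bool (c \<notin> A)"
proof -
  define F where "F = {e \<in> E. v \<notin> e}"
  have ne: "v \<noteq> a" "v \<noteq> b" "v \<noteq> c" using edge_neq[OF G] nb by metis+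
  have "finite F" using finite_simple_graph_finite_edges[OF G] unfolding F_def by simp
  have E_eq: "E = insert {v, a} (insert {v, b} (insert {v, c} F))"
  proof -
    have "E = {e \<in> E. v \<in> e} \<union> F" unfolding F_def by auto
    then show ?thesis unfolding incident_edges[OF G nb] by simp
  qed
  have "e \<inter> insert v A = e \<inter> A" if "e \<in> F" for e using that unfolding F_def by auto
  then have "edge_cut F (insert v A) = edge_cut F A" unfolding edge_cut_def by auto
  moreover have "{v, z} \<notin> F" for z unfolding F_def by simp
  ultimately show ?thesis
    unfolding E_eq using \<open>finite F\<close> ne abc assms(2)
    by (simp add: cut_size_insert doubleton_eq_iff)
qed

lemma finite_simple_graph_delete:
  assumes "finite_simple_graph V E"
  shows "finite_simple_graph (V - U) {e \<in> E. e \<inter> U = {}}"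
  unfolding finite_simple_graph_def
proof (intro conjI ballI)
  show "finite (V - U)" using assms unfolding finite_simple_graph_def by simp
next
  fix e assume e: "e \<in> {e \<in> E. e \<inter> U = {}}"
  then have "e \<in> E" by simp
  then obtain u v where "u \<in> V" "v \<in> V" "u \<noteq> v" "e = {u, v}"
    by (rule finite_simple_graph_edgeE[OF assms])
  then show "\<exists>u\<in>V - U. \<exists>v\<in>V - U. u \<noteq> v \<and> e = {u, v}"
    using e by (intro bexI[of _ u] bexI[of _ v]) auto
qed

lemma cubic_third_neighbour:
  assumes G: "finite_simple_graph V E" "cubic V E" and "{v, u} \<in> E" "{v, x} \<in> E" "u \<noteq> x"
  obtains c where "c \<noteq> u" "c \<noteq> x" "\<And>z. {v, z} \<in> E \<longleftrightarrow> z = u \<or> z = x \<or> z = c"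
proof -
  obtain a b where ab: "a \<noteq> b" "a \<noteq> u" "b \<noteq> u" "\<And>z. {v, z} \<in> E \<longleftrightarrow> z = u \<or> z = a \<or> z = b"
    by (rule cubic_neighbours_of_edge[OF G assms(3)]) blast
  then consider "x = a" | "x = b" using assms(4,5) by metis
  then show thesis
  proof cases
    case 1 then show thesis by (intro that[of b]) (use ab in auto)
  next
    case 2 then show thesis by (intro that[of a]) (use ab in auto)
  qed
qed

text \<open>Nontrivial cuts are expressed by naming two distinct vertices on either side, which
  later proofs can supply directly.\<close>

locale essentially_4_edge_connected =
  fixes V :: "'a set" and E :: "'a set set"
  assumes graph: "finite_simple_graph V E" and cubic: "cubic V E" and conn: "edge_connected 3 V E"
    and four: "\<And>A s t s' t'. A \<subseteq> V \<Longrightarrow> s \<in> A \<Longrightarrow> t \<in> A \<Longrightarrow> s \<noteq> t \<Longrightarrow>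
      s' \<in> V - A \<Longrightarrow> t' \<in> V - A \<Longrightarrow> s' \<noteq> t' \<Longrightarrow> 4 \<le> cut_size E A"
    and no_triangle: "\<And>p q r. {p, q} \<in> E \<Longrightarrow> {q, r} \<in> E \<Longrightarrow> {p, r} \<notin> E"
begin

text \<open>The obstruction to reducing the path \<open>u\<close>, \<open>v\<close>,
  \<open>x\<close>, \<open>y\<close>: both deleted edges cross the cut, no suppressed vertex is
  separated from its outer neighbours, and so at most two of at most four edges survive in the
  reduced graph.\<close>

definition blocking :: "'a \<Rightarrow> 'a \<Rightarrow> 'a \<Rightarrow> 'a \<Rightarrow> 'a set \<Rightarrow> bool" where
  "blocking u v x y A \<longleftrightarrow> A \<subseteq> V \<and> cut_size E A \<le> 4 \<and> u \<in> A \<and> y \<in> A \<and> v \<notin> A \<and> x \<notin> A \<and>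
     (\<forall>z. {u, z} \<in> E \<and> z \<noteq> v \<longrightarrow> z \<in> A) \<and> (\<forall>z. {y, z} \<in> E \<and> z \<noteq> x \<longrightarrow> z \<in> A) \<and>
     (\<forall>z. {v, z} \<in> E \<and> z \<noteq> u \<longrightarrow> z \<notin> A) \<and> (\<forall>z. {x, z} \<in> E \<and> z \<noteq> y \<longrightarrow> z \<notin> A)"

definition blocked :: "'a \<Rightarrow> 'a \<Rightarrow> 'a \<Rightarrow> 'a \<Rightarrow> bool" where
  "blocked u v x y \<longleftrightarrow> (\<exists>A. blocking u v x y A)"

lemma blocked_sym: "blocked u v x y \<longleftrightarrow> blocked y x v u"
  unfolding blocked_def blocking_def by (simp add: conj_ac)

text \<open>Uncross a blocking set \<open>A\<close> for \<open>y\<close> with a blocking set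
  \<open>B\<close> for \<open>y'\<close>. The intersection contains \<open>u\<close> and a further
  neighbour of \<open>u\<close> but neither \<open>v\<close> nor \<open>x\<close>, hence has at
  least four cut edges. Moving \<open>x\<close> and then \<open>v\<close> into the union saves one
  edge each, and the enlarged set still misses \<open>u'\<close>; so the union has at least 3 + 2
  cut edges. Together this is nine, but submodularity allows only eight.\<close>

lemma not_both_blocked:
  assumes nv: "\<And>z. {v, z} \<in> E \<longleftrightarrow> z = x \<or> z = u \<or> z = u'" "u \<noteq> x" "u' \<noteq> x" "u \<noteq> u'"
    and nx: "\<And>z. {x, z} \<in> E \<longleftrightarrow> z = v \<or> z = y \<or> z = y'" "y \<noteq> v" "y' \<noteq> v" "y \<noteq> y'"
    and bad: "blocked u v x y"
  shows "\<not> blocked u v x y'"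
proof
  assume bad': "blocked u v x y'"
  obtain A where "blocking u v x y A" using bad unfolding blocked_def by (elim exE)
  then have A: "A \<subseteq> V" "cut_size E A \<le> 4" "u \<in> A" "y \<in> A" "v \<notin> A" "x \<notin> A"
    "\<And>z. {u, z} \<in> E \<Longrightarrow> z \<noteq> v \<Longrightarrow> z \<in> A" "u' \<notin> A"
    unfolding blocking_def using nv by simp_all
  obtain B where "blocking u v x y' B" using bad' unfolding blocked_def by (elim exE)
  then have B: "B \<subseteq> V" "cut_size E B \<le> 4" "u \<in> B" "y' \<in> B" "v \<notin> B" "x \<notin> B"
    "\<And>z. {u, z} \<in> E \<Longrightarrow> z \<noteq> v \<Longrightarrow> z \<in> B" "u' \<notin> B"
    unfolding blocking_def using nv by simp_all
  have in_V: "v \<in> V" "x \<in> V" "u' \<in> V" "v \<noteq> x" "v \<noteq> u" "v \<noteq> u'"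
    using edge_in[OF graph, of v x] edge_in[OF graph, of v u'] edge_neq[OF graph, of v x]
      edge_neq[OF graph, of v u] edge_neq[OF graph, of v u'] nv by simp_all
  have "{u, v} \<in> E" using nv(1)[of u] by (simp add: insert_commute)
  then obtain a b where "a \<noteq> v" "{u, a} \<in> E"
    by (rule cubic_neighbours_of_edge[OF graph cubic]) blast
  then have "a \<in> A \<inter> B" "a \<noteq> u" using A(7) B(7) edge_neq[OF graph, of u a] by auto
  then have "4 \<le> cut_size E (A \<inter> B)"
    using four[of "A \<inter> B" u a v x] A B in_V by blast
  moreover have "cut_size E (insert v (insert x (A \<union> B))) + 2 = cut_size E (A \<union> B)"
  proof -
    have "cut_size E (insert x (A \<union> B)) + 2 = cut_size E (A \<union> B) + 1"
      using cut_size_insert_vertex[OF graph _ nx(1), of "A \<union> B"] A B nx(2-4) by simp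
    moreover have "cut_size E (insert v (insert x (A \<union> B))) + 2 = cut_size E (insert x (A \<union> B)) + 1"
      using cut_size_insert_vertex[OF graph _ nv(1), of "insert x (A \<union> B)"] A B nv(2-4) in_V
      by simp
    ultimately show ?thesis by simp
  qed
  moreover have "3 \<le> cut_size E (insert v (insert x (A \<union> B)))"
  proof -
    have "insert v (insert x (A \<union> B)) \<subseteq> V" "insert v (insert x (A \<union> B)) \<noteq> {}"
      using A(1) B(1) in_V by auto
    moreover have "insert v (insert x (A \<union> B)) \<noteq> V" using in_V A(8) B(8) nv by auto
    ultimately show ?thesis using conn unfolding edge_connected_def by blast
  qed
  ultimately show False using cut_size_submodular[OF graph, of A B] A(2) B(2) by linarith
qed

section \<open>Weights at vertices and the path inequality\<close>

definition weight_at :: "('a set \<Rightarrow> real) \<Rightarrow> 'a \<Rightarrow> real" where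
  "weight_at w z = (\<Sum>e | e \<in> E \<and> z \<in> e. w e)"

lemma weight_at_eq:
  assumes "\<And>z. {v, z} \<in> E \<longleftrightarrow> z = a \<or> z = b \<or> z = c" "a \<noteq> b" "a \<noteq> c" "b \<noteq> c"
  shows "weight_at w v = w {v, a} + w {v, b} + w {v, c}"
proof -
  have "v \<noteq> a" "v \<noteq> b" "v \<noteq> c" using edge_neq[OF graph] assms(1) by metis+
  then show ?thesis
    unfolding weight_at_def incident_edges[OF graph assms(1)] using assms(2-4)
    by (simp add: doubleton_eq_iff)
qed

lemma ordered_neighbours:
  fixes w :: "'a set \<Rightarrow> real"
  assumes "{v, u} \<in> E"
  obtains a b where "a \<noteq> b" "a \<noteq> u" "b \<noteq> u" "\<And>z. {v, z} \<in> E \<longleftrightarrow> z = u \<or> z = a \<or> z = b"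
    "w {v, b} \<le> w {v, a}"
proof -
  obtain a b where ab: "a \<noteq> b" "a \<noteq> u" "b \<noteq> u" "\<And>z. {v, z} \<in> E \<longleftrightarrow> z = u \<or> z = a \<or> z = b"
    by (rule cubic_neighbours_of_edge[OF graph cubic assms]) blast
  show thesis
  proof (cases "w {v, b} \<le> w {v, a}")
    case True
    then show thesis using that[of a b] ab by blast
  next
    case False
    then show thesis using that[of b a] ab by (metis linorder_le_cases)
  qed
qed

text \<open>The exclusion of triangles and squares makes the reduced graph simple,
  \<open>free\<close> makes it 3-edge connected, and \<open>gain\<close> is the weight condition of
  the reduction with w(uv) + w(xy) added to both sides to complete the sums at \<open>u\<close> and
  \<open>y\<close>.\<close>

lemma path_removable:
  assumes no_square: "\<And>p q r s. {p, q} \<in> E \<Longrightarrow> {q, r} \<in> E \<Longrightarrow> {r, s} \<in> E \<Longrightarrow> {s, p} \<in> E \<Longrightarrow>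
      p = r \<or> q = s"
    and IH: "\<And>(V' :: 'a set) E' w'. card V' < card V \<Longrightarrow> cubic_3_edge_connected V' E'
        \<Longrightarrow> removable V' E' w'"
    and nonneg: "\<And>e. 0 \<le> w e"
    and path: "{u, v} \<in> E" "{v, x} \<in> E" "{x, y} \<in> E" "u \<noteq> x" "v \<noteq> y"
    and free: "\<not> blocked u v x y"
    and gain: "2 * w {v, x} + weight_at w u + weight_at w y \<le> 4 * (w {u, v} + w {x, y})"
  shows "removable V E w"
proof -
  have comm: "{s, t} \<in> E \<longleftrightarrow> {t, s} \<in> E" for s t by (simp add: insert_commute)
  have irrefl: "{s, s} \<notin> E" for s using edge_neq[OF graph, of s s] by blast
  have tri: "\<not> ({p, q} \<in> E \<and> {q, r} \<in> E \<and> {p, r} \<in> E)" for p q r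
    using no_triangle by blast
  have path': "{v, u} \<in> E" "{x, v} \<in> E" "{y, x} \<in> E"
    using path(1-3) by (simp_all add: insert_commute)
  obtain a b where ab: "a \<noteq> b" "a \<noteq> v" "b \<noteq> v" "\<And>z. {u, z} \<in> E \<longleftrightarrow> z = v \<or> z = a \<or> z = b"
    "w {u, b} \<le> w {u, a}"
    by (rule ordered_neighbours[OF path(1), where w = w]) blast
  obtain p q where pq: "p \<noteq> q" "p \<noteq> x" "q \<noteq> x" "\<And>z. {y, z} \<in> E \<longleftrightarrow> z = x \<or> z = p \<or> z = q"
    "w {y, q} \<le> w {y, p}"
    by (rule ordered_neighbours[OF path'(3), where w = w]) blast
  obtain c where c: "c \<noteq> u" "c \<noteq> x" "\<And>z. {v, z} \<in> E \<longleftrightarrow> z = u \<or> z = x \<or> z = c"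
    by (rule cubic_third_neighbour[OF graph cubic path'(1) path(2,4)]) blast
  obtain d where d: "d \<noteq> v" "d \<noteq> y" "\<And>z. {x, z} \<in> E \<longleftrightarrow> z = v \<or> z = y \<or> z = d"
    by (rule cubic_third_neighbour[OF graph cubic path'(2) path(3,5)]) blast
  have uy: "u \<noteq> y" using tri[of u v x] path comm by blast
  have ne: "u \<noteq> v" "v \<noteq> x" "x \<noteq> y" using path irrefl by metis+
  define V0 where "V0 = V - {u, v, x, y}"
  define E0 where "E0 = {e \<in> E. e \<inter> {u, v, x, y} = {}}"
  have in_V: "u \<in> V" "v \<in> V" "x \<in> V" "y \<in> V" using edge_in[OF graph] path by blast+
  have in_V0: "z \<in> V0" if "{s, z} \<in> E" "z \<noteq> u" "z \<noteq> v" "z \<noteq> x" "z \<noteq> y" for s z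
    using edge_in[OF graph that(1)] that unfolding V0_def by simp
  have non_edges: "{u, x} \<notin> E" "{u, y} \<notin> E" "{v, y} \<notin> E"
    "{x, u} \<notin> E" "{y, u} \<notin> E" "{y, v} \<notin> E"
    using tri[of u v x] tri[of v x y] no_square[of u v x y] path comm by blast+
  have inside: "a \<in> V0" "b \<in> V0" "c \<in> V0" "d \<in> V0" "p \<in> V0" "q \<in> V0"
    using in_V0[of u a] in_V0[of u b] in_V0[of v c] in_V0[of x d] in_V0[of y p] in_V0[of y q]
      ab pq c d non_edges irrefl by metis+
  \<comment> \<open>The violations would be the triangles u, v, c and y, x, d and the square u, p,
    y, q.\<close>
  have "\<not> ({u, c} \<in> E)" "\<not> ({y, d} \<in> E)" "\<not> ({u, p} \<in> E \<and> {u, q} \<in> E)"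
    using tri[of u v c] path(1) c(3)[of c] tri[of y x d] path(3) d(3)[of d]
      no_square[of u p y q] pq(1,4) uy comm by blast+
  then have new_ends: "c \<noteq> a" "c \<noteq> b" "d \<noteq> p" "d \<noteq> q" "\<not> ((p = a \<or> p = b) \<and> (q = a \<or> q = b))"
    using ab(4) pq(4) by metis+
  \<comment> \<open>An edge \<open>{a, b}\<close> or \<open>{p, q}\<close> would close a triangle at
    \<open>u\<close> or \<open>y\<close>, an edge \<open>{c, d}\<close> the square c, v, x,
    d.\<close>
  have "{a, b} \<notin> E" "{c, d} \<notin> E" "{p, q} \<notin> E"
    using tri[of a u b] tri[of p y q] no_square[of c v x d] ab(4) pq(4) c d path(2) comm by metis+
  then have "{a, b} \<notin> E0" "{c, d} \<notin> E0" "{p, q} \<notin> E0" unfolding E0_def by blast+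
  moreover have "finite_simple_graph V0 E0"
    unfolding E0_def V0_def by (rule finite_simple_graph_delete[OF graph])
  moreover have "{a, b} \<noteq> {c, d}" "{a, b} \<noteq> {p, q}" "{c, d} \<noteq> {p, q}"
    using new_ends by (auto simp: doubleton_eq_iff)
  moreover have "u \<notin> V0" "v \<notin> V0" "x \<notin> V0" "y \<notin> V0" unfolding V0_def by simp_all
  moreover have "c \<noteq> d" using tri[of v c x] c(3) d(3) path(2) comm by metis
  ultimately interpret path_reduction V0 E0 u v x y a b c d p q
    using inside ab(1) pq(1) ne uy path(4,5) by unfold_locales
  have V_eq: "V = {u, v, x, y} \<union> V0" using in_V unfolding V0_def by blast
  have E_eq: "E = E0 \<union> {{u, a}, {u, b}, {u, v}, {v, c}, {v, x}, {x, d}, {x, y}, {y, p}, {y, q}}"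
  proof -
    have "E = E0 \<union> ({e \<in> E. u \<in> e} \<union> {e \<in> E. v \<in> e} \<union> {e \<in> E. x \<in> e} \<union> {e \<in> E. y \<in> e})"
      unfolding E0_def by auto
    then show ?thesis
      unfolding incident_edges[OF graph ab(4)] incident_edges[OF graph c(3)]
        incident_edges[OF graph d(3)] incident_edges[OF graph pq(4)]
      by (simp add: insert_commute)
  qed
  have red: "cubic_3_edge_connected V0 (E0 \<union> {{a, b}, {c, d}, {p, q}})"
    unfolding cubic_3_edge_connected_def
  proof (intro conjI new_graph)
    show "cubic V0 (E0 \<union> {{a, b}, {c, d}, {p, q}})"
      using cubic_reduced cubic unfolding V_eq[symmetric] E_eq[symmetric] .
    show "edge_connected 3 V0 (E0 \<union> {{a, b}, {c, d}, {p, q}})"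
    proof (rule three_edge_connected_reduced; unfold V_eq[symmetric] E_eq[symmetric])
      show "edge_connected 3 V E" by (rule conn)
    next
      fix A s t s' t'
      assume "A \<subseteq> V" "s \<in> A" "t \<in> A" "s \<noteq> t" "s' \<in> V - A" "t' \<in> V - A" "s' \<noteq> t'"
      then show "4 \<le> cut_size E A" by (rule four)
    next
      fix A assume A: "A \<subseteq> V" "{u, y, a, b, p, q} \<subseteq> A" "{v, x, c, d} \<inter> A = {}"
      show "5 \<le> cut_size E A"
      proof (rule ccontr)
        assume "\<not> 5 \<le> cut_size E A"
        then have "blocking u v x y A"
          unfolding blocking_def using A ab(4) pq(4) c(3) d(3) by auto
        then show False using free unfolding blocked_def by blast
      qed
    qed
  qed
  have "card V0 < card V"
    using finite_V0 outside by (subst V_eq) (auto intro!: psubset_card_mono)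
  from IH[OF this red] have IH': "removable V0 (E0 \<union> {{a, b}, {c, d}, {p, q}}) w'" for w' .
  have "weight_at w u = w {u, v} + w {u, a} + w {u, b}"
    by (rule weight_at_eq) (use ab in auto)
  moreover have "weight_at w y = w {y, x} + w {y, p} + w {y, q}"
    by (rule weight_at_eq) (use pq in auto)
  moreover have "w {y, x} = w {x, y}" by (simp add: insert_commute)
  ultimately have gain': "w {u, a} + w {u, b} + w {y, p} + w {y, q} + 2 * w {v, x}
      \<le> 3 * (w {u, v} + w {x, y})" using gain by simp
  show ?thesis
    using removable_old[OF nonneg ab(5) pq(5) IH' gain'] unfolding V_eq[symmetric] E_eq[symmetric] .
qed

text \<open>Of the two ways to pair the outer neighbours of the ends of \<open>{v, x}\<close>, one consists of two
  paths that are not blocked. If both paths violate the inequality of \<open>path_removable\<close>, adding the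
  violations gives a bound that does not depend on the pairing.\<close>

lemma edge_deficit:
  assumes no_square: "\<And>p q r s. {p, q} \<in> E \<Longrightarrow> {q, r} \<in> E \<Longrightarrow> {r, s} \<in> E \<Longrightarrow> {s, p} \<in> E \<Longrightarrow>
      p = r \<or> q = s"
    and IH: "\<And>(V' :: 'a set) E' w'. card V' < card V \<Longrightarrow> cubic_3_edge_connected V' E'
        \<Longrightarrow> removable V' E' w'"
    and nonneg: "\<And>e. 0 \<le> w e" and not_removable: "\<not> removable V E w"
    and e: "e \<in> E"
  defines "s \<equiv> weight_at w"
  defines "nb \<equiv> (\<lambda>v. \<Sum>e | e \<in> E \<and> v \<in> e. (\<Sum>z\<in>e. s z) - s v)"
  shows "(\<Sum>z\<in>e. 5 * s z - nb z) < 12 * w e"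
proof -
  have comm: "{s, t} \<in> E \<longleftrightarrow> {t, s} \<in> E" for s t by (simp add: insert_commute)
  obtain v x where vx: "v \<noteq> x" "e = {v, x}" by (rule finite_simple_graph_edgeE[OF graph e])
  then have E: "{v, x} \<in> E" "{x, v} \<in> E" using e comm by auto
  obtain u u' where u: "u \<noteq> u'" "u \<noteq> x" "u' \<noteq> x" "\<And>z. {v, z} \<in> E \<longleftrightarrow> z = x \<or> z = u \<or> z = u'"
    by (rule cubic_neighbours_of_edge[OF graph cubic E(1)]) blast
  obtain y y' where y: "y \<noteq> y'" "y \<noteq> v" "y' \<noteq> v" "\<And>z. {x, z} \<in> E \<longleftrightarrow> z = v \<or> z = y \<or> z = y'"
    by (rule cubic_neighbours_of_edge[OF graph cubic E(2)]) blast
  have viol: "4 * (w {v, p} + w {x, q}) < 2 * w {v, x} + s p + s q"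
    if "p = u \<or> p = u'" "q = y \<or> q = y'" "\<not> blocked p v x q" for p q
  proof (rule ccontr)
    assume "\<not> ?thesis"
    then have ineq: "2 * w {v, x} + weight_at w p + weight_at w q \<le> 4 * (w {p, v} + w {x, q})"
      unfolding s_def by (simp add: insert_commute)
    have pq: "{p, v} \<in> E" "{x, q} \<in> E" "p \<noteq> x" "v \<noteq> q"
      using that(1,2) u y comm by auto
    have "removable V E w"
      by (rule path_removable[where w = w, OF no_square IH nonneg pq(1) E(1) pq(2-4) that(3) ineq])
    then show False using not_removable by simp
  qed
  have b1: "\<not> blocked u v x y'" "\<not> blocked u' v x y" if "blocked u v x y"
  proof -
    show "\<not> blocked u v x y'"
      using not_both_blocked[of v x u u' y y'] u y that by simp
    show "\<not> blocked u' v x y"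
      using not_both_blocked[of x v y y' u u'] u y that blocked_sym by simp
  qed
  have b2: "\<not> blocked u v x y" "\<not> blocked u' v x y'" if "blocked u v x y'"
  proof -
    show "\<not> blocked u v x y" using b1(1) that by blast
    show "\<not> blocked u' v x y'"
      using not_both_blocked[of x v y' y u u'] u y that blocked_sym by auto
  qed
  have b3: "\<not> blocked u v x y'" if "blocked u' v x y'"
    using not_both_blocked[of x v y' y u' u] u y that blocked_sym by auto
  \<comment> \<open>Either pairing uses each of the four end edges and each of the four outer
    vertices exactly once, so both lead to the same inequality.\<close>
  have sum: "4 * (w {v, u} + w {v, u'} + w {x, y} + w {x, y'}) <
      4 * w {v, x} + s u + s u' + s y + s y'"
  proof (cases "blocked u v x y \<or> blocked u' v x y'")
    case True
    then have "\<not> blocked u v x y'" "\<not> blocked u' v x y"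
      using b1 b3 not_both_blocked[of v x u' u y' y] u y by auto
    then show ?thesis using viol[of u y'] viol[of u' y] by simp
  next
    case False
    then show ?thesis using viol[of u y] viol[of u' y'] by simp
  qed
  have ne: "v \<noteq> u" "v \<noteq> u'" "x \<noteq> y" "x \<noteq> y'"
    using edge_neq[OF graph, of v] edge_neq[OF graph, of x] u(4) y(4) by metis+
  have sv: "s v = w {v, x} + w {v, u} + w {v, u'}"
    unfolding s_def by (rule weight_at_eq) (use u in auto)
  have sx: "s x = w {v, x} + w {x, y} + w {x, y'}"
    using weight_at_eq[OF y(4)] y unfolding s_def by (auto simp: insert_commute)
  have nv: "nb v = s x + s u + s u'"
    unfolding nb_def incident_edges[OF graph u(4)] using u ne vx by (simp add: doubleton_eq_iff)
  have nx: "nb x = s v + s y + s y'"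
    unfolding nb_def incident_edges[OF graph y(4)] using y ne vx by (simp add: doubleton_eq_iff)
  \<comment> \<open>The left side is 4 (s(v) + s(x)) - (s(u) + s(u') + s(y) + s(y')), one of the
    five copies at each end being cancelled by the neighbour sum of the other end. Since s(v) + s(x)
    counts w(vx) twice and each end edge once, \<open>sum\<close> leaves 8 + 4 = 12 copies of
    w(vx).\<close>
  show ?thesis
    using sum vx sv sx nv nx by simp
qed

text \<open>Summed over all edges, the left sides of \<open>edge_deficit\<close> count every vertex
  three times, and the neighbour sums total three times the sum of \<open>s\<close>. This gives 3 (5
  - 3) times the sum of \<open>s\<close>, which is 2 w(E), hence exactly the total of the right
  sides; strictness in every term is then impossible.\<close>

lemma removable_if_no_square:
  assumes no_square: "\<And>p q r s. {p, q} \<in> E \<Longrightarrow> {q, r} \<in> E \<Longrightarrow> {r, s} \<in> E \<Longrightarrow> {s, p} \<in> E \<Longrightarrow>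
      p = r \<or> q = s"
    and IH: "\<And>(V' :: 'a set) E' w'. card V' < card V \<Longrightarrow> cubic_3_edge_connected V' E'
        \<Longrightarrow> removable V' E' w'"
    and nonneg: "\<And>e. 0 \<le> w e" and "E \<noteq> {}"
  shows "removable V E w"
proof (rule ccontr)
  assume neg: "\<not> removable V E w"
  define s where "s = weight_at w"
  define nb where "nb v = (\<Sum>e | e \<in> E \<and> v \<in> e. (\<Sum>z\<in>e. s z) - s v)" for v
  have fin: "finite E" by (rule finite_simple_graph_finite_edges[OF graph])
  have deg: "(\<Sum>e | e \<in> E \<and> v \<in> e. c) = 3 * c" if "v \<in> V" for v and c :: real
    using that cubic unfolding cubic_def vertex_degree_def by simp
  have card_e: "card e = 2" if "e \<in> E" for e
    using that by (rule finite_simple_graph_edgeE[OF graph]) simp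
  have count: "(\<Sum>e\<in>E. \<Sum>z\<in>e. g z) = 3 * (\<Sum>z\<in>V. g z)" for g :: "'a \<Rightarrow> real"
  proof -
    have "(\<Sum>e\<in>E. \<Sum>z\<in>e. g z) = (\<Sum>z\<in>V. \<Sum>e | e \<in> E \<and> z \<in> e. g z)"
      by (rule sum_incident_edges[OF graph, symmetric])
    also have "\<dots> = (\<Sum>z\<in>V. 3 * g z)" by (intro sum.cong refl deg)
    finally show ?thesis by (simp add: sum_distrib_left)
  qed
  have s: "(\<Sum>z\<in>V. s z) = 2 * sum w E"
  proof -
    have "(\<Sum>z\<in>V. s z) = (\<Sum>e\<in>E. \<Sum>z\<in>e. w e)"
      unfolding s_def weight_at_def by (rule sum_incident_edges[OF graph])
    also have "\<dots> = (\<Sum>e\<in>E. 2 * w e)" using card_e by (intro sum.cong) auto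
    finally show ?thesis by (simp add: sum_distrib_left)
  qed
  have nb: "(\<Sum>z\<in>V. nb z) = 3 * (\<Sum>z\<in>V. s z)"
  proof -
    have "(\<Sum>z\<in>V. nb z) = (\<Sum>e\<in>E. \<Sum>v\<in>e. (\<Sum>z\<in>e. s z) - s v)"
      unfolding nb_def by (rule sum_incident_edges[OF graph])
    also have "\<dots> = (\<Sum>e\<in>E. \<Sum>z\<in>e. s z)"
    proof (rule sum.cong)
      fix e assume "e \<in> E"
      then show "(\<Sum>v\<in>e. (\<Sum>z\<in>e. s z) - s v) = (\<Sum>z\<in>e. s z)"
        by (simp add: sum_subtractf card_e)
    qed simp
    finally show ?thesis unfolding count .
  qed
  have "(\<Sum>e\<in>E. \<Sum>z\<in>e. 5 * s z - nb z) < (\<Sum>e\<in>E. 12 * w e)"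
  proof (rule sum_strict_mono[OF fin \<open>E \<noteq> {}\<close>])
    fix e assume e: "e \<in> E"
    show "(\<Sum>z\<in>e. 5 * s z - nb z) < 12 * w e"
      unfolding s_def nb_def by (rule edge_deficit[where w = w, OF no_square IH nonneg neg e])
  qed
  also have "(\<Sum>e\<in>E. 12 * w e) = 12 * sum w E" by (simp add: sum_distrib_left)
  also have "(\<Sum>e\<in>E. \<Sum>z\<in>e. 5 * s z - nb z) = 12 * sum w E"
    unfolding count sum_subtractf nb by (simp add: sum_distrib_left[symmetric] s)
  finally show False by simp
qed

end

subsection \<open>Squares\<close>

lemma cut_size_eq_sum:
  "finite F \<Longrightarrow> cut_size F A = (\<Sum>e\<in>F. of_bool (card (e \<inter> A) = 1))"
  unfolding edge_cut_def by (simp add: of_bool_def sum.If_cases Int_def)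

text \<open>Each edge crosses none or exactly two of the three cuts.\<close>

lemma even_cut_size_disjoint:
  assumes "finite_simple_graph V E" "A \<inter> B = {}"
  shows "even (cut_size E A + cut_size E B + cut_size E (A \<union> B))"
proof -
  have "finite E" using assms(1) by (rule finite_simple_graph_finite_edges)
  then show ?thesis using assms(1)
  proof (induction E)
    case empty then show ?case by (simp add: edge_cut_def)
  next
    case (insert e E)
    obtain a b where ab: "a \<noteq> b" "e = {a, b}"
      by (rule finite_simple_graph_edgeE[OF insert.prems, of e]) simp
    have "finite_simple_graph V E"
      using insert.prems unfolding finite_simple_graph_def by simp
    then have "even (cut_size E A + cut_size E B + cut_size E (A \<union> B))"
      by (rule insert.IH)
    moreover have "\<not> (a \<in> A \<and> a \<in> B)" "\<not> (b \<in> A \<and> b \<in> B)" using assms(2) by auto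
    ultimately show ?case
      using cut_size_insert[OF insert.hyps(1) ab(1)] insert.hyps(2) ab(2)
      by (cases "a \<in> A"; cases "b \<in> A"; cases "a \<in> B"; cases "b \<in> B") simp_all
  qed
qed

text \<open>The corners 1, 2, 3, 4 of a square form a path, and corner 2 has lost its edge to the rest.
  The flags \<open>za\<close> to \<open>zd\<close> tell which corners lie in a cut, \<open>A\<close>, \<open>C\<close>, \<open>D\<close> whether the outer
  neighbours of the corners 1, 3, 4 do; \<open>e\<close> and \<open>f\<close> say that the cut contains nothing or everything
  outside the square.\<close>

lemma path_of_four_cut:
  fixes n :: nat
  assumes "e \<or> 2 \<le> n + of_bool A + of_bool C + of_bool D"
    and "f \<or> 2 \<le> n + of_bool (\<not> A) + of_bool (\<not> C) + of_bool (\<not> D)"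
    and "e \<longrightarrow> \<not> A \<and> \<not> C \<and> \<not> D" "f \<longrightarrow> A \<and> C \<and> D"
    and "\<not> (e \<and> \<not> za \<and> \<not> zb \<and> \<not> zc \<and> \<not> zd)" "\<not> (f \<and> za \<and> zb \<and> zc \<and> zd)"
  shows "2 \<le> n + of_bool (za \<noteq> A) + of_bool (zc \<noteq> C) + of_bool (zd \<noteq> D)
    + of_bool (za \<noteq> zb) + of_bool (zb \<noteq> zc) + of_bool (zc \<noteq> zd)"
  using assms
  by (cases za; cases zb; cases zc; cases zd; cases A; cases C; cases D;
      simp only: simp_thms of_bool_eq; (elim disjE)?; simp)

text \<open>Here the whole square survives with two outer edges, attached at the corners with flags
  \<open>p\<close> and \<open>q\<close>. A cut that splits the square crosses the cycle twice;
  otherwise all corners agree and the bound for the rest applies.\<close>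

lemma cycle_of_four_cut:
  fixes n :: nat
  assumes "e \<or> 2 \<le> n + of_bool A + of_bool B"
    and "f \<or> 2 \<le> n + of_bool (\<not> A) + of_bool (\<not> B)"
    and "\<not> (e \<and> \<not> za \<and> \<not> zb \<and> \<not> zc \<and> \<not> zd)" "\<not> (f \<and> za \<and> zb \<and> zc \<and> zd)"
    and "p = za \<or> p = zb \<or> p = zc \<or> p = zd" "q = za \<or> q = zb \<or> q = zc \<or> q = zd"
  shows "2 \<le> n + of_bool (p \<noteq> A) + of_bool (q \<noteq> B)
    + of_bool (za \<noteq> zb) + of_bool (zb \<noteq> zc) + of_bool (zc \<noteq> zd) + of_bool (zd \<noteq> za)"
  using assms
  by (cases za; cases zb; cases zc; cases zd; cases A; cases B;
      simp only: simp_thms of_bool_eq; (elim disjE)?; simp)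

text \<open>If \<open>A\<close> differs from \<open>zs\<close>, the suppressed corner
  \<open>u\<close> may go to either side at the same cost, and so may \<open>v\<close> if
  \<open>D\<close> differs from \<open>zt\<close>. Hence the deleted edge between them can be kept
  out of the cut unless both are forced to opposite sides, where \<open>ge4\<close> provides the
  missing edge.\<close>

lemma square_placement:
  fixes f :: "bool \<Rightarrow> bool \<Rightarrow> nat"
  assumes f: "\<And>zu zv. f zu zv = n + of_bool (zu \<noteq> A) + of_bool (zu \<noteq> zs) + of_bool (zs \<noteq> B)
      + of_bool (zs \<noteq> zt) + of_bool (zt \<noteq> C) + of_bool (zt \<noteq> zv) + of_bool (zv \<noteq> D)
          + of_bool (zu \<noteq> zv)"
    and ge3: "\<And>zu zv. 3 \<le> f zu zv" and ge4: "zs \<noteq> zt \<Longrightarrow> 4 \<le> f zs zt"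
  shows "3 \<le> n + of_bool (zs \<noteq> A) + of_bool (zs \<noteq> B) + of_bool (zt \<noteq> C) + of_bool (zt \<noteq> D)
    + of_bool (zs \<noteq> zt)"
proof -
  define zu where "zu = (if A = zs then zs else zt)"
  define zv where "zv = (if A = zs \<and> D \<noteq> zt then zs else zt)"
  have ge4': "zs \<noteq> zt \<longrightarrow> 4 \<le> f zs zt" using ge4 by (intro impI)
  show ?thesis
    using ge3[of zu zv] ge4' unfolding f zu_def zv_def
    by (cases A; cases B; cases C; cases D; cases zs; cases zt;
        simp only: simp_thms if_True if_False of_bool_eq; simp)
qed

text \<open>The cyclic order of the corners is \<open>u\<close>, \<open>s\<close>, \<open>t\<close>,
  \<open>v\<close>, with outer neighbours \<open>a\<close>, \<open>b\<close>, \<open>c\<close>,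
  \<open>d\<close>. The edge \<open>{u, v}\<close> is deleted, and \<open>u\<close>,
  \<open>v\<close> are suppressed into \<open>{s, a}\<close> and \<open>{t, d}\<close>. Every new
  edge touches \<open>s\<close> or \<open>t\<close>, so simplicity of the reduced graph comes down
  to \<open>ends\<close>.\<close>

locale square_reduction =
  fixes U :: "'a set" and E0 :: "'a set set" and u v s t a b c d :: 'a
  assumes E0: "finite_simple_graph U E0"
    and square: "u \<noteq> v" "u \<noteq> s" "u \<noteq> t" "v \<noteq> s" "v \<noteq> t" "s \<noteq> t"
    and outside: "u \<notin> U" "v \<notin> U" "s \<notin> U" "t \<notin> U"
    and inside: "a \<in> U" "b \<in> U" "c \<in> U" "d \<in> U"
    and ends: "a \<noteq> b" "c \<noteq> d"
begin

abbreviation "V \<equiv> {u, v, s, t} \<union> U"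
abbreviation "V0 \<equiv> {s, t} \<union> U"
abbreviation "L \<equiv> {{u, a}, {u, s}, {s, b}, {s, t}, {t, c}, {t, v}, {v, d}, {u, v}}"
abbreviation "N \<equiv> {{s, a}, {s, b}, {t, c}, {t, d}, {s, t}}"

lemma neq: "a \<noteq> u" "a \<noteq> v" "a \<noteq> s" "a \<noteq> t" "b \<noteq> u" "b \<noteq> v" "b \<noteq> s" "b \<noteq> t" "c \<noteq> u" "c \<noteq> v" "c \<noteq> s"
    "c \<noteq> t" "d \<noteq> u" "d \<noteq> v" "d \<noteq> s" "d \<noteq> t"
  using outside inside by auto

lemmas distinctness = square square[symmetric] neq neq[symmetric] ends ends[symmetric]

lemma finite_U: "finite U"
  using E0 unfolding finite_simple_graph_def by blast

lemma finite_E0: "finite E0"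
  by (rule finite_simple_graph_finite_edges[OF E0])

lemma not_in_E0: "{u, z} \<notin> E0" "{v, z} \<notin> E0" "{s, z} \<notin> E0" "{t, z} \<notin> E0"
  using finite_simple_graph_edge_subset[OF E0] outside by blast+

lemma old_graph: "finite_simple_graph V (E0 \<union> L)"
proof -
  have "finite_simple_graph V E0"
    using finite_U by (intro finite_simple_graph_mono[OF E0]) auto
  then show ?thesis using inside distinctness by (simp add: finite_simple_graph_insert)
qed

lemma new_graph: "finite_simple_graph V0 (E0 \<union> N)"
proof -
  have "finite_simple_graph V0 E0"
    using finite_U by (intro finite_simple_graph_mono[OF E0]) auto
  then show ?thesis using inside distinctness by (simp add: finite_simple_graph_insert)
qed

lemma cut_size_old: "cut_size (E0 \<union> L) A = cut_size E0 A + of_bool ((u \<in> A) \<noteq> (a \<in> A))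
    + of_bool ((u \<in> A) \<noteq> (s \<in> A)) + of_bool ((s \<in> A) \<noteq> (b \<in> A)) + of_bool ((s \<in> A) \<noteq> (t \<in> A))
    + of_bool ((t \<in> A) \<noteq> (c \<in> A)) + of_bool ((t \<in> A) \<noteq> (v \<in> A)) + of_bool ((v \<in> A) \<noteq> (d \<in> A))
    + of_bool ((u \<in> A) \<noteq> (v \<in> A))"
  using finite_E0 not_in_E0 distinctness
  by (simp add: cut_size_insert doubleton_eq_iff)

lemma cut_size_new: "cut_size (E0 \<union> N) A = cut_size E0 A + of_bool ((s \<in> A) \<noteq> (a \<in> A))
    + of_bool ((s \<in> A) \<noteq> (b \<in> A)) + of_bool ((t \<in> A) \<noteq> (c \<in> A)) + of_bool ((t \<in> A) \<noteq> (d \<in> A))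
    + of_bool ((s \<in> A) \<noteq> (t \<in> A))"
  using finite_E0 not_in_E0 distinctness
  by (simp add: cut_size_insert doubleton_eq_iff)

lemma cubic_reduced:
  assumes "cubic V (E0 \<union> L)"
  shows "cubic V0 (E0 \<union> N)"
  unfolding cubic_def
proof
  fix z assume z: "z \<in> V0"
  have "cut_size (E0 \<union> N) {z} = 3"
  proof (cases "z \<in> U")
    case True
    then have "cut_size (E0 \<union> L) {z} = 3"
      using assms unfolding cubic_def cut_size_singleton[OF old_graph] by blast
    moreover have "u \<noteq> z" "v \<noteq> z" "s \<noteq> z" "t \<noteq> z" using True outside by auto
    ultimately show ?thesis
      unfolding cut_size_old cut_size_new using ends
      by (simp add: of_bool_def split: if_splits)
  next
    case False
    then have "z = s \<or> z = t" using z by simp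
    moreover have "edge_cut E0 {z} = {}"
      using edge_cut_cong[OF E0, of "{z}" "{}"] False by (simp add: edge_cut_def)
    ultimately show ?thesis
      unfolding cut_size_new using distinctness by auto
  qed
  then show "vertex_degree (E0 \<union> N) z = 3"
    unfolding cut_size_singleton[OF new_graph] .
qed

lemma three_edge_connected_reduced:
  assumes conn: "edge_connected 3 V (E0 \<union> L)"
    and triv: "\<And>A p q p' q'. A \<subseteq> V \<Longrightarrow> p \<in> A \<Longrightarrow> q \<in> A \<Longrightarrow> p \<noteq> q \<Longrightarrow>
      p' \<in> V - A \<Longrightarrow> q' \<in> V - A \<Longrightarrow> p' \<noteq> q' \<Longrightarrow> 4 \<le> cut_size (E0 \<union> L) A"
  shows "edge_connected 3 V0 (E0 \<union> N)"
  unfolding edge_connected_def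
proof (intro allI impI)
  fix Z assume Z: "Z \<subseteq> V0 \<and> Z \<noteq> {} \<and> Z \<noteq> V0"
  define ext where "ext zu zv = Z \<union> (if zu then {u} else {}) \<union> (if zv then {v} else {})" for zu zv
  have notZ: "u \<notin> Z" "v \<notin> Z" using Z outside square by auto
  have mem: "u \<in> ext zu zv \<longleftrightarrow> zu" "v \<in> ext zu zv \<longleftrightarrow> zv"
    "z \<in> V0 \<Longrightarrow> z \<in> ext zu zv \<longleftrightarrow> z \<in> Z" for zu zv z
    using notZ square outside unfolding ext_def by auto
  have sub: "ext zu zv \<subseteq> V" for zu zv using Z unfolding ext_def by auto
  have inter: "ext zu zv \<inter> V0 = Z" for zu zv
    using Z outside square unfolding ext_def by auto
  have proper: "ext zu zv \<noteq> {}" "ext zu zv \<noteq> V" for zu zv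
    using Z inter[of zu zv] by auto
  have "ext zu zv \<inter> U = Z \<inter> U" for zu zv using inter[of zu zv] by blast
  then have E0cut: "edge_cut E0 (ext zu zv) = edge_cut E0 Z" for zu zv
    by (intro edge_cut_cong[OF E0])
  define f where "f zu zv = cut_size (E0 \<union> L) (ext zu zv)" for zu zv
  have f: "f zu zv = cut_size E0 Z + of_bool (zu \<noteq> (a \<in> Z)) + of_bool (zu \<noteq> (s \<in> Z))
      + of_bool ((s \<in> Z) \<noteq> (b \<in> Z)) + of_bool ((s \<in> Z) \<noteq> (t \<in> Z)) + of_bool ((t \<in> Z) \<noteq> (c \<in> Z))
      + of_bool ((t \<in> Z) \<noteq> zv) + of_bool (zv \<noteq> (d \<in> Z)) + of_bool (zu \<noteq> zv)" for zu zv
    unfolding f_def cut_size_old E0cut using inside by (simp add: mem)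
  have ge3: "3 \<le> f zu zv" for zu zv
    using conn[unfolded edge_connected_def, rule_format, of "ext zu zv"] sub proper
    unfolding f_def by simp
  \<comment> \<open>\<open>u\<close> is on the side of \<open>s\<close> and \<open>v\<close> on that
    of \<open>t\<close>, so both sides have two vertices.\<close>
  have ge4: "4 \<le> f (s \<in> Z) (t \<in> Z)" if "(s \<in> Z) \<noteq> (t \<in> Z)"
  proof (cases "s \<in> Z")
    case True
    then show ?thesis using triv[OF sub, of s "s \<in> Z" "t \<in> Z" u t v] that square
      unfolding f_def by (simp add: mem)
  next
    case False
    then show ?thesis using triv[OF sub, of t "s \<in> Z" "t \<in> Z" v s u] that square
      unfolding f_def by (simp add: mem)
  qed
  show "3 \<le> cut_size (E0 \<union> N) Z"
    using square_placement[OF f ge3 ge4] unfolding cut_size_new by simp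
qed

lemma extend_two_edge_connected:
  assumes "F \<subseteq> E0" "K \<subseteq> F \<union> (L - R)"
    and cut: "\<And>Z. Z \<subseteq> V \<Longrightarrow> Z \<noteq> {} \<Longrightarrow> Z \<noteq> V \<Longrightarrow> 2 \<le> cut_size K Z"
  shows "two_edge_connected V (F \<union> (L - R))"
proof -
  have G: "finite_simple_graph V (F \<union> (L - R))"
    using finite_U
    by (intro finite_simple_graph_mono[OF old_graph order_refl] Un_mono assms(1) Diff_subset) simp
  then have "cut_size K Z \<le> cut_size (F \<union> (L - R)) Z" for Z
    by (intro cut_size_mono assms(2) finite_simple_graph_finite_edges)
  then show ?thesis
    using G cut unfolding two_edge_connected_def edge_connected_def by (meson order_trans)
qed

lemma sum_over_N: "(\<Sum>e\<in>N. g e) = g {s, a} + g {s, b} + g {t, c} + g {t, d} + g {s, t}"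
  for g :: "'a set \<Rightarrow> 'b :: comm_semiring_1"
  using distinctness by (simp add: doubleton_eq_iff add_ac)

lemma sum_over_J:
  fixes g :: "'a set \<Rightarrow> 'b :: comm_semiring_1"
  assumes "J \<subseteq> N"
  shows "sum g J = (if {s, a} \<in> J then g {s, a} else 0) + (if {s, b} \<in> J then g {s, b} else 0)
      + (if {t, c} \<in> J then g {t, c} else 0) + (if {t, d} \<in> J then g {t, d} else 0)
      + (if {s, t} \<in> J then g {s, t} else 0)"
proof -
  have "sum g J = (\<Sum>e\<in>N. if e \<in> J then g e else 0)"
    using assms by (subst sum.inter_restrict[symmetric]) (auto simp: Int_absorb1)
  then show ?thesis unfolding sum_over_N .
qed

lemma cut_size_new_minus:
  assumes "F \<subseteq> E0"
  shows "cut_size (F \<union> (N - J)) A = cut_size F A + of_bool ({s, a} \<notin> J \<and> (s \<in> A) \<noteq> (a \<in> A))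
      + of_bool ({s, b} \<notin> J \<and> (s \<in> A) \<noteq> (b \<in> A)) + of_bool ({t, c} \<notin> J \<and> (t \<in> A) \<noteq> (c \<in> A))
      + of_bool ({t, d} \<notin> J \<and> (t \<in> A) \<noteq> (d \<in> A)) + of_bool ({s, t} \<notin> J \<and> (s \<in> A) \<noteq> (t \<in> A))"
proof -
  have "finite F" using finite_subset[OF assms finite_E0] .
  moreover have "F \<inter> (N - J) = {}" using assms not_in_E0 by blast
  ultimately have "cut_size (F \<union> (N - J)) A = cut_size F A + cut_size (N - J) A"
    by (intro cut_size_Un_disjoint) simp_all
  also have "cut_size (N - J) A = (\<Sum>e\<in>N - J. of_bool (card (e \<inter> A) = 1))"
    by (rule cut_size_eq_sum) simp
  also have "\<dots> = (\<Sum>e\<in>N. if e \<notin> J then of_bool (card (e \<inter> A) = 1) else 0)"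
    unfolding set_diff_eq by (rule sum.inter_filter) simp
  also have "\<dots> = (\<Sum>e\<in>N. of_bool (e \<notin> J \<and> card (e \<inter> A) = 1))"
    by (intro sum.cong) auto
  finally show ?thesis
    unfolding sum_over_N using distinctness by (simp add: card_doubleton_Int_eq_1[simplified]
        add_ac)
qed

text \<open>Put both remaining corners outside the cut, or both inside: then \<open>{s, t}\<close>
  does not cross, and the bound involves only \<open>F\<close> and the outer edges that
  survive.\<close>

lemma rest_cut:
  assumes F: "F \<subseteq> E0" and tec: "two_edge_connected V0 (F \<union> (N - J))"
  shows "Z \<inter> U = {} \<or> 2 \<le> cut_size F Z + of_bool ({s, a} \<notin> J \<and> a \<in> Z)
      + of_bool ({s, b} \<notin> J \<and> b \<in> Z) + of_bool ({t, c} \<notin> J \<and> c \<in> Z)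
      + of_bool ({t, d} \<notin> J \<and> d \<in> Z)" (is ?inside)
    and "U \<subseteq> Z \<or> 2 \<le> cut_size F Z + of_bool ({s, a} \<notin> J \<and> a \<notin> Z) + of_bool ({s, b} \<notin> J \<and> b \<notin> Z)
        + of_bool ({t, c} \<notin> J \<and> c \<notin> Z) + of_bool ({t, d} \<notin> J \<and> d \<notin> Z)" (is ?outside)
proof -
  have FU: "finite_simple_graph U F"
    using finite_U by (intro finite_simple_graph_mono[OF E0 order_refl _ F])
  have cong: "edge_cut F A = edge_cut F Z" if "A \<inter> U = Z \<inter> U" for A
    using that by (rule edge_cut_cong[OF FU])
  show ?inside
  proof (cases "Z \<inter> U = {}")
    case False
    then have "2 \<le> cut_size (F \<union> (N - J)) (Z \<inter> U)"
      using outside by (intro two_edge_connectedD[OF tec]) auto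
    then show ?thesis
      unfolding cut_size_new_minus[OF F] using cong[of "Z \<inter> U"] inside outside by simp
  qed simp
  show ?outside
  proof (cases "U \<subseteq> Z")
    case False
    then have "2 \<le> cut_size (F \<union> (N - J)) ({s, t} \<union> Z \<inter> U)"
      using outside by (intro two_edge_connectedD[OF tec]) auto
    moreover have "edge_cut F ({s, t} \<union> Z \<inter> U) = edge_cut F Z"
      using outside by (intro cong) auto
    ultimately show ?thesis
      unfolding cut_size_new_minus[OF F] using inside outside distinctness by simp
  qed simp
qed

text \<open>\<open>s\<close> and \<open>t\<close> have degree three in the reduced graph and must
  keep degree two. This leaves ten possibilities for \<open>J\<close>.\<close>

lemma at_most_one_at_corner:
  assumes F: "F \<subseteq> E0" and tec: "two_edge_connected V0 (F \<union> (N - J))"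
  shows "\<not> ({s, a} \<in> J \<and> {s, b} \<in> J)" "\<not> ({t, c} \<in> J \<and> {t, d} \<in> J)"
    "{s, t} \<in> J \<Longrightarrow> {s, a} \<notin> J \<and> {s, b} \<notin> J \<and> {t, c} \<notin> J \<and> {t, d} \<notin> J"
proof -
  have FU: "finite_simple_graph U F"
    using finite_U by (intro finite_simple_graph_mono[OF E0 order_refl _ F])
  have "edge_cut F {z} = {}" if "z \<notin> U" for z
    using edge_cut_cong[OF FU, of "{z}" "{}"] that by (simp add: edge_cut_def)
  moreover have "2 \<le> cut_size (F \<union> (N - J)) {s}"
    using inside outside distinctness by (intro two_edge_connectedD[OF tec]) auto
  moreover have "2 \<le> cut_size (F \<union> (N - J)) {t}"
    using inside outside distinctness by (intro two_edge_connectedD[OF tec]) auto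
  ultimately have "2 \<le> of_bool ({s, a} \<notin> J) + of_bool ({s, b} \<notin> J) + (of_bool ({s, t} \<notin> J) :: nat)"
    "2 \<le> of_bool ({t, c} \<notin> J) + of_bool ({t, d} \<notin> J) + (of_bool ({s, t} \<notin> J) :: nat)"
    unfolding cut_size_new_minus[OF F] using outside distinctness by simp_all
  then show "\<not> ({s, a} \<in> J \<and> {s, b} \<in> J)" "\<not> ({t, c} \<in> J \<and> {t, d} \<in> J)"
    "{s, t} \<in> J \<Longrightarrow> {s, a} \<notin> J \<and> {s, b} \<notin> J \<and> {t, c} \<notin> J \<and> {t, d} \<notin> J"
    by (auto simp: of_bool_def split: if_splits)
qed

text \<open>If both opposite pairs of square edges were indispensable, there would be two cuts of size at
  most one (not counting the square) that separate the corners into all four quadrants. Each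
  quadrant has a cut of size at least one, which contradicts submodularity and parity.\<close>

lemma opposite_pair_removable:
  assumes F: "F \<subseteq> E0" and tec: "two_edge_connected V0 (F \<union> N)"
  shows "two_edge_connected V (F \<union> (L - {{u, s}, {t, v}})) \<or>
    two_edge_connected V (F \<union> (L - {{s, t}, {u, v}}))"
proof (rule ccontr)
  assume neg: "\<not> ?thesis"
  \<comment> \<open>\<open>K\<close> omits all four square edges; those that cross a given cut are
    added separately.\<close>
  define K where "K = F \<union> {{u, a}, {s, b}, {t, c}, {v, d}}"
  have fin: "finite F" by (rule finite_subset[OF F finite_E0])
  have new: "{u, z} \<notin> F" "{v, z} \<notin> F" "{s, z} \<notin> F" "{t, z} \<notin> F" for z
    using F not_in_E0 by blast+
  have K: "finite_simple_graph V K"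
  proof (rule finite_simple_graph_mono[OF old_graph order_refl])
    show "K \<subseteq> E0 \<union> L" unfolding K_def by (intro Un_mono F) simp
  qed (simp add: finite_U)
  have cutK: "cut_size K Z = cut_size F Z + of_bool ((u \<in> Z) \<noteq> (a \<in> Z))
      + of_bool ((s \<in> Z) \<noteq> (b \<in> Z))
      + of_bool ((t \<in> Z) \<noteq> (c \<in> Z)) + of_bool ((v \<in> Z) \<noteq> (d \<in> Z))" for Z
    unfolding K_def using fin new distinctness by (simp add: cut_size_insert doubleton_eq_iff)
  have newK: "{u, v} \<notin> K" "{s, t} \<notin> K" "{u, s} \<notin> K" "{t, v} \<notin> K"
    unfolding K_def using new distinctness by (auto simp: doubleton_eq_iff)
  have finK: "finite K" by (rule finite_simple_graph_finite_edges[OF K])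
  have rest: "Z \<inter> U = {} \<or> 2 \<le> cut_size F Z + of_bool (a \<in> Z) + of_bool (b \<in> Z) + of_bool (c \<in> Z)
      + of_bool (d \<in> Z)"
    "U \<subseteq> Z \<or> 2 \<le> cut_size F Z + of_bool (a \<notin> Z) + of_bool (b \<notin> Z) + of_bool (c \<notin> Z)
        + of_bool (d \<notin> Z)" for Z
    using rest_cut[OF F, of "{}" Z] tec by simp_all
  have empty: "cut_size F Z = 0 \<and> a \<notin> Z \<and> b \<notin> Z \<and> c \<notin> Z \<and> d \<notin> Z" if "Z \<inter> U = {}" for Z
  proof -
    have "edge_cut F Z = edge_cut F {}"
      using that finite_U by (intro edge_cut_cong[of U] finite_simple_graph_mono[OF E0 order_refl
          _ F]) auto
    also have "\<dots> = {}" by (simp add: edge_cut_def)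
    finally show ?thesis using that inside by auto
  qed
  have full: "cut_size F Z = 0 \<and> a \<in> Z \<and> b \<in> Z \<and> c \<in> Z \<and> d \<in> Z" if "U \<subseteq> Z" for Z
  proof -
    have "edge_cut F Z = edge_cut F U"
      using that finite_U by (intro edge_cut_cong[of U] finite_simple_graph_mono[OF E0 order_refl
          _ F]) auto
    also have "\<dots> = edge_cut F {}"
      using edge_cut_compl[OF finite_simple_graph_mono[OF E0 order_refl finite_U F], of U] by simp
    also have "\<dots> = {}" by (simp add: edge_cut_def)
    finally show ?thesis using that inside by auto
  qed
  define corners where "corners Z = (of_bool (u \<in> Z) + of_bool (v \<in> Z) + of_bool (s \<in> Z) +
    of_bool (t \<in> Z) :: nat)" for Z
  \<comment> \<open>If \<open>Z\<close> meets \<open>U\<close>, the bound in \<open>rest\<close>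
    counts the outer neighbours in \<open>Z\<close>; at most one of their edges fails to cross, the
    one at the corner in \<open>Z\<close>.\<close>
  have one: "1 \<le> cut_size K Z" if "corners Z = 1" for Z
  proof (cases "Z \<inter> U = {}")
    case True
    then show ?thesis using empty[of Z] that unfolding cutK corners_def by simp
  next
    case False
    have "of_bool q \<le> of_bool (p \<noteq> q) + (of_bool p :: nat)" for p q by simp
    note this[of "a \<in> Z" "u \<in> Z"] this[of "b \<in> Z" "s \<in> Z"] this[of "c \<in> Z" "t \<in> Z"]
      this[of "d \<in> Z" "v \<in> Z"]
    then show ?thesis using rest(1)[of Z] False that unfolding cutK corners_def by linarith
  qed
  have three: "1 \<le> cut_size K Z" if "corners Z = 3" for Z
  proof (cases "U \<subseteq> Z")
    case True
    then show ?thesis using full[of Z] that unfolding cutK corners_def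
      by (cases "u \<in> Z"; cases "v \<in> Z"; cases "s \<in> Z"; cases "t \<in> Z") simp_all
  next
    case False
    have "of_bool (\<not> q) + of_bool p \<le> of_bool (p \<noteq> q) + (1 :: nat)" for p q by simp
    note this[of "a \<in> Z" "u \<in> Z"] this[of "b \<in> Z" "s \<in> Z"] this[of "c \<in> Z" "t \<in> Z"]
      this[of "d \<in> Z" "v \<in> Z"]
    then show ?thesis using rest(2)[of Z] False that unfolding cutK corners_def by linarith
  qed
  have extreme: "2 \<le> cut_size K Z" if "Z \<subseteq> V" "Z \<noteq> {}" "Z \<noteq> V" "corners Z = 0 \<or> corners Z = 4" for Z
  proof (cases "u \<in> Z")
    case True
    then have corner_in: "u \<in> Z" "v \<in> Z" "s \<in> Z" "t \<in> Z"
      using that(4) unfolding corners_def by (auto simp: of_bool_def split: if_splits)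
    then have "\<not> U \<subseteq> Z" using that by blast
    then show ?thesis using rest(2)[of Z] corner_in unfolding cutK by simp
  next
    case False
    then have corner_out: "u \<notin> Z" "v \<notin> Z" "s \<notin> Z" "t \<notin> Z"
      using that(4) unfolding corners_def by (auto simp: of_bool_def split: if_splits)
    then have "Z \<inter> U \<noteq> {}" using that by blast
    then show ?thesis using rest(1)[of Z] corner_out unfolding cutK by simp
  qed
  have compl: "cut_size K (V - Z) = cut_size K Z" for Z
    by (simp only: edge_cut_compl[OF K])
  have "\<exists>P. P \<subseteq> V \<and> P \<noteq> {} \<and> P \<noteq> V \<and> \<not> 2 \<le> cut_size (insert {u, v} (insert {s, t} K)) P"
  proof (rule ccontr)
    assume "\<not> ?thesis"
    then have "two_edge_connected V (F \<union> (L - {{u, s}, {t, v}}))"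
    proof (intro extend_two_edge_connected[OF F, of "insert {u, v} (insert {s, t} K)"])
      show "insert {u, v} (insert {s, t} K) \<subseteq> F \<union> (L - {{u, s}, {t, v}})"
        unfolding K_def using distinctness by (simp add: doubleton_eq_iff subset_insertI2)
    qed (metis (lifting))
    then show False using neg by blast
  qed
  then obtain P where P: "P \<subseteq> V" "P \<noteq> {}" "P \<noteq> V"
    "\<not> 2 \<le> cut_size (insert {u, v} (insert {s, t} K)) P" by (elim exE conjE)
  then have "\<not> 2 \<le> cut_size K P + of_bool ((s \<in> P) \<noteq> (t \<in> P)) + of_bool ((u \<in> P) \<noteq> (v \<in> P))"
    using newK finK distinctness by (simp add: cut_size_insert doubleton_eq_iff)
  \<comment> \<open>If one or three corners lie in \<open>P\<close>, one of the two retained square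
    edges crosses in addition to the edge from \<open>one\<close> or \<open>three\<close>; if none
    or all do, \<open>extreme\<close> applies; if both retained edges cross, there are already two.
    What remains is that \<open>P\<close> separates \<open>u\<close>, \<open>v\<close> from
    \<open>s\<close>, \<open>t\<close>.\<close>
  then have P': "cut_size K P \<le> 1" "u \<in> P \<longleftrightarrow> v \<in> P" "s \<in> P \<longleftrightarrow> t \<in> P" "u \<in> P \<longleftrightarrow> s \<notin> P"
    using one[of P] three[of P] extreme[OF P(1-3)] unfolding corners_def
    by (cases "u \<in> P"; cases "v \<in> P"; cases "s \<in> P"; cases "t \<in> P"; simp)+
  have "\<exists>Q. Q \<subseteq> V \<and> Q \<noteq> {} \<and> Q \<noteq> V \<and> \<not> 2 \<le> cut_size (insert {u, s} (insert {t, v} K)) Q"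
  proof (rule ccontr)
    assume "\<not> ?thesis"
    then have "two_edge_connected V (F \<union> (L - {{s, t}, {u, v}}))"
    proof (intro extend_two_edge_connected[OF F, of "insert {u, s} (insert {t, v} K)"])
      show "insert {u, s} (insert {t, v} K) \<subseteq> F \<union> (L - {{s, t}, {u, v}})"
        unfolding K_def using distinctness by (simp add: doubleton_eq_iff subset_insertI2)
    qed (metis (lifting))
    then show False using neg by blast
  qed
  then obtain Q where Q: "Q \<subseteq> V" "Q \<noteq> {}" "Q \<noteq> V"
    "\<not> 2 \<le> cut_size (insert {u, s} (insert {t, v} K)) Q" by (elim exE conjE)
  then have "\<not> 2 \<le> cut_size K Q + of_bool ((t \<in> Q) \<noteq> (v \<in> Q)) + of_bool ((u \<in> Q) \<noteq> (s \<in> Q))"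
    using newK finK distinctness by (simp add: cut_size_insert doubleton_eq_iff)
  then have Q': "cut_size K Q \<le> 1" "u \<in> Q \<longleftrightarrow> s \<in> Q" "t \<in> Q \<longleftrightarrow> v \<in> Q" "u \<in> Q \<longleftrightarrow> v \<notin> Q"
    using one[of Q] three[of Q] extreme[OF Q(1-3)] unfolding corners_def
    by (cases "u \<in> Q"; cases "v \<in> Q"; cases "s \<in> Q"; cases "t \<in> Q"; simp)+
  define A where "A = (if u \<in> P then P else V - P)"
  define B where "B = (if u \<in> Q then Q else V - Q)"
  have A: "A \<subseteq> V" "cut_size K A \<le> 1" "u \<in> A" "v \<in> A" "s \<notin> A" "t \<notin> A"
    unfolding A_def using P(1) P' compl by auto
  have B: "B \<subseteq> V" "cut_size K B \<le> 1" "u \<in> B" "s \<in> B" "v \<notin> B" "t \<notin> B"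
    unfolding B_def using Q(1) Q' compl by auto
  have "1 \<le> cut_size K (A \<inter> B)" using A B by (intro one) (simp add: corners_def)
  moreover have "1 \<le> cut_size K (A \<union> B)" using A B by (intro three) (simp add: corners_def)
  moreover have "1 \<le> cut_size K (A \<inter> (V - B))"
    using A B by (intro one) (simp add: corners_def)
  moreover have "1 \<le> cut_size K (A \<union> (V - B))"
    using A B by (intro three) (simp add: corners_def)
  moreover note cut_size_submodular[OF K, of A B] cut_size_submodular[OF K, of A "V - B"] compl[of
      B]
  \<comment> \<open>Submodularity bounds by two each sum of an intersection and a union, and every
    term is at least one, so all are equal to one. Then \<open>A\<close> is a disjoint union of two
    sets with the odd cut size one and has that cut size itself, against parity.\<close>
  ultimately have "cut_size K (A \<inter> B) = 1" "cut_size K (A \<inter> (V - B)) = 1" "cut_size K A = 1"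
    using A(2) B(2) by linarith+
  moreover have "even (cut_size K (A \<inter> B) + cut_size K (A \<inter> (V - B))
      + cut_size K (A \<inter> B \<union> A \<inter> (V - B)))"
    by (rule even_cut_size_disjoint[OF K]) blast
  moreover have "A \<inter> B \<union> A \<inter> (V - B) = A" using A(1) by blast
  ultimately show False by simp
qed

lemma rest_nontrivial:
  assumes "Z \<subseteq> V" "Z \<noteq> {}" "Z \<noteq> V"
  shows "\<not> (Z \<inter> U = {} \<and> u \<notin> Z \<and> v \<notin> Z \<and> s \<notin> Z \<and> t \<notin> Z)"
    and "\<not> (U \<subseteq> Z \<and> u \<in> Z \<and> v \<in> Z \<and> s \<in> Z \<and> t \<in> Z)"
    and "Z \<inter> U = {} \<longrightarrow> a \<notin> Z \<and> b \<notin> Z \<and> c \<notin> Z \<and> d \<notin> Z"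
    and "U \<subseteq> Z \<longrightarrow> a \<in> Z \<and> b \<in> Z \<and> c \<in> Z \<and> d \<in> Z"
  using assms inside by blast+

text \<open>By default \<open>{u, s}\<close> and \<open>{t, v}\<close> are removed. A lost edge at
  \<open>s\<close> exchanges \<open>{u, s}\<close> for the corresponding outer edge, a lost edge at
  \<open>t\<close> does the same with \<open>{t, v}\<close>, and losing \<open>{s, t}\<close>
  exchanges both for the other opposite pair. If nothing is lost, either opposite pair may turn out
  to be the removable one, and \<open>order\<close> makes the default value a lower bound for
  both.\<close>

lemma lift:
  assumes nonneg: "\<And>e. 0 \<le> w e"
    and order: "w {u, s} + w {t, v} \<le> w {s, t} + w {u, v}"
    and F: "F \<subseteq> E0" and J: "J \<subseteq> N" and tec: "two_edge_connected V0 (F \<union> (N - J))"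
  defines "\<nu> \<equiv> (\<lambda>e. if e = {s, a} then w {u, a} - w {u, s}
      else if e = {s, b} then w {s, b} - w {u, s}
      else if e = {t, c} then w {t, c} - w {t, v} else if e = {t, d} then w {v, d} - w {t, v}
      else w {s, t} + w {u, v} - w {u, s} - w {t, v})"
  shows "\<exists>R\<subseteq>L. two_edge_connected V (F \<union> (L - R)) \<and>
      w {u, s} + w {t, v} + sum \<nu> J \<le> (sum w R :: real)"
proof -
  have fin: "finite F" by (rule finite_subset[OF F finite_E0])
  have new: "{u, z} \<notin> F" "{v, z} \<notin> F" "{s, z} \<notin> F" "{t, z} \<notin> F" for z
    using F not_in_E0 by blast+
  have \<nu>: "\<nu> {s, a} = w {u, a} - w {u, s}" "\<nu> {s, b} = w {s, b} - w {u, s}"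
    "\<nu> {t, c} = w {t, c} - w {t, v}" "\<nu> {t, d} = w {v, d} - w {t, v}"
    "\<nu> {s, t} = w {s, t} + w {u, v} - w {u, s} - w {t, v}"
    unfolding \<nu>_def using distinctness by (simp_all add: doubleton_eq_iff)
  note corner = at_most_one_at_corner[OF F tec]
  note rest = rest_cut[OF F tec]
  note simps = doubleton_eq_iff distinctness
  consider (st) "{s, t} \<in> J" "{s, a} \<notin> J" "{s, b} \<notin> J" "{t, c} \<notin> J" "{t, d} \<notin> J"
    | (none) "{s, t} \<notin> J" "{s, a} \<notin> J" "{s, b} \<notin> J" "{t, c} \<notin> J" "{t, d} \<notin> J"
    | (sa) "{s, t} \<notin> J" "{s, a} \<in> J" "{s, b} \<notin> J" "{t, c} \<notin> J" "{t, d} \<notin> J"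
    | (sb) "{s, t} \<notin> J" "{s, a} \<notin> J" "{s, b} \<in> J" "{t, c} \<notin> J" "{t, d} \<notin> J"
    | (tc) "{s, t} \<notin> J" "{s, a} \<notin> J" "{s, b} \<notin> J" "{t, c} \<in> J" "{t, d} \<notin> J"
    | (td) "{s, t} \<notin> J" "{s, a} \<notin> J" "{s, b} \<notin> J" "{t, c} \<notin> J" "{t, d} \<in> J"
    | (sa_tc) "{s, t} \<notin> J" "{s, a} \<in> J" "{s, b} \<notin> J" "{t, c} \<in> J" "{t, d} \<notin> J"
    | (sa_td) "{s, t} \<notin> J" "{s, a} \<in> J" "{s, b} \<notin> J" "{t, c} \<notin> J" "{t, d} \<in> J"
    | (sb_tc) "{s, t} \<notin> J" "{s, a} \<notin> J" "{s, b} \<in> J" "{t, c} \<in> J" "{t, d} \<notin> J"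
    | (sb_td) "{s, t} \<notin> J" "{s, a} \<notin> J" "{s, b} \<in> J" "{t, c} \<notin> J" "{t, d} \<in> J"
    using corner by argo
  then show ?thesis
  proof cases
    \<comment> \<open>The old graph without \<open>{s, t}\<close> and \<open>{u, v}\<close> is
      obtained by subdividing \<open>{s, a}\<close> with \<open>u\<close> and \<open>{t, d}\<close>
      with \<open>v\<close>.\<close>
    case st
    have "two_edge_connected V0 (insert {s, a} (insert {s, b} (insert {t, c} (insert {t, d} F))))"
      using tec st by (simp add: insert_Diff_if)
    then have "two_edge_connected (insert u V0)
        (insert {u, s} (insert {u, a} (insert {s, b} (insert {t, c} (insert {t, d} F)))))"
      using outside square by (intro two_edge_connected_subdivide) auto
    then have "two_edge_connected (insert u V0)
        (insert {t, d} (insert {u, s} (insert {u, a} (insert {s, b} (insert {t, c} F)))))"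
      by (simp add: insert_commute)
    then have "two_edge_connected (insert v (insert u V0))
        (insert {v, t} (insert {v, d} (insert {u, s} (insert {u, a} (insert {s, b}
            (insert {t, c} F))))))"
      using outside square by (intro two_edge_connected_subdivide) auto
    moreover have "insert v (insert u V0) = V" by blast
    moreover have "insert {v, t} (insert {v, d} (insert {u, s} (insert {u, a} (insert {s, b}
        (insert {t, c} F)))))
        = F \<union> (L - {{s, t}, {u, v}})"
      using distinctness by (simp add: insert_Diff_if doubleton_eq_iff insert_commute)
    ultimately have "two_edge_connected V (F \<union> (L - {{s, t}, {u, v}}))" by simp
    then show ?thesis
      using st \<nu> sum_over_J[OF J, of \<nu>]
      by (intro exI[of _ "{{s, t}, {u, v}}"]) (simp add: simps)
  next
    case none
    then have "J = {}" using J by blast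
    then have "two_edge_connected V0 (F \<union> N)" using tec by simp
    from opposite_pair_removable[OF F this] show ?thesis
    proof
      assume "two_edge_connected V (F \<union> (L - {{u, s}, {t, v}}))"
      then show ?thesis
        using \<open>J = {}\<close> by (intro exI[of _ "{{u, s}, {t, v}}"]) (simp add: simps)
    next
      assume "two_edge_connected V (F \<union> (L - {{s, t}, {u, v}}))"
      then show ?thesis
        using \<open>J = {}\<close> order by (intro exI[of _ "{{s, t}, {u, v}}"]) (simp add: simps)
    qed
  next
    \<comment> \<open>The square shrinks to the path v, u, s, t, whose second corner
      \<open>u\<close> has lost its outer edge. The next three cases are its mirror images.\<close>
    case sa
    let ?K = "insert {s, t} (insert {u, s} (insert {v, u} (insert {t, c} (insert {s, b}
        (insert {v, d} F)))))" and ?R = "{{u, a}, {t, v}}"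
    have "two_edge_connected V (F \<union> (L - ?R))"
    proof (rule extend_two_edge_connected[OF F])
      show "?K \<subseteq> F \<union> (L - ?R)"
        using distinctness by (simp add: doubleton_eq_iff subset_insertI2)
    next
      fix Z assume Z: "Z \<subseteq> V" "Z \<noteq> {}" "Z \<noteq> V"
      have "cut_size ?K Z = cut_size F Z + of_bool ((v \<in> Z) \<noteq> (d \<in> Z))
          + of_bool ((s \<in> Z) \<noteq> (b \<in> Z)) + of_bool ((t \<in> Z) \<noteq> (c \<in> Z))
          + of_bool ((v \<in> Z) \<noteq> (u \<in> Z)) + of_bool ((u \<in> Z) \<noteq> (s \<in> Z)) + of_bool ((s \<in> Z) \<noteq> (t \<in> Z))"
        using fin new distinctness by (simp add: cut_size_insert doubleton_eq_iff)
      also have "2 \<le> \<dots>"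
      proof (rule path_of_four_cut[where n = "cut_size F Z" and e = "Z \<inter> U = {}" and f = "U \<subseteq> Z" and
          A = "d \<in> Z" and C = "b \<in> Z" and D = "c \<in> Z" and
          za = "v \<in> Z" and zb = "u \<in> Z" and zc = "s \<in> Z" and zd = "t \<in> Z"])
        show "Z \<inter> U = {} \<or> 2 \<le> cut_size F Z + of_bool (d \<in> Z) + of_bool (b \<in> Z) + of_bool (c \<in> Z)"
          using rest(1)[of Z] sa by (simp add: add_ac)
        show "U \<subseteq> Z \<or> 2 \<le> cut_size F Z + of_bool (d \<notin> Z) + of_bool (b \<notin> Z) + of_bool (c \<notin> Z)"
          using rest(2)[of Z] sa by (simp add: add_ac)
      qed (use rest_nontrivial[OF Z] in blast)+
      finally show "2 \<le> cut_size ?K Z" .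
    qed
    then show ?thesis
      using sa \<nu> sum_over_J[OF J, of \<nu>] nonneg[of "{u, s}"] nonneg[of "{t, v}"]
      by (intro exI[of _ ?R]) (simp add: simps)
  next
    case sb
    let ?K = "insert {u, v} (insert {s, u} (insert {t, s} (insert {v, d} (insert {u, a}
        (insert {t, c} F)))))" and ?R = "{{s, b}, {t, v}}"
    have "two_edge_connected V (F \<union> (L - ?R))"
    proof (rule extend_two_edge_connected[OF F])
      show "?K \<subseteq> F \<union> (L - ?R)"
        using distinctness by (simp add: doubleton_eq_iff subset_insertI2)
    next
      fix Z assume Z: "Z \<subseteq> V" "Z \<noteq> {}" "Z \<noteq> V"
      have "cut_size ?K Z = cut_size F Z + of_bool ((t \<in> Z) \<noteq> (c \<in> Z))
          + of_bool ((u \<in> Z) \<noteq> (a \<in> Z)) + of_bool ((v \<in> Z) \<noteq> (d \<in> Z))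
          + of_bool ((t \<in> Z) \<noteq> (s \<in> Z)) + of_bool ((s \<in> Z) \<noteq> (u \<in> Z)) + of_bool ((u \<in> Z) \<noteq> (v \<in> Z))"
        using fin new distinctness by (simp add: cut_size_insert doubleton_eq_iff)
      also have "2 \<le> \<dots>"
      proof (rule path_of_four_cut[where n = "cut_size F Z" and e = "Z \<inter> U = {}" and f = "U \<subseteq> Z" and
          A = "c \<in> Z" and C = "a \<in> Z" and D = "d \<in> Z" and
          za = "t \<in> Z" and zb = "s \<in> Z" and zc = "u \<in> Z" and zd = "v \<in> Z"])
        show "Z \<inter> U = {} \<or> 2 \<le> cut_size F Z + of_bool (c \<in> Z) + of_bool (a \<in> Z) + of_bool (d \<in> Z)"
          using rest(1)[of Z] sb by (simp add: add_ac)
        show "U \<subseteq> Z \<or> 2 \<le> cut_size F Z + of_bool (c \<notin> Z) + of_bool (a \<notin> Z) + of_bool (d \<notin> Z)"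
          using rest(2)[of Z] sb by (simp add: add_ac)
      qed (use rest_nontrivial[OF Z] in blast)+
      finally show "2 \<le> cut_size ?K Z" .
    qed
    then show ?thesis
      using sb \<nu> sum_over_J[OF J, of \<nu>] nonneg[of "{u, s}"] nonneg[of "{t, v}"]
      by (intro exI[of _ ?R]) (simp add: simps)
  next
    case tc
    let ?K = "insert {v, u} (insert {t, v} (insert {s, t} (insert {u, a} (insert {v, d}
        (insert {s, b} F)))))" and ?R = "{{t, c}, {u, s}}"
    have "two_edge_connected V (F \<union> (L - ?R))"
    proof (rule extend_two_edge_connected[OF F])
      show "?K \<subseteq> F \<union> (L - ?R)"
        using distinctness by (simp add: doubleton_eq_iff subset_insertI2)
    next
      fix Z assume Z: "Z \<subseteq> V" "Z \<noteq> {}" "Z \<noteq> V"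
      have "cut_size ?K Z = cut_size F Z + of_bool ((s \<in> Z) \<noteq> (b \<in> Z))
          + of_bool ((v \<in> Z) \<noteq> (d \<in> Z)) + of_bool ((u \<in> Z) \<noteq> (a \<in> Z))
          + of_bool ((s \<in> Z) \<noteq> (t \<in> Z)) + of_bool ((t \<in> Z) \<noteq> (v \<in> Z)) + of_bool ((v \<in> Z) \<noteq> (u \<in> Z))"
        using fin new distinctness by (simp add: cut_size_insert doubleton_eq_iff)
      also have "2 \<le> \<dots>"
      proof (rule path_of_four_cut[where n = "cut_size F Z" and e = "Z \<inter> U = {}" and f = "U \<subseteq> Z" and
          A = "b \<in> Z" and C = "d \<in> Z" and D = "a \<in> Z" and
          za = "s \<in> Z" and zb = "t \<in> Z" and zc = "v \<in> Z" and zd = "u \<in> Z"])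
        show "Z \<inter> U = {} \<or> 2 \<le> cut_size F Z + of_bool (b \<in> Z) + of_bool (d \<in> Z) + of_bool (a \<in> Z)"
          using rest(1)[of Z] tc by (simp add: add_ac)
        show "U \<subseteq> Z \<or> 2 \<le> cut_size F Z + of_bool (b \<notin> Z) + of_bool (d \<notin> Z) + of_bool (a \<notin> Z)"
          using rest(2)[of Z] tc by (simp add: add_ac)
      qed (use rest_nontrivial[OF Z] in blast)+
      finally show "2 \<le> cut_size ?K Z" .
    qed
    then show ?thesis
      using tc \<nu> sum_over_J[OF J, of \<nu>] nonneg[of "{u, s}"] nonneg[of "{t, v}"]
      by (intro exI[of _ ?R]) (simp add: simps)
  next
    case td
    let ?K = "insert {t, s} (insert {v, t} (insert {u, v} (insert {s, b} (insert {t, c}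
        (insert {u, a} F)))))" and ?R = "{{v, d}, {u, s}}"
    have "two_edge_connected V (F \<union> (L - ?R))"
    proof (rule extend_two_edge_connected[OF F])
      show "?K \<subseteq> F \<union> (L - ?R)"
        using distinctness by (simp add: doubleton_eq_iff subset_insertI2)
    next
      fix Z assume Z: "Z \<subseteq> V" "Z \<noteq> {}" "Z \<noteq> V"
      have "cut_size ?K Z = cut_size F Z + of_bool ((u \<in> Z) \<noteq> (a \<in> Z))
          + of_bool ((t \<in> Z) \<noteq> (c \<in> Z)) + of_bool ((s \<in> Z) \<noteq> (b \<in> Z))
          + of_bool ((u \<in> Z) \<noteq> (v \<in> Z)) + of_bool ((v \<in> Z) \<noteq> (t \<in> Z)) + of_bool ((t \<in> Z) \<noteq> (s \<in> Z))"
        using fin new distinctness by (simp add: cut_size_insert doubleton_eq_iff)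
      also have "2 \<le> \<dots>"
      proof (rule path_of_four_cut[where n = "cut_size F Z" and e = "Z \<inter> U = {}" and f = "U \<subseteq> Z" and
          A = "a \<in> Z" and C = "c \<in> Z" and D = "b \<in> Z" and
          za = "u \<in> Z" and zb = "v \<in> Z" and zc = "t \<in> Z" and zd = "s \<in> Z"])
        show "Z \<inter> U = {} \<or> 2 \<le> cut_size F Z + of_bool (a \<in> Z) + of_bool (c \<in> Z) + of_bool (b \<in> Z)"
          using rest(1)[of Z] td by (simp add: add_ac)
        show "U \<subseteq> Z \<or> 2 \<le> cut_size F Z + of_bool (a \<notin> Z) + of_bool (c \<notin> Z) + of_bool (b \<notin> Z)"
          using rest(2)[of Z] td by (simp add: add_ac)
      qed (use rest_nontrivial[OF Z] in blast)+
      finally show "2 \<le> cut_size ?K Z" .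
    qed
    then show ?thesis
      using td \<nu> sum_over_J[OF J, of \<nu>] nonneg[of "{u, s}"] nonneg[of "{t, v}"]
      by (intro exI[of _ ?R]) (simp add: simps)
  next
    \<comment> \<open>From here on two outer edges are removed and the square stays intact.\<close>
    case sa_tc
    let ?K = "insert {v, u} (insert {t, v} (insert {s, t} (insert {u, s} (insert {v, d}
        (insert {s, b} F)))))" and ?R = "{{u, a}, {t, c}}"
    have "two_edge_connected V (F \<union> (L - ?R))"
    proof (rule extend_two_edge_connected[OF F])
      show "?K \<subseteq> F \<union> (L - ?R)"
        using distinctness by (simp add: doubleton_eq_iff subset_insertI2)
    next
      fix Z assume Z: "Z \<subseteq> V" "Z \<noteq> {}" "Z \<noteq> V"
      have "cut_size ?K Z = cut_size F Z + of_bool ((s \<in> Z) \<noteq> (b \<in> Z))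
          + of_bool ((v \<in> Z) \<noteq> (d \<in> Z)) + of_bool ((u \<in> Z) \<noteq> (s \<in> Z))
          + of_bool ((s \<in> Z) \<noteq> (t \<in> Z)) + of_bool ((t \<in> Z) \<noteq> (v \<in> Z)) + of_bool ((v \<in> Z) \<noteq> (u \<in> Z))"
        using fin new distinctness by (simp add: cut_size_insert doubleton_eq_iff)
      also have "2 \<le> \<dots>"
      proof (rule cycle_of_four_cut[where n = "cut_size F Z" and e = "Z \<inter> U = {}"
          and f = "U \<subseteq> Z" and
          A = "b \<in> Z" and B = "d \<in> Z" and p = "s \<in> Z" and q = "v \<in> Z" and
          za = "u \<in> Z" and zb = "s \<in> Z" and zc = "t \<in> Z" and zd = "v \<in> Z"])
        show "Z \<inter> U = {} \<or> 2 \<le> cut_size F Z + of_bool (b \<in> Z) + of_bool (d \<in> Z)"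
          using rest(1)[of Z] sa_tc by (simp add: add_ac)
        show "U \<subseteq> Z \<or> 2 \<le> cut_size F Z + of_bool (b \<notin> Z) + of_bool (d \<notin> Z)"
          using rest(2)[of Z] sa_tc by (simp add: add_ac)
      qed (use rest_nontrivial[OF Z] in blast)+
      finally show "2 \<le> cut_size ?K Z" .
    qed
    then show ?thesis
      using sa_tc \<nu> sum_over_J[OF J, of \<nu>] nonneg[of "{u, s}"] nonneg[of "{t, v}"]
      by (intro exI[of _ ?R]) (simp add: simps)
  next
    case sa_td
    let ?K = "insert {v, u} (insert {t, v} (insert {s, t} (insert {u, s} (insert {t, c}
        (insert {s, b} F)))))" and ?R = "{{u, a}, {v, d}}"
    have "two_edge_connected V (F \<union> (L - ?R))"
    proof (rule extend_two_edge_connected[OF F])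
      show "?K \<subseteq> F \<union> (L - ?R)"
        using distinctness by (simp add: doubleton_eq_iff subset_insertI2)
    next
      fix Z assume Z: "Z \<subseteq> V" "Z \<noteq> {}" "Z \<noteq> V"
      have "cut_size ?K Z = cut_size F Z + of_bool ((s \<in> Z) \<noteq> (b \<in> Z))
          + of_bool ((t \<in> Z) \<noteq> (c \<in> Z)) + of_bool ((u \<in> Z) \<noteq> (s \<in> Z))
          + of_bool ((s \<in> Z) \<noteq> (t \<in> Z)) + of_bool ((t \<in> Z) \<noteq> (v \<in> Z)) + of_bool ((v \<in> Z) \<noteq> (u \<in> Z))"
        using fin new distinctness by (simp add: cut_size_insert doubleton_eq_iff)
      also have "2 \<le> \<dots>"
      proof (rule cycle_of_four_cut[where n = "cut_size F Z" and e = "Z \<inter> U = {}"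
          and f = "U \<subseteq> Z" and
          A = "b \<in> Z" and B = "c \<in> Z" and p = "s \<in> Z" and q = "t \<in> Z" and
          za = "u \<in> Z" and zb = "s \<in> Z" and zc = "t \<in> Z" and zd = "v \<in> Z"])
        show "Z \<inter> U = {} \<or> 2 \<le> cut_size F Z + of_bool (b \<in> Z) + of_bool (c \<in> Z)"
          using rest(1)[of Z] sa_td by (simp add: add_ac)
        show "U \<subseteq> Z \<or> 2 \<le> cut_size F Z + of_bool (b \<notin> Z) + of_bool (c \<notin> Z)"
          using rest(2)[of Z] sa_td by (simp add: add_ac)
      qed (use rest_nontrivial[OF Z] in blast)+
      finally show "2 \<le> cut_size ?K Z" .
    qed
    then show ?thesis
      using sa_td \<nu> sum_over_J[OF J, of \<nu>] nonneg[of "{u, s}"] nonneg[of "{t, v}"]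
      by (intro exI[of _ ?R]) (simp add: simps)
  next
    case sb_tc
    let ?K = "insert {v, u} (insert {t, v} (insert {s, t} (insert {u, s} (insert {v, d}
        (insert {u, a} F)))))" and ?R = "{{s, b}, {t, c}}"
    have "two_edge_connected V (F \<union> (L - ?R))"
    proof (rule extend_two_edge_connected[OF F])
      show "?K \<subseteq> F \<union> (L - ?R)"
        using distinctness by (simp add: doubleton_eq_iff subset_insertI2)
    next
      fix Z assume Z: "Z \<subseteq> V" "Z \<noteq> {}" "Z \<noteq> V"
      have "cut_size ?K Z = cut_size F Z + of_bool ((u \<in> Z) \<noteq> (a \<in> Z))
          + of_bool ((v \<in> Z) \<noteq> (d \<in> Z)) + of_bool ((u \<in> Z) \<noteq> (s \<in> Z))
          + of_bool ((s \<in> Z) \<noteq> (t \<in> Z)) + of_bool ((t \<in> Z) \<noteq> (v \<in> Z)) + of_bool ((v \<in> Z) \<noteq> (u \<in> Z))"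
        using fin new distinctness by (simp add: cut_size_insert doubleton_eq_iff)
      also have "2 \<le> \<dots>"
      proof (rule cycle_of_four_cut[where n = "cut_size F Z" and e = "Z \<inter> U = {}"
          and f = "U \<subseteq> Z" and
          A = "a \<in> Z" and B = "d \<in> Z" and p = "u \<in> Z" and q = "v \<in> Z" and
          za = "u \<in> Z" and zb = "s \<in> Z" and zc = "t \<in> Z" and zd = "v \<in> Z"])
        show "Z \<inter> U = {} \<or> 2 \<le> cut_size F Z + of_bool (a \<in> Z) + of_bool (d \<in> Z)"
          using rest(1)[of Z] sb_tc by (simp add: add_ac)
        show "U \<subseteq> Z \<or> 2 \<le> cut_size F Z + of_bool (a \<notin> Z) + of_bool (d \<notin> Z)"
          using rest(2)[of Z] sb_tc by (simp add: add_ac)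
      qed (use rest_nontrivial[OF Z] in blast)+
      finally show "2 \<le> cut_size ?K Z" .
    qed
    then show ?thesis
      using sb_tc \<nu> sum_over_J[OF J, of \<nu>] nonneg[of "{u, s}"] nonneg[of "{t, v}"]
      by (intro exI[of _ ?R]) (simp add: simps)
  next
    case sb_td
    let ?K = "insert {v, u} (insert {t, v} (insert {s, t} (insert {u, s} (insert {t, c}
        (insert {u, a} F)))))" and ?R = "{{s, b}, {v, d}}"
    have "two_edge_connected V (F \<union> (L - ?R))"
    proof (rule extend_two_edge_connected[OF F])
      show "?K \<subseteq> F \<union> (L - ?R)"
        using distinctness by (simp add: doubleton_eq_iff subset_insertI2)
    next
      fix Z assume Z: "Z \<subseteq> V" "Z \<noteq> {}" "Z \<noteq> V"
      have "cut_size ?K Z = cut_size F Z + of_bool ((u \<in> Z) \<noteq> (a \<in> Z))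
          + of_bool ((t \<in> Z) \<noteq> (c \<in> Z)) + of_bool ((u \<in> Z) \<noteq> (s \<in> Z))
          + of_bool ((s \<in> Z) \<noteq> (t \<in> Z)) + of_bool ((t \<in> Z) \<noteq> (v \<in> Z)) + of_bool ((v \<in> Z) \<noteq> (u \<in> Z))"
        using fin new distinctness by (simp add: cut_size_insert doubleton_eq_iff)
      also have "2 \<le> \<dots>"
      proof (rule cycle_of_four_cut[where n = "cut_size F Z" and e = "Z \<inter> U = {}"
          and f = "U \<subseteq> Z" and
          A = "a \<in> Z" and B = "c \<in> Z" and p = "u \<in> Z" and q = "t \<in> Z" and
          za = "u \<in> Z" and zb = "s \<in> Z" and zc = "t \<in> Z" and zd = "v \<in> Z"])
        show "Z \<inter> U = {} \<or> 2 \<le> cut_size F Z + of_bool (a \<in> Z) + of_bool (c \<in> Z)"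
          using rest(1)[of Z] sb_td by (simp add: add_ac)
        show "U \<subseteq> Z \<or> 2 \<le> cut_size F Z + of_bool (a \<notin> Z) + of_bool (c \<notin> Z)"
          using rest(2)[of Z] sb_td by (simp add: add_ac)
      qed (use rest_nontrivial[OF Z] in blast)+
      finally show "2 \<le> cut_size ?K Z" .
    qed
    then show ?thesis
      using sb_td \<nu> sum_over_J[OF J, of \<nu>] nonneg[of "{u, s}"] nonneg[of "{t, v}"]
      by (intro exI[of _ ?R]) (simp add: simps)
  qed
qed

text \<open>The difference between w(L) and \<nu>(N) is 4 (w(us) + w(tv)); 2/9 of it is 8/9 (w(us) +
  w(tv)), which the default gain covers.\<close>

lemma removable_old:
  assumes nonneg: "\<And>e. 0 \<le> w e"
    and order: "w {u, s} + w {t, v} \<le> w {s, t} + w {u, v}"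
    and IH: "\<And>w'. removable V0 (E0 \<union> N) w'"
  shows "removable V (E0 \<union> L) w"
proof -
  define \<nu> where "\<nu> = (\<lambda>e. if e = {s, a} then w {u, a} - w {u, s}
      else if e = {s, b} then w {s, b} - w {u, s}
      else if e = {t, c} then w {t, c} - w {t, v} else if e = {t, d} then w {v, d} - w {t, v}
      else w {s, t} + w {u, v} - w {u, s} - w {t, v})"
  show ?thesis
  proof (rule removable_lift[where n = "\<lambda>e. e" and I = N and \<nu> = \<nu> and V' = V0
        and C = "w {u, s} + w {t, v}"])
    show "E0 \<inter> (\<lambda>e. e) ` N = {}" using not_in_E0 by simp
    show "E0 \<inter> L = {}" using not_in_E0 by simp
    show "removable V0 (E0 \<union> (\<lambda>e. e) ` N) w'" for w' using IH by simp
  next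
    fix J X
    assume "J \<subseteq> N" "X \<subseteq> E0" "two_edge_connected V0 (X \<union> (\<lambda>e. e) ` (N - J))"
    then show "\<exists>R\<subseteq>L. two_edge_connected V (X \<union> (L - R)) \<and>
        w {u, s} + w {t, v} + sum \<nu> J \<le> sum w R"
      unfolding \<nu>_def using lift[OF nonneg order] by simp
  next
    have N_eq: "sum \<nu> N = (w {u, a} - w {u, s}) + (w {s, b} - w {u, s}) + (w {t, c} - w {t, v})
        + (w {v, d} - w {t, v}) + (w {s, t} + w {u, v} - w {u, s} - w {t, v})"
      unfolding sum_over_N unfolding \<nu>_def using distinctness by (simp add: doubleton_eq_iff)
    have L_eq: "sum w L = w {u, a} + w {u, s} + w {s, b} + w {s, t} + w {t, c} + w {t, v}
        + w {v, d} + w {u, v}"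
      using distinctness by (simp add: doubleton_eq_iff)
    show "2 / 9 * sum w L \<le> w {u, s} + w {t, v} + 2 / 9 * sum \<nu> N"
      unfolding N_eq L_eq using nonneg[of "{u, s}"] nonneg[of "{t, v}"] by (simp add: field_simps)
  qed (use finite_E0 in simp_all)
qed

end

context essentially_4_edge_connected
begin

lemma ordered_square_removable:
  assumes IH: "\<And>(V' :: 'a set) E' w'. card V' < card V \<Longrightarrow> cubic_3_edge_connected V' E' \<Longrightarrow>
      removable V' E' w'"
    and nonneg: "\<And>e. 0 \<le> w e"
    and square: "{u, s} \<in> E" "{s, t} \<in> E" "{t, v} \<in> E" "{v, u} \<in> E" "u \<noteq> t" "s \<noteq> v"
    and order: "w {u, s} + w {t, v} \<le> w {s, t} + w {v, u}"
  shows "removable V E w"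
proof -
  have comm: "{p, q} \<in> E \<longleftrightarrow> {q, p} \<in> E" for p q by (simp add: insert_commute)
  have irrefl: "{p, p} \<notin> E" for p using edge_neq[OF graph, of p p] by blast
  have tri: "\<not> ({p, q} \<in> E \<and> {q, r} \<in> E \<and> {p, r} \<in> E)" for p q r
    using no_triangle by blast
  have square': "{s, u} \<in> E" "{t, s} \<in> E" "{v, t} \<in> E" "{u, v} \<in> E"
    using square(1-4) comm by blast+
  obtain a where a: "a \<noteq> v" "a \<noteq> s" "\<And>z. {u, z} \<in> E \<longleftrightarrow> z = v \<or> z = s \<or> z = a"
    by (rule cubic_third_neighbour[OF graph cubic square'(4) square(1) square(6)[symmetric]]) blast
  obtain b where b: "b \<noteq> u" "b \<noteq> t" "\<And>z. {s, z} \<in> E \<longleftrightarrow> z = u \<or> z = t \<or> z = b"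
    by (rule cubic_third_neighbour[OF graph cubic square'(1) square(2,5)]) blast
  obtain c where c: "c \<noteq> s" "c \<noteq> v" "\<And>z. {t, z} \<in> E \<longleftrightarrow> z = s \<or> z = v \<or> z = c"
    by (rule cubic_third_neighbour[OF graph cubic square'(2) square(3,6)]) blast
  obtain d where d: "d \<noteq> t" "d \<noteq> u" "\<And>z. {v, z} \<in> E \<longleftrightarrow> z = t \<or> z = u \<or> z = d"
    by (rule cubic_third_neighbour[OF graph cubic square'(3) square(4) square(5)[symmetric]]) blast
  define U where "U = V - {u, v, s, t}"
  define E0 where "E0 = {e \<in> E. e \<inter> {u, v, s, t} = {}}"
  have in_V: "u \<in> V" "v \<in> V" "s \<in> V" "t \<in> V" using edge_in[OF graph] square by blast+
  have in_U: "z \<in> U" if "{p, z} \<in> E" "z \<noteq> u" "z \<noteq> v" "z \<noteq> s" "z \<noteq> t" for p z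
    using edge_in[OF graph that(1)] that unfolding U_def by simp
  have ne: "u \<noteq> v" "u \<noteq> s" "v \<noteq> t" "s \<noteq> t" using square irrefl by metis+
  have non_edges: "{u, t} \<notin> E" "{t, u} \<notin> E" "{s, v} \<notin> E" "{v, s} \<notin> E"
    using tri[of u s t] tri[of s t v] square comm by blast+
  have inside: "a \<in> U" "b \<in> U" "c \<in> U" "d \<in> U"
    using in_U[of u a] in_U[of s b] in_U[of t c] in_U[of v d] a b c d non_edges irrefl by metis+
  have "finite_simple_graph U E0"
    unfolding E0_def U_def by (rule finite_simple_graph_delete[OF graph])
  moreover have "u \<notin> U" "v \<notin> U" "s \<notin> U" "t \<notin> U" unfolding U_def by simp_all
  moreover have "a \<noteq> b" "c \<noteq> d"
    using tri[of u s a] tri[of t v c] a(3) b(3) c(3) d(3) square(1,3) by metis+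
  ultimately interpret square_reduction U E0 u v s t a b c d
    using inside ne square(5) square(6)[symmetric] by unfold_locales
  have V_eq: "V = {u, v, s, t} \<union> U" using in_V unfolding U_def by blast
  have E_eq: "E = E0 \<union> {{u, a}, {u, s}, {s, b}, {s, t}, {t, c}, {t, v}, {v, d}, {u, v}}"
  proof -
    have "E = E0 \<union> ({e \<in> E. u \<in> e} \<union> {e \<in> E. v \<in> e} \<union> {e \<in> E. s \<in> e} \<union> {e \<in> E. t \<in> e})"
      unfolding E0_def by auto
    then show ?thesis
      unfolding incident_edges[OF graph a(3)] incident_edges[OF graph b(3)]
        incident_edges[OF graph c(3)] incident_edges[OF graph d(3)]
      by (simp add: insert_commute)
  qed
  have red: "cubic_3_edge_connected ({s, t} \<union> U) (E0 \<union> {{s, a}, {s, b}, {t, c}, {t, d}, {s, t}})"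
    unfolding cubic_3_edge_connected_def
  proof (intro conjI new_graph)
    show "cubic ({s, t} \<union> U) (E0 \<union> {{s, a}, {s, b}, {t, c}, {t, d}, {s, t}})"
      using cubic_reduced cubic unfolding V_eq[symmetric] E_eq[symmetric] .
    show "edge_connected 3 ({s, t} \<union> U) (E0 \<union> {{s, a}, {s, b}, {t, c}, {t, d}, {s, t}})"
    proof (rule three_edge_connected_reduced; unfold V_eq[symmetric] E_eq[symmetric])
      show "edge_connected 3 V E" by (rule conn)
    next
      fix A p q p' q'
      assume "A \<subseteq> V" "p \<in> A" "q \<in> A" "p \<noteq> q" "p' \<in> V - A" "q' \<in> V - A" "p' \<noteq> q'"
      then show "4 \<le> cut_size E A" by (rule four)
    qed
  qed
  have "card ({s, t} \<union> U) < card V"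
  proof (rule psubset_card_mono)
    show "finite V" using graph unfolding finite_simple_graph_def by simp
    have "u \<notin> {s, t} \<union> U" using outside ne square by simp
    then show "{s, t} \<union> U \<subset> V" using in_V unfolding V_eq by blast
  qed
  from IH[OF this red] have IH':
    "removable ({s, t} \<union> U) (E0 \<union> {{s, a}, {s, b}, {t, c}, {t, d}, {s, t}}) w'" for w' .
  have "w {u, s} + w {t, v} \<le> w {s, t} + w {u, v}" using order by (simp add: insert_commute)
  from removable_old[OF nonneg this IH'] show ?thesis
    unfolding V_eq[symmetric] E_eq[symmetric] .
qed

text \<open>Rotating a square by one corner swaps its two opposite pairs, so \<open>order\<close>
  can always be arranged. Any square therefore settles the claim.\<close>

lemma removable_nonneg:
  assumes IH: "\<And>(V' :: 'a set) E' w'. card V' < card V \<Longrightarrow> cubic_3_edge_connected V' E' \<Longrightarrow>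
      removable V' E' w'"
    and nonneg: "\<And>e. 0 \<le> w e" and "E \<noteq> {}"
  shows "removable V E w"
proof (rule ccontr)
  assume neg: "\<not> removable V E w"
  have "p = r \<or> q = s"
    if sq: "{p, q} \<in> E" "{q, r} \<in> E" "{r, s} \<in> E" "{s, p} \<in> E" for p q r s
  proof (rule ccontr)
    assume ne: "\<not> ?thesis"
    then have "\<not> w {p, q} + w {r, s} \<le> w {q, r} + w {s, p}"
      using ordered_square_removable[where w = w, OF IH nonneg sq] neg by blast
    moreover have "\<not> w {q, r} + w {s, p} \<le> w {r, s} + w {p, q}"
      using ordered_square_removable[where w = w, OF IH nonneg sq(2-4) sq(1)] neg ne by blast
    ultimately show False by linarith
  qed
  then show False
    using removable_if_no_square[where w = w, OF _ IH nonneg \<open>E \<noteq> {}\<close>] neg by blast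
qed

end

subsection \<open>Gluing along \<open>3\<close>-edge cuts\<close>

text \<open>\<open>a i\<close> and \<open>b i\<close> are the ends of the cut edge \<open>i\<close>
  in \<open>A\<close> and outside. The contracted sides are represented by vertices \<alpha> and
  \<beta> of the sides themselves, so the vertex type does not change in the induction.\<close>

locale three_cut =
  fixes V :: "'a set" and E :: "'a set set" and A :: "'a set" and I :: "'a set set"
    and a b :: "'a set \<Rightarrow> 'a" and \<alpha> \<beta> :: 'a
  assumes graph: "finite_simple_graph V E" and cubic: "cubic V E" and conn: "edge_connected 3 V E"
    and A: "A \<subseteq> V" and card_I: "card I = 3" and I_eq: "I = edge_cut E A"
    and ends: "\<And>i. i \<in> I \<Longrightarrow> i = {a i, b i} \<and> a i \<in> A \<and> b i \<in> V - A"
    and two_in: "\<exists>p\<in>A. \<exists>q\<in>A. p \<noteq> q" and two_out: "\<exists>p\<in>V - A. \<exists>q\<in>V - A. p \<noteq> q"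
    and \<alpha>: "\<alpha> \<in> A" and \<beta>: "\<beta> \<in> V - A"
begin

abbreviation "inner \<equiv> {e \<in> E. e \<subseteq> A}"
abbreviation "outer \<equiv> {e \<in> E. e \<subseteq> V - A}"
abbreviation "star i \<equiv> {a i, \<beta>}"

text \<open>The situation is symmetric, so whatever is shown for contracting the outside also serves
  for contracting \<open>A\<close>.\<close>

lemma swap: "three_cut V E (V - A) I b a \<beta> \<alpha>"
proof
  have A': "V - (V - A) = A" using A by blast
  show "\<exists>p\<in>V - (V - A). \<exists>q\<in>V - (V - A). p \<noteq> q" "\<alpha> \<in> V - (V - A)"
    unfolding A' by (rule two_in, rule \<alpha>)
  show "i = {b i, a i} \<and> b i \<in> V - A \<and> a i \<in> V - (V - A)" if "i \<in> I" for i
    unfolding A' using ends[OF that] by (metis insert_commute)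
  show "I = edge_cut E (V - A)" unfolding I_eq edge_cut_compl[OF graph] ..
qed (rule graph cubic conn card_I two_out \<beta> Diff_subset)+

lemma finite_V: "finite V" using graph unfolding finite_simple_graph_def by simp
lemma finite_E: "finite E" by (rule finite_simple_graph_finite_edges[OF graph])
lemma finite_I: "finite I" using card_I card.infinite by fastforce

text \<open>If two cut edges met in a vertex of \<open>A\<close>, moving it out of \<open>A\<close>
  would exchange at least two cut edges for at most one and leave a cut of size at most two. Hence
  the contraction is simple.\<close>

lemma inj_ends: "inj_on a I"
proof (rule inj_onI, rule ccontr)
  fix i j assume ij: "i \<in> I" "j \<in> I" "a i = a j" "i \<noteq> j"
  have "i \<in> E" "j \<in> E" using ij I_eq unfolding edge_cut_def by auto
  then have E: "{a i, b i} \<in> E" "{a i, b j} \<in> E" using ends ij by metis+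
  have "b i \<noteq> b j" using ends ij by metis
  obtain x y where xy: "x \<noteq> y" "x \<noteq> b i" "y \<noteq> b i" "\<And>z. {a i, z} \<in> E \<longleftrightarrow> z = b i \<or> z = x \<or> z = y"
    by (rule cubic_neighbours_of_edge[OF graph cubic E(1)]) blast
  have "\<exists>c. c \<noteq> b i \<and> c \<noteq> b j \<and> (\<forall>z. {a i, z} \<in> E \<longleftrightarrow> z = b i \<or> z = b j \<or> z = c)"
    using xy E(2) \<open>b i \<noteq> b j\<close> by metis
  then obtain c where c: "c \<noteq> b i" "c \<noteq> b j" "\<And>z. {a i, z} \<in> E \<longleftrightarrow> z = b i \<or> z = b j \<or> z = c"
    by blast
  have "insert (a i) (A - {a i}) = A" using ends[OF ij(1)] by blast
  moreover have "b i \<notin> A" "b j \<notin> A" using ends ij by blast+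
  moreover have "cut_size E A = 3" using card_I I_eq by simp
  ultimately have "cut_size E (A - {a i}) \<le> 2"
    using cut_size_insert_vertex[OF graph _ c(3), of "A - {a i}"] c(1,2) \<open>b i \<noteq> b j\<close>
    by (simp add: of_bool_def split: if_splits)
  moreover have "A - {a i} \<noteq> {}" using two_in by blast
  moreover have "A - {a i} \<subseteq> V" "A - {a i} \<noteq> V" using A \<beta> by blast+
  ultimately show False
    using conn[unfolded edge_connected_def, rule_format, of "A - {a i}"] by simp
qed

lemma star_inj: "inj_on star I"
proof (rule inj_onI)
  fix i j assume "i \<in> I" "j \<in> I" "star i = star j"
  then have "a i = a j" using ends[of i] ends[of j] \<beta> by (auto simp: doubleton_eq_iff)
  then show "i = j" using inj_ends \<open>i \<in> I\<close> \<open>j \<in> I\<close> by (auto dest: inj_onD)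
qed

lemma star_not_inner: "star i \<notin> inner"
  using \<beta> by simp

lemma cut_size_star:
  assumes "F \<subseteq> inner" "I' \<subseteq> I"
  shows "cut_size (F \<union> star ` I') Z = cut_size F Z + card {i \<in> I'. (a i \<in> Z) \<noteq> (\<beta> \<in> Z)}"
proof -
  have "finite F" "finite I'"
    using assms finite_E finite_I by (auto intro: finite_subset[OF _ finite_E] finite_subset)
  moreover have "F \<inter> star ` I' = {}" using assms(1) star_not_inner by blast
  moreover have "edge_cut (star ` I') Z = star ` {i \<in> I'. (a i \<in> Z) \<noteq> (\<beta> \<in> Z)}"
  proof -
    have "card (star i \<inter> Z) = 1 \<longleftrightarrow> (a i \<in> Z) \<noteq> (\<beta> \<in> Z)" if "i \<in> I'" for i
    proof -
      have "i \<in> I" using that assms(2) by blast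
      then have "a i \<noteq> \<beta>" using ends[of i] \<beta> by auto
      then show ?thesis by (rule card_doubleton_Int_eq_1)
    qed
    then show ?thesis unfolding edge_cut_def by auto
  qed
  moreover have "inj_on star {i \<in> I'. (a i \<in> Z) \<noteq> (\<beta> \<in> Z)}"
    using star_inj by (rule inj_on_subset) (use assms(2) in auto)
  ultimately show ?thesis by (simp add: cut_size_Un_disjoint card_image)
qed

lemma cut_size_split:
  assumes "F \<subseteq> inner" "G \<subseteq> outer" "I' \<subseteq> I"
  shows "cut_size (F \<union> (G \<union> I')) Z =
    cut_size F (Z \<inter> A) + cut_size G (Z - A) + card {i \<in> I'. (a i \<in> Z) \<noteq> (b i \<in> Z)}"
proof -
  have fin: "finite F" "finite G" "finite I'"
    using assms finite_I by (auto intro: finite_subset[OF _ finite_E] finite_subset)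
  have "F \<inter> (G \<union> I') = {}" "G \<inter> I' = {}"
  proof -
    have "\<not> i \<subseteq> A" "\<not> i \<subseteq> V - A" if "i \<in> I" for i
    proof -
      have "a i \<in> i" "b i \<in> i" using ends[OF that] by (metis insertCI)+
      then show "\<not> i \<subseteq> A" "\<not> i \<subseteq> V - A" using ends[OF that] by auto
    qed
    moreover have "\<not> (e \<subseteq> A \<and> e \<subseteq> V - A)" if "e \<in> E" for e
      using finite_simple_graph_edgeE[OF graph that] by (metis Diff_iff insertI1 subset_iff)
    ultimately show "F \<inter> (G \<union> I') = {}" "G \<inter> I' = {}" using assms by blast+
  qed
  then have "cut_size (F \<union> (G \<union> I')) Z = cut_size F Z + cut_size G Z + cut_size I' Z"
    using fin by (simp add: cut_size_Un_disjoint)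
  moreover have "edge_cut F Z = edge_cut F (Z \<inter> A)"
  proof -
    have "e \<inter> Z = e \<inter> (Z \<inter> A)" if "e \<in> F" for e using that assms(1) by blast
    then show ?thesis unfolding edge_cut_def by auto
  qed
  moreover have "edge_cut G Z = edge_cut G (Z - A)"
  proof -
    have "e \<inter> Z = e \<inter> (Z - A)" if "e \<in> G" for e using that assms(2) by blast
    then show ?thesis unfolding edge_cut_def by auto
  qed
  moreover have "edge_cut I' Z = {i \<in> I'. (a i \<in> Z) \<noteq> (b i \<in> Z)}"
  proof -
    have "card (i \<inter> Z) = 1 \<longleftrightarrow> (a i \<in> Z) \<noteq> (b i \<in> Z)" if "i \<in> I'" for i
    proof -
      have i: "i = {a i, b i}" "a i \<noteq> b i" using ends[of i] that assms(3) by auto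
      show ?thesis using card_doubleton_Int_eq_1[OF i(2), of Z] i(1) by simp
    qed
    then show ?thesis unfolding edge_cut_def by auto
  qed
  ultimately show ?thesis by simp
qed

lemma E_split: "E = inner \<union> (outer \<union> I)"
proof -
  have "e \<subseteq> A \<or> e \<subseteq> V - A \<or> e \<in> I" if e: "e \<in> E" for e
  proof -
    obtain p q where "p \<in> V" "q \<in> V" "p \<noteq> q" "e = {p, q}"
      by (rule finite_simple_graph_edgeE[OF graph e])
    then show ?thesis using e card_doubleton_Int_eq_1[of p q A] unfolding I_eq edge_cut_def by auto
  qed
  then show ?thesis unfolding I_eq edge_cut_def by auto
qed

lemma contracted_graph: "finite_simple_graph (insert \<beta> A) (inner \<union> star ` I)"
proof -
  have "finite_simple_graph A inner"
  proof -
    have "e \<inter> (V - A) = {} \<longleftrightarrow> e \<subseteq> A" if "e \<in> E" for e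
      using finite_simple_graph_edge_subset[OF graph that] A by blast
    then have "{e \<in> E. e \<inter> (V - A) = {}} = inner" by auto
    moreover have "V - (V - A) = A" using A by blast
    ultimately show ?thesis using finite_simple_graph_delete[OF graph, of "V - A"] by simp
  qed
  then have "finite_simple_graph (insert \<beta> A) inner"
    by (rule finite_simple_graph_mono) (use finite_subset[OF A finite_V] in auto)
  moreover have "finite_simple_graph (insert \<beta> A) (star ` I)"
    unfolding finite_simple_graph_def
  proof (intro conjI ballI)
    show "finite (insert \<beta> A)" using finite_subset[OF A finite_V] by simp
    fix e assume "e \<in> star ` I"
    then obtain i where "i \<in> I" "e = star i" by blast
    then show "\<exists>u\<in>insert \<beta> A. \<exists>v\<in>insert \<beta> A. u \<noteq> v \<and> e = {u, v}"
      using ends[of i] \<beta> by (intro bexI[of _ "a i"] bexI[of _ \<beta>]) auto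
  qed
  ultimately show ?thesis by (simp add: finite_simple_graph_Un)
qed

lemma cut_size_contracted:
  assumes "X \<subseteq> A"
  shows "cut_size (inner \<union> star ` I) X = cut_size E X"
proof -
  have "\<beta> \<notin> X" "\<And>i. i \<in> I \<Longrightarrow> b i \<notin> X" "X \<inter> A = X" "X - A = {}"
    using assms \<beta> ends by blast+
  then have "{i \<in> I. (a i \<in> X) \<noteq> (b i \<in> X)} = {i \<in> I. (a i \<in> X) \<noteq> (\<beta> \<in> X)}" by auto
  moreover have "cut_size outer {} = 0" unfolding edge_cut_def by simp
  ultimately show ?thesis
    using cut_size_star[of inner I X] cut_size_split[of inner outer I X] E_split
      \<open>X \<inter> A = X\<close> \<open>X - A = {}\<close> by simp
qed

text \<open>Cuts that avoid \<beta> are cuts of the original graph, and the others are complements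
  of such cuts; the degree of \<beta> is the number of cut edges.\<close>

lemma contracted: "cubic_3_edge_connected (insert \<beta> A) (inner \<union> star ` I)"
  unfolding cubic_3_edge_connected_def
proof (intro conjI contracted_graph)
  show "cubic (insert \<beta> A) (inner \<union> star ` I)"
    unfolding cubic_def
  proof
    fix z assume z: "z \<in> insert \<beta> A"
    have "cut_size (inner \<union> star ` I) {z} = 3"
    proof (cases "z \<in> A")
      case True
      then have "cut_size E {z} = 3"
        using cubic A unfolding cubic_def cut_size_singleton[OF graph] by blast
      then show ?thesis using cut_size_contracted[of "{z}"] True by simp
    next
      case False
      then have "z = \<beta>" using z by simp
      have "e \<inter> {\<beta>} = {}" if "e \<in> inner" for e using that \<beta> by blast
      then have "edge_cut inner {\<beta>} = {}" unfolding edge_cut_def by auto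
      moreover have "{i \<in> I. (a i \<in> {\<beta>}) \<noteq> (\<beta> \<in> {\<beta>})} = I" using ends \<beta> by force
      ultimately show ?thesis
        using cut_size_star[of inner I "{\<beta>}"] card_I \<open>z = \<beta>\<close> by simp
    qed
    then show "vertex_degree (inner \<union> star ` I) z = 3"
      unfolding cut_size_singleton[OF contracted_graph] .
  qed
  have inside: "3 \<le> cut_size (inner \<union> star ` I) X" if "X \<subseteq> A" "X \<noteq> {}" for X
  proof -
    have "X \<subseteq> V" "X \<noteq> V" using that A \<beta> by blast+
    then show ?thesis
      using conn that(2) unfolding edge_connected_def cut_size_contracted[OF that(1)] by blast
  qed
  show "edge_connected 3 (insert \<beta> A) (inner \<union> star ` I)"
    unfolding edge_connected_def
  proof (intro allI impI)
    fix Z assume Z: "Z \<subseteq> insert \<beta> A \<and> Z \<noteq> {} \<and> Z \<noteq> insert \<beta> A"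
    show "3 \<le> cut_size (inner \<union> star ` I) Z"
    proof (cases "\<beta> \<in> Z")
      case True
      then have "insert \<beta> A - Z \<subseteq> A" "insert \<beta> A - Z \<noteq> {}" using Z by blast+
      then have "3 \<le> cut_size (inner \<union> star ` I) (insert \<beta> A - Z)" by (rule inside)
      then show ?thesis unfolding edge_cut_compl[OF contracted_graph] .
    next
      case False
      then show ?thesis using Z by (intro inside) auto
    qed
  qed
qed

lemma card_contracted: "card (insert \<beta> A) < card V"
  using two_out A \<beta> by (intro psubset_card_mono[OF finite_V]) blast

lemma side_cut:
  assumes F: "F \<subseteq> inner" and I': "I' \<subseteq> I" and X: "X \<subseteq> A"
    and tec: "two_edge_connected (insert \<beta> A) (F \<union> star ` I')"
  shows "X \<noteq> {} \<Longrightarrow> 2 \<le> cut_size F X + card {i \<in> I'. a i \<in> X}"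
    and "X \<noteq> A \<Longrightarrow> 2 \<le> cut_size F X + card {i \<in> I'. a i \<notin> X}"
proof -
  have \<beta>X: "\<beta> \<notin> X" using X \<beta> by blast
  have a: "a i \<noteq> \<beta>" if "i \<in> I'" for i using that I' ends \<beta> by blast
  show "2 \<le> cut_size F X + card {i \<in> I'. a i \<in> X}" if "X \<noteq> {}"
  proof -
    have "2 \<le> cut_size (F \<union> star ` I') X"
      using that X \<beta>X by (intro two_edge_connectedD[OF tec]) auto
    then show ?thesis unfolding cut_size_star[OF F I'] using \<beta>X by simp
  qed
  show "2 \<le> cut_size F X + card {i \<in> I'. a i \<notin> X}" if "X \<noteq> A"
  proof -
    have "2 \<le> cut_size (F \<union> star ` I') (insert \<beta> X)"
      using that X \<beta> by (intro two_edge_connectedD[OF tec]) auto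
    moreover have "edge_cut F (insert \<beta> X) = edge_cut F X"
    proof -
      have "e \<inter> insert \<beta> X = e \<inter> X" if "e \<in> F" for e using that F \<beta> by blast
      then show ?thesis unfolding edge_cut_def by auto
    qed
    moreover have "{i \<in> I'. (a i \<in> insert \<beta> X) \<noteq> (\<beta> \<in> insert \<beta> X)} = {i \<in> I'. a i \<notin> X}"
      using a by auto
    ultimately show ?thesis unfolding cut_size_star[OF F I'] by simp
  qed
qed

text \<open>A cut that splits both sides has at least two edges because each side contributes one: on
  either side, the two cuts obtained by adding the contracted vertex or not share at most three
  star edges.\<close>

lemma glue:
  assumes F: "F \<subseteq> inner" and G: "G \<subseteq> outer" and I': "I' \<subseteq> I"
    and tec: "two_edge_connected (insert \<beta> A) (F \<union> star ` I')"
      "two_edge_connected (insert \<alpha> (V - A)) (G \<union> (\<lambda>i. {b i, \<alpha>}) ` I')"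
  shows "two_edge_connected V (F \<union> (G \<union> I'))"
proof -
  interpret B: three_cut V E "V - A" I b a \<beta> \<alpha> by (rule swap)
  have sub: "F \<union> (G \<union> I') \<subseteq> E" using F G I' unfolding I_eq edge_cut_def by auto
  have "finite I'" by (rule finite_subset[OF I' finite_I])
  have "2 \<le> cut_size (F \<union> (G \<union> I')) Z" if Z: "Z \<subseteq> V" "Z \<noteq> {}" "Z \<noteq> V" for Z
  proof -
    define X Y where "X = Z \<inter> A" and "Y = Z - A"
    have XY: "X \<subseteq> A" "Y \<subseteq> V - A" "Z = X \<union> Y" using Z(1) unfolding X_def Y_def by auto
    have mem: "a i \<in> Z \<longleftrightarrow> a i \<in> X" "b i \<in> Z \<longleftrightarrow> b i \<in> Y" if "i \<in> I'" for i
      using ends[of i] that I' unfolding X_def Y_def by blast+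
    have cut: "cut_size (F \<union> (G \<union> I')) Z =
        cut_size F X + cut_size G Y + card {i \<in> I'. (a i \<in> X) \<noteq> (b i \<in> Y)}"
    proof -
      have "{i \<in> I'. (a i \<in> Z) \<noteq> (b i \<in> Z)} = {i \<in> I'. (a i \<in> X) \<noteq> (b i \<in> Y)}"
        using mem by blast
      then show ?thesis unfolding cut_size_split[OF F G I'] X_def Y_def by simp
    qed
    note sA = side_cut[OF F I' XY(1) tec(1)]
    note sB = B.side_cut[OF G I' XY(2) tec(2)]
    have in_ends: "a i \<in> A" "b i \<in> V - A" if "i \<in> I'" for i using ends[of i] that I' by blast+
    consider "X = {}" | "X = A" | "Y = {}" | "Y = V - A"
      | "X \<noteq> {}" "X \<noteq> A" "Y \<noteq> {}" "Y \<noteq> V - A" by blast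
    then show ?thesis
    proof cases
      case 1
      then have "Y \<noteq> {}" using Z(2) XY(3) by simp
      then show ?thesis using sB(1) 1 unfolding cut by simp
    next
      case 2
      then have "Y \<noteq> V - A" using Z(3) XY(3) A by blast
      moreover have "{i \<in> I'. (a i \<in> X) \<noteq> (b i \<in> Y)} = {i \<in> I'. b i \<notin> Y}"
        using 2 in_ends by blast
      ultimately show ?thesis using sB(2) unfolding cut by simp
    next
      case 3
      then have "X \<noteq> {}" using Z(2) XY(3) by simp
      then show ?thesis using sA(1) 3 unfolding cut by simp
    next
      case 4
      then have "X \<noteq> A" using Z(3) XY(3) A by blast
      moreover have "{i \<in> I'. (a i \<in> X) \<noteq> (b i \<in> Y)} = {i \<in> I'. a i \<notin> X}"
        using 4 in_ends by blast
      ultimately show ?thesis using sA(2) unfolding cut by simp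
    next
      case 5
      have split: "card {i \<in> I'. P i} + card {i \<in> I'. \<not> P i} \<le> 3" for P
      proof -
        have "card {i \<in> I'. P i} + card {i \<in> I'. \<not> P i} = card ({i \<in> I'. P i} \<union> {i \<in> I'. \<not> P i})"
          using \<open>finite I'\<close> by (intro card_Un_disjoint[symmetric]) auto
        also have "\<dots> \<le> card I" using I' finite_I by (intro card_mono) auto
        finally show ?thesis using card_I by simp
      qed
      have "1 \<le> cut_size F X" using sA 5 split[of "\<lambda>i. a i \<in> X"] by simp
      moreover have "1 \<le> cut_size G Y" using sB 5 split[of "\<lambda>i. b i \<in> Y"] by simp
      ultimately show ?thesis unfolding cut by simp
    qed
  qed
  moreover have "finite_simple_graph V (F \<union> (G \<union> I'))"
    by (rule finite_simple_graph_mono[OF graph order_refl finite_V sub])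
  ultimately show ?thesis unfolding two_edge_connected_def edge_connected_def by blast
qed

text \<open>The contracted vertex has three star edges and must keep two.\<close>

lemma at_most_one_star_edge:
  assumes "F \<subseteq> inner" "J \<subseteq> I" "two_edge_connected (insert \<beta> A) (F \<union> star ` (I - J))"
  obtains "J = {}" | i where "i \<in> I" "J = {i}"
proof -
  have fin: "finite J" using assms(2) finite_I by (rule finite_subset)
  have "2 \<le> cut_size F {} + card {i \<in> I - J. a i \<notin> {}}"
    using assms \<alpha> by (intro side_cut(2)) auto
  then have "2 \<le> card (I - J)" by (simp add: edge_cut_def set_diff_eq)
  then have "card J \<le> 1" using card_I fin assms(2) by (simp add: card_Diff_subset)
  then consider "card J = 0" | "card J = 1" by linarith
  then show thesis
  proof cases
    case 1 then show thesis using that(1) fin by simp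
  next
    case 2
    then obtain i where "J = {i}" by (auto simp: card_1_singleton_iff)
    then show thesis using that(2) assms(2) by blast
  qed
qed

text \<open>Guarantees that the maximum defining \<open>val J\<close> ranges over a nonempty set,
  with the empty removal as a member.\<close>

lemma two_edge_connected_minus_star_edge:
  assumes "J \<subseteq> I" "card J \<le> 1"
  shows "two_edge_connected (insert \<beta> A) (inner \<union> star ` (I - J))"
proof -
  have G: "finite_simple_graph (insert \<beta> A) (inner \<union> star ` (I - J))"
    using finite_subset[OF A finite_V]
    by (intro finite_simple_graph_mono[OF contracted_graph order_refl]) auto
  have "2 \<le> cut_size (inner \<union> star ` (I - J)) Z"
    if Z: "Z \<subseteq> insert \<beta> A" "Z \<noteq> {}" "Z \<noteq> insert \<beta> A" for Z
  proof -
    have "3 \<le> cut_size (inner \<union> star ` I) Z"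
      using contracted Z unfolding cubic_3_edge_connected_def edge_connected_def by blast
    moreover have "card {i \<in> I. (a i \<in> Z) \<noteq> (\<beta> \<in> Z)} \<le>
        card ({i \<in> I - J. (a i \<in> Z) \<noteq> (\<beta> \<in> Z)} \<union> J)"
      using finite_I finite_subset[OF assms(1) finite_I] by (intro card_mono) auto
    moreover note card_Un_le[of "{i \<in> I - J. (a i \<in> Z) \<noteq> (\<beta> \<in> Z)}" J]
    ultimately show ?thesis
      using assms(2) cut_size_star[of inner I Z] cut_size_star[of inner "I - J" Z] by auto
  qed
  then show ?thesis using G unfolding two_edge_connected_def edge_connected_def by blast
qed

text \<open>\<open>val J\<close> is the best gain on the outer side when the star edges
  \<open>J\<close> are missing there. Deleting the star edge \<open>i\<close> on the inner side
  gains the cut edge itself and changes the outer optimum from \<open>val {}\<close> to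
  \<open>val {i}\<close>; this is the weight it receives.\<close>

lemma removable_glued:
  assumes remA: "\<And>w'. removable (insert \<beta> A) (inner \<union> star ` I) w'"
    and remB: "\<And>w'. removable (insert \<alpha> (V - A)) (outer \<union> (\<lambda>i. {b i, \<alpha>}) ` I) w'"
  shows "removable V E w"
proof -
  interpret B: three_cut V E "V - A" I b a \<beta> \<alpha> by (rule swap)
  define removals where "removals J = {R. R \<subseteq> outer \<and>
    two_edge_connected (insert \<alpha> (V - A)) ((outer - R) \<union> B.star ` (I - J))}" for J
  define val where "val J = Max (sum w ` removals J)" for J
  have fin: "finite (sum w ` removals J)" for J
  proof -
    have "removals J \<subseteq> Pow E" unfolding removals_def by blast
    then show ?thesis using finite_E by (intro finite_imageI) (auto intro: finite_subset)
  qed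
  have val_ge: "sum w R \<le> val J" if "R \<in> removals J" for R J
    unfolding val_def using fin that by (intro Max_ge) auto
  have val_attained: "\<exists>R\<in>removals J. sum w R = val J" if "J \<subseteq> I" "card J \<le> 1" for J
  proof -
    have "{} \<in> removals J"
      unfolding removals_def using B.two_edge_connected_minus_star_edge[OF that] by simp
    then have "val J \<in> sum w ` removals J"
      unfolding val_def using fin by (intro Max_in) auto
    then show ?thesis by auto
  qed
  have disj: "inner \<inter> star ` I = {}" "outer \<inter> B.star ` I = {}"
    using star_not_inner B.star_not_inner by blast+
  have disjL: "inner \<inter> (outer \<union> I) = {}" "outer \<inter> I = {}"
  proof -
    have "e \<notin> I \<and> \<not> (e \<subseteq> A \<and> e \<subseteq> V - A)" if e: "e \<in> E" "e \<subseteq> A \<or> e \<subseteq> V - A" for e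
    proof -
      obtain p q where "p \<in> V" "q \<in> V" "p \<noteq> q" "e = {p, q}"
        by (rule finite_simple_graph_edgeE[OF graph e(1)])
      then show ?thesis using e card_doubleton_Int_eq_1[of p q A] unfolding I_eq edge_cut_def by
          auto
    qed
    then show "inner \<inter> (outer \<union> I) = {}" "outer \<inter> I = {}" by blast+
  qed
  have finEI: "finite outer" "finite inner" using finite_E by simp_all
  \<comment> \<open>Weight \<open>val {} - val {i}\<close> on the outer star edges makes every
    admissible deletion worth at most \<open>val {}\<close>, whether it takes one star edge or none.
    The claim for the outer side then yields just the gain condition needed below.\<close>
  have bound: "2 / 9 * (sum w outer + (\<Sum>i\<in>I. val {} - val {i})) \<le> val {}"
  proof -
    obtain M J where M: "M \<subseteq> outer" "J \<subseteq> I"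
      "two_edge_connected (insert \<alpha> (V - A)) ((outer - M) \<union> B.star ` (I - J))"
      "2 / 9 * (sum w outer + (\<Sum>i\<in>I. val {} - val {i})) \<le> sum w M + (\<Sum>i\<in>J. val {} - val {i})"
      by (rule removable_indexed[OF finEI(1) finite_I B.star_inj disj(2) remB])
    then have le: "sum w M \<le> val J" by (intro val_ge) (simp add: removals_def)
    have "sum w M + (\<Sum>i\<in>J. val {} - val {i}) \<le> val {}"
      by (rule B.at_most_one_star_edge[OF Diff_subset M(2,3)]) (use le in simp_all)
    then show ?thesis using M(4) by simp
  qed
  have "removable V (inner \<union> (outer \<union> I)) w"
  proof (rule removable_lift[where n = star and I = I and \<nu> = "\<lambda>i. w i + val {i} - val {}"
        and C = "val {}", OF _ _ finite_I star_inj disj(1) disjL(1) remA])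
    fix J X assume J: "J \<subseteq> I" and X: "X \<subseteq> inner"
      and tec: "two_edge_connected (insert \<beta> A) (X \<union> star ` (I - J))"
    have "card J \<le> 1 \<and> val {} + (\<Sum>i\<in>J. w i + val {i} - val {}) = val J + sum w J"
      by (rule at_most_one_star_edge[OF X J tec]) simp_all
    then have J1: "card J \<le> 1"
      and C: "val {} + (\<Sum>i\<in>J. w i + val {i} - val {}) = val J + sum w J" by simp_all
    obtain R where R: "R \<in> removals J" "sum w R = val J"
      using val_attained[OF J J1] by blast
    then have R': "R \<subseteq> outer"
      "two_edge_connected (insert \<alpha> (V - A)) ((outer - R) \<union> B.star ` (I - J))"
      unfolding removals_def by blast+
    have "two_edge_connected V (X \<union> ((outer - R) \<union> (I - J)))"
      by (rule glue[OF X Diff_subset Diff_subset tec]) (rule R'(2))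
    moreover have "(outer - R) \<union> (I - J) = (outer \<union> I) - (R \<union> J)"
      using R'(1) J disjL(2) by blast
    moreover have "sum w (R \<union> J) = val J + sum w J"
    proof -
      have "R \<inter> J = {}" using R'(1) J disjL(2) by blast
      then show ?thesis
        using R(2) finite_subset[OF R'(1) finEI(1)] finite_subset[OF J finite_I]
        by (simp add: sum.union_disjoint)
    qed
    ultimately show "\<exists>R\<subseteq>outer \<union> I. two_edge_connected V (X \<union> (outer \<union> I - R)) \<and>
        val {} + (\<Sum>i\<in>J. w i + val {i} - val {}) \<le> sum w R"
      using R'(1) J C by (intro exI[of _ "R \<union> J"]) auto
  next
    have "sum w (outer \<union> I) = sum w outer + sum w I"
      using finEI finite_I disjL(2) by (simp add: sum.union_disjoint)
    moreover have "(\<Sum>i\<in>I. w i + val {i} - val {}) = sum w I - (\<Sum>i\<in>I. val {} - val {i})"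
      by (simp add: sum.distrib sum_subtractf)
    moreover have "(\<Sum>i\<in>I. val {} - val {i}) = 3 * val {} - (\<Sum>i\<in>I. val {i})"
      using card_I by (simp add: sum_subtractf)
    ultimately show "2 / 9 * sum w (outer \<union> I) \<le>
        val {} + 2 / 9 * (\<Sum>i\<in>I. w i + val {i} - val {})"
      using bound by (simp add: field_simps)
  qed (use finEI finite_I in simp_all)
  then show ?thesis using E_split by simp
qed

end

section \<open>The complete graph on four vertices\<close>

lemma two_edge_connected_square:
  assumes "p \<noteq> q" "p \<noteq> r" "p \<noteq> s" "q \<noteq> r" "q \<noteq> s" "r \<noteq> s"
  shows "two_edge_connected {p, q, r, s} {{p, q}, {q, r}, {r, s}, {s, p}}"
proof -
  have "two_edge_connected {p} {}"
    unfolding two_edge_connected_def finite_simple_graph_def edge_connected_def by auto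
  \<comment> \<open>A closed ear at a single vertex yields a triangle, and subdividing one edge of
    it the 4-cycle.\<close>
  then have "two_edge_connected (insert s (insert q {p})) (insert {q, p} (insert {q, s}
      (insert {s, p} {})))"
    using assms by (intro two_edge_connected_add_ear2) auto
  then have "two_edge_connected {s, q, p} (insert {q, s} (insert {q, p} (insert {s, p} {})))"
    by (simp add: insert_commute)
  then have "two_edge_connected (insert r {s, q, p})
      (insert {r, q} (insert {r, s} (insert {q, p} (insert {s, p} {}))))"
    using assms by (intro two_edge_connected_subdivide) auto
  then show ?thesis by (simp add: insert_commute)
qed

text \<open>The edges split into three perfect matchings, each with a 4-cycle as complement. The
  heaviest has at least a third of the weight, which exceeds 2/9 unless the weight is zero.\<close>

lemma K4_removable:
  assumes ne: "p \<noteq> q" "p \<noteq> r" "p \<noteq> s" "q \<noteq> r" "q \<noteq> s" "r \<noteq> s"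
    and V: "V = {p, q, r, s}"
    and E: "E = {{p, q}, {p, r}, {p, s}, {q, r}, {q, s}, {r, s}}"
    and nonneg: "\<And>e. 0 \<le> w e"
  shows "removable V E w"
proof -
  define M1 M2 M3 where "M1 = {{p, q}, {r, s}}" and "M2 = {{p, r}, {q, s}}"
      and "M3 = {{p, s}, {q, r}}"
  have "E - M1 = {{p, r}, {r, q}, {q, s}, {s, p}}" "E - M2 = {{p, q}, {q, r}, {r, s}, {s, p}}"
    "E - M3 = {{p, q}, {q, s}, {s, r}, {r, p}}"
    unfolding E M1_def M2_def M3_def using ne
    by (simp_all add: insert_Diff_if doubleton_eq_iff insert_commute)
  then have tec: "two_edge_connected V (E - M1)" "two_edge_connected V (E - M2)"
    "two_edge_connected V (E - M3)"
    using two_edge_connected_square[of p r q s] two_edge_connected_square[of p q r s]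
      two_edge_connected_square[of p q s r] ne
    unfolding V by (simp_all add: insert_commute)
  have "sum w E = sum w M1 + sum w M2 + sum w M3"
    unfolding E M1_def M2_def M3_def using ne by (simp add: doubleton_eq_iff)
  moreover have "0 \<le> sum w E" using nonneg by (simp add: sum_nonneg)
  ultimately have "2 / 9 * sum w E \<le> sum w M1 \<or> 2 / 9 * sum w E \<le> sum w M2
      \<or> 2 / 9 * sum w E \<le> sum w M3"
    by linarith
  moreover have "M1 \<subseteq> E" "M2 \<subseteq> E" "M3 \<subseteq> E" unfolding E M1_def M2_def M3_def by simp_all
  ultimately show ?thesis using tec unfolding removable_def by blast
qed

subsection \<open>Cubic \<open>3\<close>-edge connected graphs\<close>

lemma removable_3_cut:
  fixes V :: "'a set"
  assumes G: "cubic_3_edge_connected V E"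
    and IH: "\<And>(V' :: 'a set) E' w'. card V' < card V \<Longrightarrow> cubic_3_edge_connected V' E' \<Longrightarrow>
      removable V' E' w'"
    and A: "A \<subseteq> V" "cut_size E A \<le> 3"
    and two: "\<exists>p\<in>A. \<exists>q\<in>A. p \<noteq> q" "\<exists>p\<in>V - A. \<exists>q\<in>V - A. p \<noteq> q"
  shows "removable V E w"
proof -
  have graph: "finite_simple_graph V E" "cubic V E" "edge_connected 3 V E"
    using G unfolding cubic_3_edge_connected_def by simp_all
  obtain \<alpha> \<beta> where \<alpha>\<beta>: "\<alpha> \<in> A" "\<beta> \<in> V - A" using two by blast
  define I where "I = edge_cut E A"
  have "A \<noteq> {}" "A \<noteq> V" using \<alpha>\<beta> by blast+
  then have card_I: "card I = 3"
    using A graph(3)[unfolded edge_connected_def, rule_format, of A] unfolding I_def by simp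
  have "\<forall>i\<in>I. \<exists>p q. i = {p, q} \<and> p \<in> A \<and> q \<in> V - A"
  proof
    fix i assume i: "i \<in> I"
    then have "i \<in> E" unfolding I_def edge_cut_def by simp
    then obtain p q where pq: "p \<in> V" "q \<in> V" "p \<noteq> q" "i = {p, q}"
      by (rule finite_simple_graph_edgeE[OF graph(1)])
    then have "(p \<in> A) \<noteq> (q \<in> A)"
      using i card_doubleton_Int_eq_1[of p q A] unfolding I_def edge_cut_def by simp
    then show "\<exists>p q. i = {p, q} \<and> p \<in> A \<and> q \<in> V - A"
    proof (cases "p \<in> A")
      case True
      with \<open>(p \<in> A) \<noteq> (q \<in> A)\<close> pq show ?thesis by (intro exI[of _ p] exI[of _ q]) simp
    next
      case False
      with \<open>(p \<in> A) \<noteq> (q \<in> A)\<close> pq show ?thesis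
        by (intro exI[of _ q] exI[of _ p]) (simp add: insert_commute)
    qed
  qed
  then obtain a b where ab: "\<And>i. i \<in> I \<Longrightarrow> i = {a i, b i} \<and> a i \<in> A \<and> b i \<in> V - A"
    by (elim bchoice[THEN exE] exE) (metis (no_types))
  interpret three_cut V E A I a b \<alpha> \<beta>
    by unfold_locales (fact graph A(1) card_I I_def ab two \<alpha>\<beta>)+
  interpret B: three_cut V E "V - A" I b a \<beta> \<alpha> by (rule swap)
  show ?thesis
    by (rule removable_glued[OF IH[OF card_contracted contracted]
          IH[OF B.card_contracted B.contracted]])
qed

text \<open>The cut around a triangle has three edges, so by \<open>four\<close> only one vertex
  lies outside; the third neighbours of all corners coincide with it.\<close>

lemma triangle_removable:
  assumes graph: "finite_simple_graph V E" and cubic: "cubic V E" and nonneg: "\<And>e. 0 \<le> w e"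
    and four: "\<And>A s t s' t'. A \<subseteq> V \<Longrightarrow> s \<in> A \<Longrightarrow> t \<in> A \<Longrightarrow> s \<noteq> t \<Longrightarrow>
      s' \<in> V - A \<Longrightarrow> t' \<in> V - A \<Longrightarrow> s' \<noteq> t' \<Longrightarrow> 4 \<le> cut_size E A"
    and tri: "{p, q} \<in> E" "{q, r} \<in> E" "{p, r} \<in> E"
  shows "removable V E w"
proof -
  have tri': "{q, p} \<in> E" "{r, q} \<in> E" "{r, p} \<in> E" using tri by (simp_all add: insert_commute)
  have ne: "p \<noteq> q" "q \<noteq> r" "p \<noteq> r" using edge_neq[OF graph] tri by metis+
  obtain p' where p': "p' \<noteq> q" "p' \<noteq> r" "\<And>z. {p, z} \<in> E \<longleftrightarrow> z = q \<or> z = r \<or> z = p'"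
    by (rule cubic_third_neighbour[OF graph cubic tri(1,3) ne(2)]) blast
  obtain q' where q': "q' \<noteq> p" "q' \<noteq> r" "\<And>z. {q, z} \<in> E \<longleftrightarrow> z = p \<or> z = r \<or> z = q'"
    by (rule cubic_third_neighbour[OF graph cubic tri'(1) tri(2) ne(3)]) blast
  obtain r' where r': "r' \<noteq> p" "r' \<noteq> q" "\<And>z. {r, z} \<in> E \<longleftrightarrow> z = p \<or> z = q \<or> z = r'"
    by (rule cubic_third_neighbour[OF graph cubic tri'(3,2) ne(1)]) blast
  have ne': "p' \<noteq> p" "q' \<noteq> q" "r' \<noteq> r"
    using edge_neq[OF graph, of p p'] edge_neq[OF graph, of q q'] edge_neq[OF graph, of r r']
      p'(3) q'(3) r'(3) by metis+
  have in_V: "p \<in> V" "q \<in> V" "r \<in> V" "p' \<in> V" "q' \<in> V" "r' \<in> V"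
    using edge_in[OF graph, of p p'] edge_in[OF graph, of q q'] edge_in[OF graph, of r r']
      p'(3) q'(3) r'(3) by simp_all
  have "cut_size E {} = 0" unfolding edge_cut_def by simp
  moreover have "cut_size E {p} = cut_size E {} + 3"
    using cut_size_insert_vertex[OF graph _ p'(3), of "{}"] p' ne by simp
  moreover have "cut_size E {q, p} + 1 = cut_size E {p} + 2"
    using cut_size_insert_vertex[OF graph _ q'(3), of "{p}"] q' ne by simp
  moreover have "cut_size E {r, q, p} + 2 = cut_size E {q, p} + 1"
    using cut_size_insert_vertex[OF graph _ r'(3), of "{q, p}"] r' ne by simp
  ultimately have cut: "cut_size E {r, q, p} = 3" by simp
  have only: "s = p'" if "s \<in> V - {r, q, p}" for s
  proof (rule ccontr)
    assume "s \<noteq> p'"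
    then have "4 \<le> cut_size E {r, q, p}"
      using four[of "{r, q, p}" r q s p'] that in_V ne ne' p' by auto
    then show False using cut by simp
  qed
  have eqs: "q' = p'" "r' = p'" using only[of q'] only[of r'] in_V q' r' ne' by auto
  have "V = {p, q, r, p'}" using only in_V by blast
  moreover have "E = {{p, q}, {p, r}, {p, p'}, {q, r}, {q, p'}, {r, p'}}"
  proof -
    have "p \<in> e \<or> q \<in> e \<or> r \<in> e" if e: "e \<in> E" for e
    proof -
      obtain x y where "x \<in> V" "y \<in> V" "x \<noteq> y" "e = {x, y}"
        by (rule finite_simple_graph_edgeE[OF graph e])
      then show ?thesis using only[of x] only[of y] by auto
    qed
    then have "E = {e \<in> E. p \<in> e} \<union> {e \<in> E. q \<in> e} \<union> {e \<in> E. r \<in> e}" by blast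
    then show ?thesis
      unfolding incident_edges[OF graph p'(3)] incident_edges[OF graph q'(3)]
        incident_edges[OF graph r'(3)] eqs
      by (simp add: insert_commute)
  qed
  ultimately show ?thesis using p' q' r' ne ne' eqs nonneg by (intro K4_removable) auto
qed

lemma removable_cubic_3_edge_connected:
  assumes "cubic_3_edge_connected V E"
  shows "removable V E w"
  using assms
proof (induction "card V" arbitrary: V E w rule: less_induct)
  case (less V E w)
  have IH: "\<And>(V' :: 'a set) E' w'. card V' < card V \<Longrightarrow> cubic_3_edge_connected V' E' \<Longrightarrow>
      removable V' E' w'"
    by (rule less.hyps)
  have graph: "finite_simple_graph V E" "cubic V E" "edge_connected 3 V E"
    using less.prems unfolding cubic_3_edge_connected_def by simp_all
  \<comment> \<open>Only the weights of the current graph are truncated; the induction hypothesis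
    stays available for all real weights, as the reductions require.\<close>
  define w' where "w' = (\<lambda>e. max 0 (w e))"
  have nonneg: "\<And>e. 0 \<le> w' e" unfolding w'_def by simp
  consider (empty) "E = {}"
    | (cut) A s t s' t' where "A \<subseteq> V" "s \<in> A" "t \<in> A" "s \<noteq> t" "s' \<in> V - A" "t' \<in> V - A" "s' \<noteq> t'"
      "\<not> 4 \<le> cut_size E A"
    | (essential) "E \<noteq> {}" "\<And>A s t s' t'. A \<subseteq> V \<Longrightarrow> s \<in> A \<Longrightarrow> t \<in> A \<Longrightarrow> s \<noteq> t \<Longrightarrow>
      s' \<in> V - A \<Longrightarrow> t' \<in> V - A \<Longrightarrow> s' \<noteq> t' \<Longrightarrow> 4 \<le> cut_size E A"
    by blast
  then have "removable V E w'"
  proof cases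
    case empty
    \<comment> \<open>Without edges every degree is zero, so there is no vertex.\<close>
    then have "V = {}" using graph(2) unfolding cubic_def vertex_degree_def by auto
    then show ?thesis
      using empty graph(1)
      unfolding removable_def two_edge_connected_def edge_connected_def by auto
  next
    case cut
    then show ?thesis by (intro removable_3_cut[OF less.prems IH]) auto
  next
    case essential
    show ?thesis
    proof (cases "\<exists>p q r. {p, q} \<in> E \<and> {q, r} \<in> E \<and> {p, r} \<in> E")
      case True
      then obtain p q r where tri: "{p, q} \<in> E" "{q, r} \<in> E" "{p, r} \<in> E" by blast
      show ?thesis by (rule triangle_removable[where w = w', OF graph(1,2) nonneg essential(2) tri])
    next
      case False
      interpret essentially_4_edge_connected V E
        using graph essential(2) False by unfold_locales blast+
      show ?thesis by (rule removable_nonneg[where w = w', OF IH nonneg essential(1)])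
    qed
  qed
  then show ?case unfolding w'_def by (rule removable_if_nonneg[OF graph(1)])
qed

lemma cubic_edge_count:
  assumes "finite_simple_graph V E" "cubic V E"
  shows "2 * card E = 3 * card V"
proof -
  have "(\<Sum>z\<in>V. \<Sum>e | e \<in> E \<and> z \<in> e. 1) = (\<Sum>e\<in>E. \<Sum>z\<in>e. 1 :: nat)"
    by (rule sum_incident_edges[OF assms(1)])
  moreover have "(\<Sum>z\<in>V. \<Sum>e | e \<in> E \<and> z \<in> e. 1 :: nat) = (\<Sum>z\<in>V. 3)"
    using assms(2) unfolding cubic_def vertex_degree_def by (intro sum.cong) simp_all
  moreover have "(\<Sum>e\<in>E. \<Sum>z\<in>e. 1) = (\<Sum>e\<in>E. 2 :: nat)"
  proof (rule sum.cong)
    fix e assume "e \<in> E"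
    then show "(\<Sum>z\<in>e. 1) = (2 :: nat)"
      by (rule finite_simple_graph_edgeE[OF assms(1)]) simp
  qed simp
  ultimately show ?thesis by simp
qed

theorem corollary1:
  fixes V :: "'a set" and E :: "'a set set" and n :: nat
  assumes "finite_simple_graph V E"
    and "cubic V E"
    and "edge_connected 3 V E"
    and "n = card V"
  shows "\<exists>V\<^sub>H E\<^sub>H. spanning_subgraph V\<^sub>H E\<^sub>H V E \<and> edge_connected 2 V\<^sub>H E\<^sub>H \<and>
           real (card E\<^sub>H) \<le> 7 / 6 * real n"
proof -
  have "removable V E (\<lambda>e. 1)"
    using assms(1-3) by (intro removable_cubic_3_edge_connected) (simp add:
        cubic_3_edge_connected_def)
  then obtain M where M: "M \<subseteq> E" "two_edge_connected V (E - M)"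
    "2 / 9 * real (card E) \<le> real (card M)"
    unfolding removable_def by auto
  have fin: "finite E" by (rule finite_simple_graph_finite_edges[OF assms(1)])
  then have "card (E - M) = card E - card M" "card M \<le> card E"
    using M(1) by (simp_all add: card_Diff_subset card_mono finite_subset)
  then have "real (card (E - M)) = real (card E) - real (card M)" by (simp add: of_nat_diff)
  moreover have "2 * real (card E) = 3 * real n"
    using arg_cong[OF cubic_edge_count[OF assms(1,2)], of real] assms(4) by simp
  ultimately have "real (card (E - M)) \<le> 7 / 6 * real n" using M(3) by linarith
  moreover have "spanning_subgraph V (E - M) V E"
    unfolding spanning_subgraph_def subgraph_def
    using finite_simple_graph_edge_subset[OF assms(1)] by auto
  ultimately show ?thesis using M(2) unfolding two_edge_connected_def by blast
qed

end
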